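(* Let $f$ be a quasi-majority function and $\rho\in(0,1]$ an arbitrary constant. Consider the $\rho$-lazy variant of the functional voting with respect to $f$ on the Erdős–Rényi graph $G(n,p)$ with vertex set $V$, and suppose that $p=p(n)=\Omega(1/\sqrt n)$. Then, w.h.p. over $G(n,p)$, for every $A\subseteq V$, $T_{\mathrm{cons}}(A)=O(\log n)$ w.h.p.
   Context: $G(n,p)$ is the random graph on $n$ vertices in which each of the $\binom n2$ pairs is an edge independently with probability $p$. For $v\in V$, $S\subseteq V$, $\deg_S(v)$ is the number of neighbours of $v$ in $S$. Functional voting: let $f:\mathbb R\to\mathbb R$ satisfy $f([0,1])=[0,1]$ and $f(0)=0$. Functional voting with respect to $f$ is the Markov chain $A_0,A_1,\dots$ on subsets of $V$ ($A_t$ is the set of vertices holding opinion $0$, the others hold opinion $1$) in which, given $A_t=A$ and $B=V\setminus A$, all vertices update simultaneously and independently: $v\in B$ belongs to $A_{t+1}$ with probability $f(\deg_A(v)/\deg(v))$, and $v\in A$ belongs to $V\setminus A_{t+1}$ with probability $f(\deg_B(v)/\deg(v))$. In the $\rho$-lazy variant, in each round every vertex independently performs the functional voting update with respect to $f$ (switching opinion with probability $f(\deg_A(v)/\deg(v))$ if $v\in B$, and with probability $f(\deg_B(v)/\deg(v))$ if $v\in A$) with probability $\rho$ and does nothing (keeps its opinion) with probability $1-\rho$; i.e. the switching probabilities $f(\cdot)$ are replaced by $\rho f(\cdot)$. $T_{\mathrm{cons}}(A)=\min\{t\ge0: A_t\in\{\emptyset,V\}\}$ for the (lazy) chain started at $A_0=A$.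 The updating function is $H_f(x)=x(1-f(1-x))+(1-x)f(x)$. Such an $f$ is quasi-majority if: (1) $f$ is $C^2$; (2) $0<f(1/2)<1$; (3) $H_f(x)<x$ for all $x\in(0,1/2)$; (4) $H_f'(1/2)>1$; (5) $H_f'(0)<1$. Conventions: "w.h.p." means with probability at least $1-n^{-c}$ for a constant $c>0$, and $n$ is sufficiently large. The outer "w.h.p." refers to the randomness of the graph, the inner one to the randomness of the voting process on the realized graph. Constants hidden in $O$ and in w.h.p. do not depend on $n$, on the realized graph or on $A$. *)

theory Defs
  imports "HOL-Probability.Probability" "HOL-Library.Landau_Symbols" "HOL-Library.Ramsey"
begin

section \<open>Updating functions\<close>

definition updating :: "(real \<Rightarrow> real) \<Rightarrow> real \<Rightarrow> real" where
  "updating f x = x * (1 - f (1 - x)) + (1 - x) * f x"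

definition C2 :: "(real \<Rightarrow> real) \<Rightarrow> bool" where
  "C2 f \<longleftrightarrow> f differentiable_on UNIV \<and> deriv f differentiable_on UNIV
     \<and> continuous_on UNIV (deriv (deriv f))"

definition voting_function :: "(real \<Rightarrow> real) \<Rightarrow> bool" where
  "voting_function f \<longleftrightarrow> f ` {0..1} = {0..1} \<and> f 0 = 0"

definition quasi_majority :: "(real \<Rightarrow> real) \<Rightarrow> bool" where
  "quasi_majority f \<longleftrightarrow> voting_function f
     \<and> C2 f
     \<and> 0 < f (1/2) \<and> f (1/2) < 1
     \<and> (\<forall>x\<in>{0<..<1/2}. updating f x < x)
     \<and> deriv (updating f) (1/2) > 1
     \<and> deriv (updating f) 0 < 1"


section \<open>The random graph G(n,p)\<close>

text \<open>A simple graph on a vertex set \<open>V\<close> is given by its edge set, a set of two-element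
  subsets of \<open>V\<close>. The vertex set of \<open>G(n,p)\<close> is \<open>{..<n}\<close>.\<close>

definition gnp :: "nat \<Rightarrow> real \<Rightarrow> nat set set pmf" where
  "gnp n p = map_pmf (\<lambda>present. {e \<in> nsets {..<n} 2. present e})
     (Pi_pmf (nsets {..<n} 2) False (\<lambda>_. bernoulli_pmf p))"

definition degree_in :: "'a set set \<Rightarrow> 'a set \<Rightarrow> 'a \<Rightarrow> nat" where
  "degree_in E S v = card {u \<in> S. {u, v} \<in> E}"


section \<open>Lazy functional voting\<close>

text \<open>In the following \<open>A\<close> is the set of vertices holding opinion 0, and a Boolean records
  whether a vertex holds opinion 0. The argument of \<open>f\<close> is 0 for an isolated vertex,
  as \<open>x / 0 = 0\<close>, so such a vertex never switches.\<close>

definition vertex_update ::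
    "(real \<Rightarrow> real) \<Rightarrow> 'a set \<Rightarrow> 'a set set \<Rightarrow> 'a set \<Rightarrow> 'a \<Rightarrow> bool pmf" where
  "vertex_update f V E A v =
     (if v \<in> A
      then map_pmf Not (bernoulli_pmf (f (real (degree_in E (V - A) v) / real (degree_in E V v))))
      else bernoulli_pmf (f (real (degree_in E A v) / real (degree_in E V v))))"

definition lazy_vertex_update ::
    "(real \<Rightarrow> real) \<Rightarrow> real \<Rightarrow> 'a set \<Rightarrow> 'a set set \<Rightarrow> 'a set \<Rightarrow> 'a \<Rightarrow> bool pmf" where
  "lazy_vertex_update f \<rho> V E A v =
     bind_pmf (bernoulli_pmf \<rho>)
       (\<lambda>active. if active then vertex_update f V E A v else return_pmf (v \<in> A))"

definition voting_step ::
    "(real \<Rightarrow> real) \<Rightarrow> real \<Rightarrow> 'a set \<Rightarrow> 'a set set \<Rightarrow> 'a set \<Rightarrow> 'a set pmf" where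
  "voting_step f \<rho> V E A =
     map_pmf (\<lambda>opinion0. {v \<in> V. opinion0 v}) (Pi_pmf V False (lazy_vertex_update f \<rho> V E A))"


section \<open>The law of the chain on trajectories\<close>

text \<open>For a transition kernel \<open>K\<close> and an initial state \<open>a\<close>, the law on
  \<open>nat \<Rightarrow> 's\<close> of the Markov chain is obtained from the Ionescu-Tulcea theorem; its
  finite-dimensional distributions are computed in \<open>emeasure_markov_chain\<close> below.\<close>

definition chain_kernel :: "('s \<Rightarrow> 's pmf) \<Rightarrow> 's \<Rightarrow> nat \<Rightarrow> (nat \<Rightarrow> 's) \<Rightarrow> 's measure" where
  "chain_kernel K a t \<omega> = measure_pmf (if t = 0 then return_pmf a else K (\<omega> (t - 1)))"

definition markov_chain :: "('s \<Rightarrow> 's pmf) \<Rightarrow> 's \<Rightarrow> (nat \<Rightarrow> 's) measure" where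
  "markov_chain K a =
     projective_family.lim UNIV
       (Ionescu_Tulcea.CI (chain_kernel K a) (\<lambda>_. count_space UNIV)) (\<lambda>_. count_space UNIV)"

lemma Ionescu_Tulcea_chain_kernel:
  fixes K :: "'s \<Rightarrow> 's pmf"
  shows "Ionescu_Tulcea (chain_kernel K a) (\<lambda>_. count_space UNIV)"
proof (rule Ionescu_Tulcea.intro)
  fix i :: nat
  show "chain_kernel K a i \<in> PiM {0..<i} (\<lambda>_. count_space UNIV) \<rightarrow>\<^sub>M subprob_algebra (count_space UNIV)"
  proof (cases i)
    case 0
    then show ?thesis
      by (auto simp: chain_kernel_def[abs_def] space_subprob_algebra
            intro!: measurable_const prob_space_imp_subprob_space measure_pmf.prob_space_axioms)
  next
    case (Suc j)
    have "(\<lambda>s. measure_pmf (K s)) \<in> count_space UNIV \<rightarrow>\<^sub>M subprob_algebra (count_space UNIV)"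
      by (auto simp: space_subprob_algebra
            intro!: prob_space_imp_subprob_space measure_pmf.prob_space_axioms)
    moreover have "(\<lambda>\<omega>. \<omega> j) \<in> PiM {0..<i} (\<lambda>_. count_space UNIV) \<rightarrow>\<^sub>M count_space UNIV"
      using Suc by (intro measurable_component_singleton) auto
    ultimately show ?thesis
      using Suc by (auto simp: chain_kernel_def[abs_def] intro: measurable_compose)
  qed
next
  fix i :: nat and x :: "nat \<Rightarrow> 's"
  assume "x \<in> space (PiM {0..<i} (\<lambda>_. count_space UNIV))"
  show "prob_space (chain_kernel K a i x)"
    by (simp add: chain_kernel_def measure_pmf.prob_space_axioms)
qed

lemma sets_markov_chain [measurable_cong]:
  "sets (markov_chain K a) = sets (PiM UNIV (\<lambda>_. count_space UNIV))"
proof -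
  interpret Ionescu_Tulcea "chain_kernel K a" "\<lambda>_. count_space UNIV"
    by (rule Ionescu_Tulcea_chain_kernel)
  show ?thesis
    by (simp add: markov_chain_def)
qed

lemma space_markov_chain [simp]: "space (markov_chain K a) = UNIV"
  by (subst sets_eq_imp_space_eq[OF sets_markov_chain]) (simp add: space_PiM)

lemma emeasure_markov_chain:
  "emeasure (markov_chain K a) {\<omega>. \<forall>i\<le>t. \<omega> i = x i} =
     ennreal (indicator {a} (x 0) * (\<Prod>i<t. pmf (K (x i)) (x (Suc i))))"
proof -
  interpret IT: Ionescu_Tulcea "chain_kernel K a" "\<lambda>_. count_space UNIV"
    by (rule Ionescu_Tulcea_chain_kernel)
  let ?M = "\<lambda>_::nat. count_space UNIV"
  let ?u = "\<lambda>_::nat. undefined"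
  let ?K = "\<lambda>i. if i = 0 then return_pmf a else K (x (i - 1))"
  define Q where "Q n = {restrict x {0..<n}}" for n
  have Q: "Q n \<in> sets (PiM {0..<n} ?M)" for n
  proof -
    have "Q n = PiE {0..<n} (\<lambda>i. {x i})"
      unfolding Q_def PiE_singleton[OF restrict_extensional, symmetric] by (intro PiE_cong) auto
    also have "\<dots> \<in> sets (PiM {0..<n} ?M)"
      by (intro sets_PiM_I_finite) auto
    finally show ?thesis .
  qed
  have u: "?u \<in> space (PiM {0..<0} ?M)"
    by (simp add: space_PiM)
  have step: "emeasure (IT.eP n \<omega>) (Q (Suc n)) = ennreal (pmf (?K n) (x n)) * indicator (Q n) \<omega>"
    if \<omega>: "\<omega> \<in> space (PiM {0..<n} ?M)" for n \<omega>
  proof -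
    have ext: "\<omega> \<in> extensional {0..<n}"
      using \<omega> by (simp add: space_PiM PiE_def)
    have eq: "fun_upd \<omega> n y = restrict x {0..<Suc n} \<longleftrightarrow> \<omega> = restrict x {0..<n} \<and> y = x n" for y
      using ext by (auto simp: fun_eq_iff extensional_def restrict_def less_Suc_eq)
    have "emeasure (IT.eP n \<omega>) (Q (Suc n))
        = emeasure (chain_kernel K a n \<omega>) {y. \<omega> = restrict x {0..<n} \<and> y = x n}"
      by (subst IT.emeasure_eP[OF \<omega> Q]) (simp add: Q_def vimage_def eq del: fun_upd_apply)
    also have "\<dots> = ennreal (pmf (?K n) (x n)) * indicator (Q n) \<omega>"
      by (cases "\<omega> = restrict x {0..<n}")
         (auto simp: Q_def chain_kernel_def emeasure_pmf_single)
    finally show ?thesis .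
  qed
  have C: "emeasure (IT.C 0 n ?u) (Q n) = ennreal (\<Prod>i<n. pmf (?K i) (x i))" for n
  proof (induction n)
    case 0
    have "?u \<in> Q 0" by (simp add: Q_def restrict_def)
    then show ?case
      using Q[of 0] by (simp add: emeasure_return)
  next
    case (Suc n)
    have sp: "space (IT.C 0 n ?u) = space (PiM {0..<n} ?M)"
      using IT.space_C[OF u, of n] by simp
    have st: "sets (IT.C 0 n ?u) = sets (PiM {0..<n} ?M)"
      using IT.sets_C[OF u, of n] by simp
    have ne: "space (IT.C 0 n ?u) \<noteq> {}"
      by (rule prob_space.not_empty[OF IT.prob_space_C[OF u]])
    have "emeasure (IT.C 0 (Suc n) ?u) (Q (Suc n))
        = (\<integral>\<^sup>+\<omega>. emeasure (IT.eP n \<omega>) (Q (Suc n)) \<partial>IT.C 0 n ?u)"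
      using IT.measurable_eP[of n] Q[of "Suc n"]
      by (simp add: emeasure_bind[OF ne, where N = "PiM {0..<Suc n} ?M"] measurable_cong_sets[OF st refl])
    also have "\<dots> = (\<integral>\<^sup>+\<omega>. ennreal (pmf (?K n) (x n)) * indicator (Q n) \<omega> \<partial>IT.C 0 n ?u)"
      by (intro nn_integral_cong step) (simp add: sp)
    also have "\<dots> = ennreal (pmf (?K n) (x n)) * emeasure (IT.C 0 n ?u) (Q n)"
      using Q[of n] by (simp add: nn_integral_cmult_indicator st)
    also have "\<dots> = ennreal (\<Prod>i<Suc n. pmf (?K i) (x i))"
      unfolding Suc.IH
      by (subst ennreal_mult[symmetric]) (auto simp: mult.commute intro!: prod_nonneg)
    finally show ?case .
  qed
  have emb: "prod_emb UNIV ?M {0..<Suc t} (Q (Suc t)) = {\<omega>. \<forall>i\<le>t. \<omega> i = x i}"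
    by (auto simp: prod_emb_def Q_def fun_eq_iff restrict_def less_Suc_eq_le) metis
  have "emeasure (markov_chain K a) {\<omega>. \<forall>i\<le>t. \<omega> i = x i} = emeasure (IT.CI {0..<Suc t}) (Q (Suc t))"
    unfolding markov_chain_def emb[symmetric] by (rule IT.lim) (auto simp: Q)
  also have "\<dots> = emeasure (IT.C 0 (Suc t) ?u) (Q (Suc t))"
    using IT.emeasure_CI[OF subset_refl Q] prod_emb_id[of "Q (Suc t)" "{0..<Suc t}" ?M]
    by (auto simp: Q_def)
  also have "\<dots> = ennreal (\<Prod>i<Suc t. pmf (?K i) (x i))"
    by (rule C)
  also have "(\<Prod>i<Suc t. pmf (?K i) (x i)) = indicator {a} (x 0) * (\<Prod>i<t. pmf (K (x i)) (x (Suc i)))"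
    by (subst prod.lessThan_Suc_shift) (auto simp: indicator_def)
  finally show ?thesis .
qed

lemma prob_space_markov_chain: "prob_space (markov_chain K a)"
proof
  interpret IT: Ionescu_Tulcea "chain_kernel K a" "\<lambda>_. count_space UNIV"
    by (rule Ionescu_Tulcea_chain_kernel)
  have "emeasure (markov_chain K a) (prod_emb UNIV (\<lambda>_. count_space UNIV) {} (space (PiM {} (\<lambda>_. count_space UNIV))))
      = emeasure (IT.CI {}) (space (PiM {} (\<lambda>_. count_space UNIV)))"
    unfolding markov_chain_def by (rule IT.lim) auto
  also have "\<dots> = emeasure (IT.CI {}) (space (IT.CI {}))"
    by (simp add: IT.CI_def)
  also have "\<dots> = 1"
    using IT.PF.prob_space_P[of "{}"] by (intro prob_space.emeasure_space_1) auto
  finally show "emeasure (markov_chain K a) (space (markov_chain K a)) = 1"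
    by (simp add: prod_emb_def space_PiM vimage_def restrict_def)
qed


section \<open>Consensus time\<close>

text \<open>\<open>T_cons V \<omega>\<close> is infinite if the trajectory \<open>\<omega>\<close> never reaches consensus,
  as the infimum of the empty set is the top element of \<^typ>\<open>enat\<close>.\<close>

definition T_cons :: "'a set \<Rightarrow> (nat \<Rightarrow> 'a set) \<Rightarrow> enat" where
  "T_cons V \<omega> = (INF t \<in> {t. \<omega> t \<in> {{}, V}}. enat t)"

lemma measurable_T_cons:
  "T_cons V \<in> PiM UNIV (\<lambda>_. count_space UNIV) \<rightarrow>\<^sub>M count_space UNIV"
proof -
  have eq: "T_cons V \<omega> = (INF t. if \<omega> t \<in> {{}, V} then enat t else \<infinity>)" for \<omega>
    unfolding T_cons_def
  proof (rule antisym)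
    show "(INF t \<in> {t. \<omega> t \<in> {{}, V}}. enat t) \<le> (INF t. if \<omega> t \<in> {{}, V} then enat t else \<infinity>)"
      by (rule INF_greatest) (simp add: INF_lower)
    show "(INF t. if \<omega> t \<in> {{}, V} then enat t else \<infinity>) \<le> (INF t \<in> {t. \<omega> t \<in> {{}, V}}. enat t)"
      by (rule INF_mono) auto
  qed
  have comp: "(\<lambda>\<omega>. if \<omega> t \<in> {{}, V} then enat t else \<infinity>)
      \<in> PiM UNIV (\<lambda>_. count_space UNIV) \<rightarrow>\<^sub>M count_space UNIV" for t
    by (rule measurable_compose[where N = "count_space UNIV" and f = "\<lambda>\<omega>. \<omega> t"])
       (auto intro!: measurable_component_singleton)
  show ?thesis
    unfolding eq[abs_def] by (intro measurable_INF comp) auto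
qed

end

theory Submission
  imports Defs "HOL-Real_Asymp.Real_Asymp"
begin

text \<open>
  Laziness only replaces \<open>f\<close> by \<open>\<rho> f\<close>. Let \<open>\<pi>\<close> be the stationary distribution of simple random
  walk on the realized graph and \<open>\<alpha> = \<pi>(A)\<close>, \<open>u = \<bar>\<alpha> - 1/2\<bar>\<close>. With high probability all degrees
  are of order \<open>np\<close>, all codegrees are \<open>O(np\<^sup>2 + log n)\<close>, and for every \<open>A\<close> the degrees into \<open>A\<close>
  deviate from \<open>p |A|\<close> by \<open>O(n\<^sup>2 p)\<close> in squared \<open>\<ell>\<^sub>2\<close>-norm. On such a graph the mean of \<open>\<alpha>\<close> after one
  round is \<open>H(\<alpha>)\<close> up to an error \<open>O(1 / (np)) = O(1 / \<surd>n)\<close> near \<open>\<alpha> = 1/2\<close>, it is at most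
  \<open>(1 - \<epsilon>) \<alpha>\<close> for small \<open>\<alpha>\<close>, and its variance is \<open>O(1/n)\<close>.

  The function \<open>\<psi> = min (1, K (1/2 - u) / (u \<surd>n))\<close> contracts in expectation by a constant factor in
  every round. Away from the centre this follows from the drift and Chebyshev's inequality. In
  the window \<open>u = O(1 / \<surd>n)\<close>, where the drift may be adverse, the product form of the moment
  generating function shows that \<open>E cosh (\<theta> \<surd>n (\<alpha> - 1/2))\<close> is at least \<open>exp (c \<theta>\<^sup>2)\<close>, and the
  Paley-Zygmund inequality yields a constant probability of leaving the window. Off consensus
  \<open>\<psi>\<close> is at least \<open>1 / (4 n\<^sup>2)\<close>, so \<open>O(log n)\<close> rounds suffice.
\<close>

section \<open>Sums of independent Bernoulli variables\<close>

text \<open>The hypothesis on \<open>p\<close> enters through a balance. Near 1/2, stationarity of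
  \<open>\<pi>\<close> leaves only a second-order error in the mean of \<alpha>, and with np of
  order \<surd>n this error has the same order 1/\<surd>n as the random fluctuation of one round.
  Within O(1/\<surd>n) of 1/2 it can cancel or reverse the repulsion of H, and only the noise moves
  the process away; outside a window with a large constant K the repulsion beats both.

  In \<psi> the factor 1/u falls while the bias grows geometrically, the factor 1/2 - u falls while
  the minority dies out, and the cap makes \<psi> constant in the window. One contracting function
  thus replaces a succession of phases, and Markov's inequality at a single time replaces the
  control of failures round by round.

  Near consensus an additive error 1/\<surd>n is useless, since \<alpha> may be as small as 1/n.
  There the second moment of the walk probabilities has to be a small multiple of \<alpha>. The
  squared-deviation bound gives this for large sets only; the codegrees are there for the small
  ones.\<close>

definition pi_bernoulli :: "'a set \<Rightarrow> ('a \<Rightarrow> real) \<Rightarrow> ('a \<Rightarrow> bool) pmf" where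
  "pi_bernoulli V q = Pi_pmf V False (\<lambda>v. bernoulli_pmf (q v))"

lemma finite_set_pi_bernoulli: "finite V \<Longrightarrow> finite (set_pmf (pi_bernoulli V q))"
  unfolding pi_bernoulli_def
  by (rule finite_subset[OF set_Pi_pmf_subset']) (auto intro!: finite_PiE_dflt)

lemma integrable_pi_bernoulli [simp]:
  fixes F :: "('a \<Rightarrow> bool) \<Rightarrow> real"
  shows "finite V \<Longrightarrow> integrable (measure_pmf (pi_bernoulli V q)) F"
  by (intro integrable_measure_pmf_finite finite_set_pi_bernoulli)

text \<open>Independence enters only through this product formula: \<open>F\<close> is an indicator
  for joint probabilities and an exponential for moment generating functions.\<close>

lemma expectation_prod_pi_bernoulli:
  fixes F :: "'a \<Rightarrow> bool \<Rightarrow> real"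
  assumes "finite V" "\<And>v. v \<in> V \<Longrightarrow> 0 \<le> q v" "\<And>v. v \<in> V \<Longrightarrow> q v \<le> 1" "\<And>v b. F v b \<ge> 0"
  shows "measure_pmf.expectation (pi_bernoulli V q) (\<lambda>s. \<Prod>v\<in>V. F v (s v))
       = (\<Prod>v\<in>V. F v True * q v + F v False * (1 - q v))"
  unfolding pi_bernoulli_def
  by (subst expectation_prod_Pi_pmf)
     (auto simp: assms intro!: prod.cong integrable_measure_pmf_finite)

lemma prob_all_pi_bernoulli:
  assumes "finite V" "\<And>v. v \<in> V \<Longrightarrow> 0 \<le> q v" "\<And>v. v \<in> V \<Longrightarrow> q v \<le> 1" "U \<subseteq> V"
  shows "measure_pmf.prob (pi_bernoulli V q) {s. \<forall>v\<in>U. s v} = (\<Prod>v\<in>U. q v)"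
proof -
  have finU: "finite U" using assms(1,4) by (rule rev_finite_subset)
  have "indicator {s. \<forall>v\<in>U. s v} s = (\<Prod>v\<in>V. (if v \<in> U then of_bool (s v) else 1) :: real)" for s
  proof -
    have "(\<Prod>v\<in>V. (if v \<in> U then of_bool (s v) else 1) :: real) = (\<Prod>v\<in>U. of_bool (s v))"
      using assms by (simp add: prod.If_cases Int_absorb1)
    also have "\<dots> = indicator {s. \<forall>v\<in>U. s v} s"
      using finU by (auto simp: indicator_def)
    finally show ?thesis by simp
  qed
  then have "(\<lambda>s. \<Prod>v\<in>V. (if v \<in> U then of_bool (s v) else 1) :: real) = indicator {s. \<forall>v\<in>U. s v}"
    by (intro ext) simp
  then have "measure_pmf.prob (pi_bernoulli V q) {s. \<forall>v\<in>U. s v}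
      = measure_pmf.expectation (pi_bernoulli V q)
          (\<lambda>s. \<Prod>v\<in>V. (if v \<in> U then of_bool (s v) else 1))"
    by (simp only: integral_indicator) simp
  also have "\<dots> = (\<Prod>v\<in>V. if v \<in> U then q v else 1)"
    by (subst expectation_prod_pi_bernoulli) (auto simp: assms intro!: prod.cong)
  also have "\<dots> = (\<Prod>v\<in>U. q v)"
    using assms by (simp add: prod.If_cases Int_absorb1)
  finally show ?thesis .
qed

lemma expectation_of_bool_pi_bernoulli:
  assumes "finite V" "\<And>v. v \<in> V \<Longrightarrow> 0 \<le> q v" "\<And>v. v \<in> V \<Longrightarrow> q v \<le> 1" "u \<in> V" "v \<in> V"
  shows "measure_pmf.expectation (pi_bernoulli V q) (\<lambda>s. of_bool (s v)) = q v"
    and "measure_pmf.expectation (pi_bernoulli V q) (\<lambda>s. of_bool (s u) * of_bool (s v))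
       = (if u = v then q v else q u * q v)"
proof -
  have *: "measure_pmf.expectation (pi_bernoulli V q) (\<lambda>s. of_bool (\<forall>v\<in>U. s v)) = (\<Prod>v\<in>U. q v)"
    if "U \<subseteq> V" for U
  proof -
    have "(\<lambda>s. of_bool (\<forall>v\<in>U. s v)) = (indicator {s. \<forall>v\<in>U. s v} :: _ \<Rightarrow> real)"
      by (auto simp: indicator_def)
    then show ?thesis using prob_all_pi_bernoulli[OF assms(1-3) that] by simp
  qed
  show "measure_pmf.expectation (pi_bernoulli V q) (\<lambda>s. of_bool (s v)) = q v"
    using *[of "{v}"] assms by simp
  \<comment> \<open>For \<open>u = v\<close> the set \<open>{u, v}\<close> collapses to a singleton,
    which yields both cases of the formula at once.\<close>
  show "measure_pmf.expectation (pi_bernoulli V q) (\<lambda>s. of_bool (s u) * of_bool (s v))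
       = (if u = v then q v else q u * q v)"
    using *[of "{u, v}"] assms by (auto simp: of_bool_conj)
qed

lemma expectation_sum_pi_bernoulli:
  fixes w :: "'a \<Rightarrow> real"
  assumes "finite V" "\<And>v. v \<in> V \<Longrightarrow> 0 \<le> q v" "\<And>v. v \<in> V \<Longrightarrow> q v \<le> 1"
  shows "measure_pmf.expectation (pi_bernoulli V q) (\<lambda>s. \<Sum>v\<in>V. w v * of_bool (s v))
       = (\<Sum>v\<in>V. w v * q v)"
  using assms by (simp add: expectation_of_bool_pi_bernoulli(1) Bochner_Integration.integral_sum
      del: sum_mult_of_bool_eq)

lemma variance_sum_pi_bernoulli:
  fixes w :: "'a \<Rightarrow> real"
  assumes "finite V" "\<And>v. v \<in> V \<Longrightarrow> 0 \<le> q v" "\<And>v. v \<in> V \<Longrightarrow> q v \<le> 1"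
  shows "measure_pmf.expectation (pi_bernoulli V q) (\<lambda>s. (\<Sum>v\<in>V. w v * (of_bool (s v) - q v))\<^sup>2)
       = (\<Sum>v\<in>V. (w v)\<^sup>2 * (q v * (1 - q v)))"
proof -
  let ?E = "measure_pmf.expectation (pi_bernoulli V q)"
  have "(\<Sum>v\<in>V. w v * (of_bool (s v) - q v))\<^sup>2 =
     (\<Sum>u\<in>V. \<Sum>v\<in>V. w u * w v * (of_bool (s u) * of_bool (s v)) - w u * w v * q v * of_bool (s u)
         - w u * w v * q u * of_bool (s v) + w u * w v * q u * q v)" for s
    by (simp add: power2_eq_square sum_product algebra_simps)
  then have "?E (\<lambda>s. (\<Sum>v\<in>V. w v * (of_bool (s v) - q v))\<^sup>2) =
     (\<Sum>u\<in>V. \<Sum>v\<in>V. w u * w v * (if u = v then q v else q u * q v) - w u * w v * q v * q u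
         - w u * w v * q u * q v + w u * w v * q u * q v)"
    using assms by (simp add: expectation_of_bool_pi_bernoulli Bochner_Integration.integral_sum
        Bochner_Integration.integral_diff Bochner_Integration.integral_add)
  \<comment> \<open>The off-diagonal terms are covariances of independent variables and
    cancel.\<close>
  also have "\<dots> = (\<Sum>u\<in>V. \<Sum>v\<in>V. if u = v then (w v)\<^sup>2 * (q v * (1 - q v)) else 0)"
    by (intro sum.cong) (auto simp: power2_eq_square algebra_simps)
  also have "\<dots> = (\<Sum>v\<in>V. (w v)\<^sup>2 * (q v * (1 - q v)))"
    using assms by simp
  finally show ?thesis .
qed

section \<open>Exponential moments and tail inequalities\<close>

lemma
  fixes x :: real assumes "\<bar>x\<bar> \<le> 1"
  shows exp_le_quadratic: "exp x \<le> 1 + x + x\<^sup>2"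
    and exp_ge_quadratic: "1 + x + x\<^sup>2/3 \<le> exp x"
proof -
  obtain t where t: "\<bar>t\<bar> \<le> \<bar>x\<bar>" "exp x = (\<Sum>m<3. x^m / fact m) + exp t / fact 3 * x^3"
    using Maclaurin_exp_le[of x 3] by blast
  have "exp t \<le> exp 1" using t assms by simp
  also have "\<dots> \<le> 3" by (rule exp_le)
  finally have "exp t \<le> 3" .
  have "\<bar>x^3\<bar> = x\<^sup>2 * \<bar>x\<bar>" by (simp add: power3_eq_cube power2_eq_square abs_mult)
  also have "\<dots> \<le> x\<^sup>2 * 1" using assms by (intro mult_mono) auto
  finally have x3: "x^3 \<le> x\<^sup>2" "- (x^3) \<le> x\<^sup>2" by simp_all
  have "exp t * x^3 \<le> 3 * x\<^sup>2"
  proof (cases "x^3 \<ge> 0")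
    case True
    then have "exp t * x^3 \<le> 3 * x^3" using \<open>exp t \<le> 3\<close> by (intro mult_right_mono) auto
    then show ?thesis using x3 by simp
  next
    case False
    then have "exp t * x^3 \<le> 0" by (simp add: mult_nonneg_nonpos)
    then show ?thesis by (smt (verit) zero_le_power2)
  qed
  then show "exp x \<le> 1 + x + x\<^sup>2"
    using t(2) by (simp add: eval_nat_numeral)
  obtain t' where t': "exp x = (\<Sum>m<4. x^m / fact m) + exp t' / fact 4 * x^4"
    using Maclaurin_exp_le[of x 4] by blast
  have "exp x \<ge> (\<Sum>m<4. x^m / fact m)" using t' by simp
  then show "1 + x + x\<^sup>2/3 \<le> exp x"
    using x3 by (simp add: eval_nat_numeral)
qed

text \<open>Upper bound: with the centring factor \<open>exp (- (t * q))\<close> pulled out, what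
  remains is \<open>1 + q * (exp t - 1)\<close>, at most \<open>exp (q * (t + t^2))\<close>. Lower
  bound: the variable is centred, so the linear terms cancel and the quadratic ones leave 1 + u with
  u a third of the variance times t^2; then \<open>exp (u / 2) \<le> 1 + u\<close> on [0,1].\<close>

lemma bernoulli_mgf_bounds:
  fixes q t :: real
  assumes q: "0 \<le> q" "q \<le> 1" and t: "\<bar>t\<bar> \<le> 1"
  shows "exp (t * (1 - q)) * q + exp (t * (0 - q)) * (1 - q) \<le> exp (q * t\<^sup>2)" (is "?l \<le> _")
    and "exp (t\<^sup>2 * (q * (1 - q)) / 6) \<le> exp (t * (1 - q)) * q + exp (t * (0 - q)) * (1 - q)"
proof -
  have "?l = exp (- (t * q)) * (1 + q * (exp t - 1))"
    by (simp add: algebra_simps exp_diff exp_minus field_simps)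
  also have "\<dots> \<le> exp (- (t * q)) * (1 + q * (t + t\<^sup>2))"
    using exp_le_quadratic[OF t] q by (intro mult_left_mono add_left_mono) auto
  also have "\<dots> \<le> exp (- (t * q)) * exp (q * (t + t\<^sup>2))"
    by (intro mult_left_mono exp_ge_add_one_self) auto
  also have "\<dots> = exp (q * t\<^sup>2)"
    by (simp add: algebra_simps flip: exp_add)
  finally show "?l \<le> exp (q * t\<^sup>2)" .
  define u where "u = t\<^sup>2 * (q * (1 - q)) / 3"
  have t2: "t\<^sup>2 \<le> 1" using t by (simp add: abs_square_le_1)
  have "q * (1 - q) \<le> 1 * 1" using q by (intro mult_mono) auto
  then have "t\<^sup>2 * (q * (1 - q)) \<le> 1 * 1" using q t2 by (intro mult_mono) auto
  then have u: "0 \<le> u" "u \<le> 1" using q by (auto simp: u_def)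
  have "\<bar>t\<bar> * \<bar>1 - q\<bar> \<le> 1 * 1" "\<bar>t\<bar> * \<bar>0 - q\<bar> \<le> 1 * 1" using q t
    by (intro mult_mono; simp)+
  then have "\<bar>t * (1 - q)\<bar> \<le> 1" "\<bar>t * (0 - q)\<bar> \<le> 1" unfolding abs_mult by simp_all
  then have "?l \<ge> (1 + t * (1 - q) + (t * (1 - q))\<^sup>2/3) * q + (1 + t * (0 - q) + (t * (0 - q))\<^sup>2/3) * (1 - q)"
    using q by (intro add_mono mult_right_mono exp_ge_quadratic) auto
  also have "(1 + t * (1 - q) + (t * (1 - q))\<^sup>2/3) * q + (1 + t * (0 - q) + (t * (0 - q))\<^sup>2/3) * (1 - q) = 1 + u"
    by (simp add: u_def power2_eq_square field_simps)
  finally have "1 + u \<le> ?l" .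
  moreover have "exp (u / 2) \<le> 1 + u / 2 + (u / 2)\<^sup>2" using u by (intro exp_le_quadratic) auto
  moreover have "(u / 2)\<^sup>2 \<le> u / 2" using u using mult_left_le[of u u] by (simp add: power2_eq_square field_simps)
  ultimately show "exp (t\<^sup>2 * (q * (1 - q)) / 6) \<le> ?l" by (simp add: u_def)
qed

text \<open>The upper bound serves the tails of the random graph and the second moment in the escape
  argument. The lower bound is the source of anticoncentration: it says that the sum really
  fluctuates on the scale of its standard deviation.\<close>

lemma
  fixes w :: "'a \<Rightarrow> real"
  assumes "finite V" "\<And>v. v \<in> V \<Longrightarrow> 0 \<le> q v" "\<And>v. v \<in> V \<Longrightarrow> q v \<le> 1"
    and "\<And>v. v \<in> V \<Longrightarrow> \<bar>w v\<bar> \<le> 1"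
  shows pi_bernoulli_mgf_le:
      "measure_pmf.expectation (pi_bernoulli V q) (\<lambda>s. exp (\<Sum>v\<in>V. w v * (of_bool (s v) - q v)))
        \<le> exp (\<Sum>v\<in>V. q v * (w v)\<^sup>2)" (is "?E \<le> _")
    and pi_bernoulli_mgf_ge:
      "exp ((\<Sum>v\<in>V. (w v)\<^sup>2 * (q v * (1 - q v))) / 6)
        \<le> measure_pmf.expectation (pi_bernoulli V q) (\<lambda>s. exp (\<Sum>v\<in>V. w v * (of_bool (s v) - q v)))"
proof -
  have E: "?E = (\<Prod>v\<in>V. exp (w v * (1 - q v)) * q v + exp (w v * (0 - q v)) * (1 - q v))"
    using expectation_prod_pi_bernoulli[of V q "\<lambda>v b. exp (w v * (of_bool b - q v))"] assms
    by (simp add: exp_sum)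
  have "?E \<le> (\<Prod>v\<in>V. exp (q v * (w v)\<^sup>2))"
    unfolding E using assms by (intro prod_mono conjI bernoulli_mgf_bounds add_nonneg_nonneg mult_nonneg_nonneg) auto
  then show "?E \<le> exp (\<Sum>v\<in>V. q v * (w v)\<^sup>2)" using assms by (simp add: exp_sum)
  have "(\<Prod>v\<in>V. exp ((w v)\<^sup>2 * (q v * (1 - q v)) / 6)) \<le> ?E"
    unfolding E using assms by (intro prod_mono conjI bernoulli_mgf_bounds) auto
  then show "exp ((\<Sum>v\<in>V. (w v)\<^sup>2 * (q v * (1 - q v))) / 6) \<le> ?E"
    using assms by (simp add: exp_sum sum_divide_distrib)
qed

text \<open>Markov's inequality with domination demanded on the support only, so that properties of
  sampled graphs such as the absence of loops may be used.\<close>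

lemma pmf_prob_le_expectation:
  fixes F :: "'a \<Rightarrow> real"
  assumes "integrable (measure_pmf M) F" "\<And>s. s \<in> set_pmf M \<Longrightarrow> 0 \<le> F s"
    and "\<And>s. s \<in> set_pmf M \<Longrightarrow> s \<in> S \<Longrightarrow> 1 \<le> F s"
  shows "measure_pmf.prob M S \<le> measure_pmf.expectation M F"
proof -
  have "measure_pmf.prob M S = measure_pmf.expectation M (indicator S)" by simp
  also have "\<dots> \<le> measure_pmf.expectation M F"
    using assms
    by (intro integral_mono_AE assms AE_pmfI integrable_real_indicator) (auto simp: indicator_def less_top[symmetric])
  finally show ?thesis .
qed

lemma pi_bernoulli_Chebyshev:
  fixes w :: "'a \<Rightarrow> real"
  assumes "finite V" "\<And>v. v \<in> V \<Longrightarrow> 0 \<le> q v" "\<And>v. v \<in> V \<Longrightarrow> q v \<le> 1" "\<tau> > 0"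
  shows "measure_pmf.prob (pi_bernoulli V q)
           {s. \<tau> \<le> \<bar>(\<Sum>v\<in>V. w v * of_bool (s v)) - (\<Sum>v\<in>V. w v * q v)\<bar>}
       \<le> (\<Sum>v\<in>V. (w v)\<^sup>2 * (q v * (1 - q v))) / \<tau>\<^sup>2"
proof -
  have "measure_pmf.prob (pi_bernoulli V q)
           {s. \<tau> \<le> \<bar>(\<Sum>v\<in>V. w v * of_bool (s v)) - (\<Sum>v\<in>V. w v * q v)\<bar>}
       \<le> measure_pmf.expectation (pi_bernoulli V q)
           (\<lambda>s. (\<Sum>v\<in>V. w v * (of_bool (s v) - q v))\<^sup>2 / \<tau>\<^sup>2)"
  proof (rule pmf_prob_le_expectation)
    fix s assume "s \<in> {s. \<tau> \<le> \<bar>(\<Sum>v\<in>V. w v * of_bool (s v)) - (\<Sum>v\<in>V. w v * q v)\<bar>}"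
    then have "\<tau> \<le> \<bar>\<Sum>v\<in>V. w v * (of_bool (s v) - q v)\<bar>"
      by (simp add: algebra_simps sum_subtractf)
    then have "\<tau>\<^sup>2 \<le> (\<Sum>v\<in>V. w v * (of_bool (s v) - q v))\<^sup>2"
      using \<open>\<tau> > 0\<close> by (metis abs_le_square_iff abs_of_pos)
    then show "1 \<le> (\<Sum>v\<in>V. w v * (of_bool (s v) - q v))\<^sup>2 / \<tau>\<^sup>2"
      using \<open>\<tau> > 0\<close> by simp
  qed (use assms in auto)
  also have "\<dots> = (\<Sum>v\<in>V. (w v)\<^sup>2 * (q v * (1 - q v))) / \<tau>\<^sup>2"
    using variance_sum_pi_bernoulli[OF assms(1-3), where w = w] by simp
  finally show ?thesis .
qed

text \<open>A variant normalised to a gap of 1 between mean and threshold. The part of Z below the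
  threshold contributes at most b, the part above is treated by AM-GM, and after integration 1/2 <=
  W/2 * P remains.\<close>

lemma pmf_Paley_Zygmund:
  fixes Z :: "'a \<Rightarrow> real"
  assumes fin: "finite (set_pmf M)" and Z: "\<And>s. 0 \<le> Z s"
    and E: "b + 1 \<le> measure_pmf.expectation M Z" and b: "0 \<le> b"
    and E2: "measure_pmf.expectation M (\<lambda>s. (Z s)\<^sup>2) \<le> W" and W: "0 < W"
  shows "1 / W \<le> measure_pmf.prob M {s. b < Z s}"
proof -
  let ?I = "\<lambda>s. indicator {s. b < Z s} s :: real"
  have [simp]: "integrable (measure_pmf M) F" for F :: "'a \<Rightarrow> real"
    by (rule integrable_measure_pmf_finite[OF fin])
  \<comment> \<open>AM-GM: \<open>z \<le> z\<^sup>2 / (2 W) + W / 2\<close>\<close>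
  have "Z s \<le> b + (Z s)\<^sup>2 / (2 * W) + W / 2 * ?I s" for s
  proof (cases "b < Z s")
    case True
    have "0 \<le> (Z s - W)\<^sup>2" by simp
    then have "2 * W * Z s \<le> (Z s)\<^sup>2 + W * W" by (simp add: power2_eq_square algebra_simps)
    then have "Z s \<le> ((Z s)\<^sup>2 + W * W) / (2 * W)" using W by (simp add: field_simps)
    also have "\<dots> = (Z s)\<^sup>2 / (2 * W) + W / 2" using W by (simp add: field_simps)
    finally show ?thesis using True b by simp
  qed (use W in \<open>simp add: add_increasing2\<close>)
  then have "measure_pmf.expectation M Z
      \<le> measure_pmf.expectation M (\<lambda>s. b + (Z s)\<^sup>2 / (2 * W) + W / 2 * ?I s)"
    by (intro integral_mono) auto
  also have "\<dots> = b + measure_pmf.expectation M (\<lambda>s. (Z s)\<^sup>2) / (2 * W) + W / 2 * measure_pmf.prob M {s. b < Z s}"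
    by simp
  also have "\<dots> \<le> b + W / (2 * W) + W / 2 * measure_pmf.prob M {s. b < Z s}"
    using E2 W by (intro add_mono divide_right_mono) auto
  finally have "1 \<le> W * measure_pmf.prob M {s. b < Z s}" using E W by (simp add: field_simps)
  then show ?thesis using W by (simp add: field_simps)
qed

section \<open>Pseudorandomness of G(n,p)\<close>

text \<open>An ordered pair of distinct vertices is a potential edge with a marked endpoint; the
  other endpoint is recovered by \<open>the_elem (e - {v})\<close>. This turns sums over vertices
  into sums over the independent edge indicators.\<close>

lemma sum_incident_pairs:
  fixes F :: "'a \<Rightarrow> 'a set \<Rightarrow> real"
  assumes "finite V"
  shows "(\<Sum>v\<in>V. \<Sum>u\<in>V - {v}. F v {u, v}) = (\<Sum>e\<in>nsets V 2. \<Sum>v\<in>e. F v e)"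
proof -
  have fin: "\<forall>e\<in>nsets V 2. finite e" by (auto simp: nsets_def)
  have "(\<Sum>v\<in>V. \<Sum>u\<in>V - {v}. F v {u, v}) = (\<Sum>(v, u)\<in>Sigma V (\<lambda>v. V - {v}). F v {u, v})"
    using assms by (subst sum.Sigma) auto
  also have "\<dots> = (\<Sum>(e, v)\<in>Sigma (nsets V 2) (\<lambda>e. e). F v e)"
    by (rule sum.reindex_bij_witness
        [where j = "\<lambda>(v, u). ({u, v}, v)" and i = "\<lambda>(e, v). (v, the_elem (e - {v}))"])
       (auto simp: nsets_def card_2_iff insert_Diff_if doubleton_eq_iff)
  also have "\<dots> = (\<Sum>e\<in>nsets V 2. \<Sum>v\<in>e. F v e)"
    using assms fin by (subst sum.Sigma) (auto simp: finite_imp_finite_nsets)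
  finally show ?thesis .
qed

lemma gnp_altdef:
  "gnp n p = map_pmf (\<lambda>s. {e \<in> nsets {..<n} 2. s e}) (pi_bernoulli (nsets {..<n} 2) (\<lambda>_. p))"
  by (simp add: gnp_def pi_bernoulli_def)

lemma set_gnp: "E \<in> set_pmf (gnp n p) \<Longrightarrow> E \<subseteq> nsets {..<n} 2"
  by (auto simp: gnp_def)

lemma finite_set_gnp [simp]: "finite (set_pmf (gnp n p))"
  by (simp add: gnp_altdef finite_set_pi_bernoulli finite_imp_finite_nsets)

text \<open>The vertex v itself is left out of A because there are no loops; for vertices below n
  every summand is then centred under \<open>gnp n p\<close>, also when v lies in A.\<close>

definition edge_dev :: "real \<Rightarrow> 'a set set \<Rightarrow> 'a set \<Rightarrow> 'a \<Rightarrow> real" where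
  "edge_dev p E A v = (\<Sum>u\<in>A - {v}. of_bool ({u, v} \<in> E) - p)"

lemma edge_dev_conv_degree_in:
  assumes "finite A" "{v} \<notin> E"
  shows "edge_dev p E A v = real (degree_in E A v) - p * real (card (A - {v}))"
proof -
  have "{u \<in> A. {u, v} \<in> E} = {u \<in> A - {v}. {u, v} \<in> E}" using assms(2) by auto
  then have "real (degree_in E A v) = (\<Sum>u\<in>A - {v}. of_bool ({u, v} \<in> E))"
    using assms by (simp add: degree_in_def Int_def)
  then show ?thesis by (simp add: edge_dev_def sum_subtractf)
qed

text \<open>Deviations at different vertices share edges and are dependent, but a linear form in
  them is a linear form in independent edge indicators. An edge {x, y} gets a coefficient made of at
  most \<open>t x\<close> and \<open>t y\<close>, so the bound 1/2 on \<open>t\<close> keeps it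
  within 1, and its square is at most twice the sum of the two squares.\<close>

lemma gnp_mgf_edge_dev:
  fixes t :: "nat \<Rightarrow> real"
  assumes p: "0 \<le> p" "p \<le> 1" and A: "A \<subseteq> {..<n}" and t: "\<And>v. v < n \<Longrightarrow> \<bar>t v\<bar> \<le> 1/2"
  shows "measure_pmf.expectation (gnp n p) (\<lambda>E. exp (\<Sum>v<n. t v * edge_dev p E A v))
       \<le> exp (2 * p * real n * (\<Sum>v<n. (t v)\<^sup>2))"
proof -
  let ?P = "nsets {..<n} 2"
  define w where "w e = (\<Sum>v\<in>e. t v * of_bool (e - {v} \<subseteq> A))" for e
  have lin: "(\<Sum>v<n. t v * edge_dev p E A v) = (\<Sum>e\<in>?P. w e * (of_bool (e \<in> E) - p))" for E
  proof -
    have "t v * edge_dev p E A v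
        = (\<Sum>u\<in>{..<n} - {v}. t v * of_bool ({u, v} - {v} \<subseteq> A) * (of_bool ({u, v} \<in> E) - p))" for v
    proof -
      have "edge_dev p E A v = (\<Sum>u\<in>{..<n} - {v}. of_bool ({u, v} - {v} \<subseteq> A) * (of_bool ({u, v} \<in> E) - p))"
        unfolding edge_dev_def using A by (intro sum.mono_neutral_cong_left) auto
      then show ?thesis by (simp only: sum_distrib_left mult.assoc)
    qed
    then have "(\<Sum>v<n. t v * edge_dev p E A v)
        = (\<Sum>v<n. \<Sum>u\<in>{..<n} - {v}. t v * of_bool ({u, v} - {v} \<subseteq> A) * (of_bool ({u, v} \<in> E) - p))"
      by simp
    also have "\<dots> = (\<Sum>e\<in>?P. \<Sum>v\<in>e. t v * of_bool (e - {v} \<subseteq> A) * (of_bool (e \<in> E) - p))"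
      by (rule sum_incident_pairs) simp
    finally show ?thesis by (simp add: w_def sum_distrib_right)
  qed
  have w: "\<bar>w e\<bar> \<le> 1 \<and> (w e)\<^sup>2 \<le> (\<Sum>v\<in>e. 2 * (t v)\<^sup>2)" if e: "e \<in> ?P" for e
  proof -
    obtain x y where xy: "e = {x, y}" "x \<noteq> y" "x < n" "y < n"
      using e by (auto simp: nsets_def card_2_iff)
    define a b where "a = t x * of_bool (e - {x} \<subseteq> A)" and "b = t y * of_bool (e - {y} \<subseteq> A)"
    have "w e = a + b" using xy by (simp add: w_def a_def b_def)
    moreover have "\<bar>a\<bar> \<le> \<bar>t x\<bar>" "\<bar>b\<bar> \<le> \<bar>t y\<bar>" by (auto simp: a_def b_def)
    moreover from this have "a\<^sup>2 \<le> (t x)\<^sup>2" "b\<^sup>2 \<le> (t y)\<^sup>2" by (simp_all add: abs_le_square_iff)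
    moreover have "(a + b)\<^sup>2 \<le> 2 * a\<^sup>2 + 2 * b\<^sup>2"
      using zero_le_power2[of "a - b"] by (simp add: power2_eq_square algebra_simps)
    ultimately show ?thesis using t[of x] t[of y] xy by simp
  qed
  have "measure_pmf.expectation (gnp n p) (\<lambda>E. exp (\<Sum>v<n. t v * edge_dev p E A v))
      = measure_pmf.expectation (pi_bernoulli ?P (\<lambda>_. p)) (\<lambda>s. exp (\<Sum>e\<in>?P. w e * (of_bool (s e) - p)))"
    unfolding gnp_altdef integral_map_pmf lin by (intro Bochner_Integration.integral_cong refl arg_cong[where f = exp] sum.cong) auto
  also have "\<dots> \<le> exp (\<Sum>e\<in>?P. p * (w e)\<^sup>2)"
    using p w by (intro pi_bernoulli_mgf_le) (auto simp: finite_imp_finite_nsets)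
  also have "\<dots> \<le> exp (\<Sum>e\<in>?P. p * (\<Sum>v\<in>e. 2 * (t v)\<^sup>2))"
    using p w by (simp only: exp_le_cancel_iff) (intro sum_mono mult_left_mono, auto)
  also have "(\<Sum>e\<in>?P. p * (\<Sum>v\<in>e. 2 * (t v)\<^sup>2)) = (\<Sum>v<n. \<Sum>u\<in>{..<n} - {v}. p * (2 * (t v)\<^sup>2))"
    unfolding sum_distrib_left using sum_incident_pairs[of "{..<n}" "\<lambda>v e. p * (2 * (t v)\<^sup>2)"] by simp
  also have "\<dots> \<le> (\<Sum>v<n. real n * (p * (2 * (t v)\<^sup>2)))"
    using p by (intro sum_mono) (auto simp: algebra_simps intro!: mult_nonneg_nonneg)
  also have "\<dots> = 2 * p * real n * (\<Sum>v<n. (t v)\<^sup>2)"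
    by (simp add: sum_distrib_left mult_ac)
  finally show ?thesis by simp
qed

text \<open>Chernoff bound with slopes 1/16 and -1/16: the threshold np/4 contributes -np/64 to the
  exponent and the moment generating function at most np/128.\<close>

lemma gnp_degree_deviation:
  assumes p: "0 \<le> p" "p \<le> 1" and v: "v < n"
  shows "measure_pmf.prob (gnp n p) {E. real n * p / 4 \<le> \<bar>edge_dev p E {..<n} v\<bar>}
       \<le> 2 * exp (- (real n * p / 128))"
proof -
  have *: "measure_pmf.expectation (gnp n p) (\<lambda>E. exp (c * edge_dev p E {..<n} v))
       \<le> exp (2 * p * real n * c\<^sup>2)" if "\<bar>c\<bar> \<le> 1/2" for c :: real
  proof -
    have "(\<Sum>u<n. (if u = v then c else 0) * x u) = c * x v" for x :: "nat \<Rightarrow> real"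
      using v by (simp add: if_distrib[of "\<lambda>y. y * _"] cong: if_cong)
    moreover have "(\<Sum>u<n. (if u = v then c else 0)\<^sup>2) = c\<^sup>2"
      using v by (simp add: if_distrib[of "\<lambda>y. y\<^sup>2"] cong: if_cong)
    ultimately show ?thesis
      using gnp_mgf_edge_dev[OF p, of "{..<n}" n "\<lambda>u. if u = v then c else 0"] that by simp
  qed
  let ?m = "real n * p"
  have "measure_pmf.prob (gnp n p) {E. ?m / 4 \<le> \<bar>edge_dev p E {..<n} v\<bar>}
     \<le> measure_pmf.expectation (gnp n p) (\<lambda>E. exp (- (?m / 64)) * exp (1/16 * edge_dev p E {..<n} v)
          + exp (- (?m / 64)) * exp (-1/16 * edge_dev p E {..<n} v))"
  proof (rule pmf_prob_le_expectation)
    fix E assume "E \<in> {E. ?m / 4 \<le> \<bar>edge_dev p E {..<n} v\<bar>}"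
    then have "0 \<le> - (?m / 64) + 1/16 * edge_dev p E {..<n} v \<or> 0 \<le> - (?m / 64) + -1/16 * edge_dev p E {..<n} v"
      by (auto simp: abs_if field_simps split: if_splits)
    then have "1 \<le> exp (- (?m / 64) + 1/16 * edge_dev p E {..<n} v) \<or> 1 \<le> exp (- (?m / 64) + -1/16 * edge_dev p E {..<n} v)"
      by (metis exp_ge_zero one_le_exp_iff)
    then show "1 \<le> exp (- (?m / 64)) * exp (1/16 * edge_dev p E {..<n} v)
          + exp (- (?m / 64)) * exp (-1/16 * edge_dev p E {..<n} v)"
      unfolding exp_add[symmetric] by (smt (verit) exp_gt_zero)
  qed (auto intro!: integrable_measure_pmf_finite)
  also have "\<dots> = exp (- (?m / 64)) * measure_pmf.expectation (gnp n p) (\<lambda>E. exp (1/16 * edge_dev p E {..<n} v))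
         + exp (- (?m / 64)) * measure_pmf.expectation (gnp n p) (\<lambda>E. exp (-1/16 * edge_dev p E {..<n} v))"
    by (subst Bochner_Integration.integral_add) (auto intro!: integrable_measure_pmf_finite)
  also have "\<dots> \<le> exp (- (?m / 64)) * exp (2 * p * real n * (1/16)\<^sup>2) + exp (- (?m / 64)) * exp (2 * p * real n * (-1/16)\<^sup>2)"
    by (intro add_mono mult_left_mono *) auto
  also have "\<dots> = 2 * exp (- (?m / 128))"
    by (simp add: power2_eq_square field_simps flip: exp_add)
  finally show ?thesis .
qed

text \<open>Since \<open>k^2 \<ge> \<bar>k\<bar>\<close> for integers, the Gaussian sum is dominated
  by geometric ones of ratio at most 8/9: at most 9 from the nonnegative indices and 8 from the
  negative ones, uniformly in R.\<close>

lemma sum_exp_neg_square_le: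
  "(\<Sum>k\<in>{-R..R}. exp (- ((real_of_int k)\<^sup>2 / 8))) \<le> 17"
proof -
  define r where "r = exp (- 1 / 8 :: real)"
  have "9 / 8 \<le> exp (1 / 8 :: real)" using exp_ge_add_one_self[of "1/8 :: real"] by simp
  then have r: "0 < r" "r \<le> 8 / 9" by (auto simp: r_def exp_minus field_simps)
  have le: "exp (- ((real_of_int k)\<^sup>2 / 8)) \<le> r ^ nat \<bar>k\<bar>" for k
  proof -
    have "r ^ nat \<bar>k\<bar> = exp (- (\<bar>real_of_int k\<bar> / 8))"
      by (simp add: r_def flip: exp_of_nat_mult)
    moreover have "\<bar>real_of_int k\<bar> \<le> (real_of_int k)\<^sup>2"
    proof -
      have "\<bar>k\<bar> * 1 \<le> \<bar>k\<bar> * \<bar>k\<bar>" by (cases "k = 0") (use mult_left_mono[of 1 "\<bar>k\<bar>" "\<bar>k\<bar>"] in auto)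
      then have "\<bar>k\<bar> \<le> k\<^sup>2" by (simp add: power2_eq_square)
      then show ?thesis by (metis of_int_abs of_int_le_iff of_int_power)
    qed
    ultimately show ?thesis by simp
  qed
  have geo: "(\<Sum>j<N. r ^ j) \<le> 9" for N
  proof -
    have "(\<Sum>j<N. r ^ j) \<le> (\<Sum>j. r ^ j)" using r by (intro sum_le_suminf) auto
    also have "\<dots> = 1 / (1 - r)" using r by (intro suminf_geometric) auto
    also have "\<dots> \<le> 9" using r by (simp add: field_simps)
    finally show ?thesis .
  qed
  have "(\<Sum>k\<in>{-R..R}. exp (- ((real_of_int k)\<^sup>2 / 8))) \<le> (\<Sum>k\<in>{-R..R}. r ^ nat \<bar>k\<bar>)"
    by (intro sum_mono le)
  also have "\<dots> \<le> (\<Sum>k\<in>(int ` {..<nat (R+1)}) \<union> ((\<lambda>j. - int (Suc j)) ` {..<nat R}). r ^ nat \<bar>k\<bar>)"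
  proof (intro sum_mono2)
    show "{-R..R} \<subseteq> (int ` {..<nat (R+1)}) \<union> ((\<lambda>j. - int (Suc j)) ` {..<nat R})"
    proof
      fix k assume k: "k \<in> {-R..R}"
      show "k \<in> (int ` {..<nat (R+1)}) \<union> ((\<lambda>j. - int (Suc j)) ` {..<nat R})"
      proof (cases "k \<ge> 0")
        case True then show ?thesis using k by (intro UnI1 image_eqI[of _ _ "nat k"]) auto
      next
        case False then show ?thesis using k by (intro UnI2 image_eqI[of _ _ "nat (-k-1)"]) auto
      qed
    qed
  qed (use r in auto)
  also have "\<dots> \<le> (\<Sum>j<nat (R+1). r ^ j) + r * (\<Sum>j<nat R. r ^ j)"
    using r by (subst sum.union_disjoint)
      (auto simp: sum.reindex inj_on_def o_def nat_add_distrib sum_distrib_left intro!: add_mono sum_mono)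
  also have "\<dots> \<le> 9 + 8/9 * 9" using r geo
    by (intro add_mono mult_mono) (auto intro!: sum_nonneg)
  finally show ?thesis by simp
qed

text \<open>The witness is the integer k nearest to y = 2 r x. Completing the square, k r x - k^2/4
  = (r x)^2 - (k - y)^2/4, and rounding loses at most 1/16. The bound on x puts k into the range R.
  The range itself keeps all slopes k r within 1/2, as \<open>gnp_mgf_edge_dev\<close>
  demands.\<close>

lemma net_bound:
  fixes x m :: real
  assumes m: "1 \<le> m" and x: "\<bar>x\<bar> \<le> 2 * m"
  defines "r \<equiv> 1 / (4 * sqrt m)" and "R \<equiv> \<lfloor>sqrt m + 1/2\<rfloor>"
  shows "\<exists>k\<in>{-R..R}. x\<^sup>2 / (16 * m) \<le> real_of_int k * r * x - (real_of_int k)\<^sup>2 / 4 + 1/16"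
    and "\<And>k. k \<in> {-R..R} \<Longrightarrow> \<bar>real_of_int k * r\<bar> \<le> 1/2"
proof -
  have r: "r > 0" "r\<^sup>2 = 1 / (16 * m)" using m by (auto simp: r_def power_divide power_mult_distrib)
  have rm: "r * m = sqrt m / 4" using m by (simp add: r_def field_simps real_div_sqrt)
  define y where "y = 2 * r * x"
  have "\<bar>y\<bar> \<le> 2 * r * (2 * m)" unfolding y_def abs_mult using r x by (intro mult_mono) auto
  also have "\<dots> = sqrt m" using rm by simp
  finally have y: "\<bar>y\<bar> \<le> sqrt m" .
  have close: "\<bar>real_of_int (round y) - y\<bar> \<le> 1/2" by (rule of_int_round_abs_le)
  then have "\<bar>real_of_int (round y)\<bar> \<le> sqrt m + 1/2" using y by linarith
  then have "real_of_int (round y) \<le> sqrt m + 1/2" "real_of_int (- round y) \<le> sqrt m + 1/2" by auto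
  then have "round y \<le> R" "- round y \<le> R" unfolding R_def by (simp_all only: le_floor_iff)
  then have mem: "round y \<in> {-R..R}" by auto
  define k where "k = real_of_int (round y)"
  have "(k - y)\<^sup>2 \<le> (1/2)\<^sup>2" using close unfolding k_def by (subst abs_le_square_iff[symmetric]) simp
  moreover have "k * r * x - k\<^sup>2 / 4 = r\<^sup>2 * x\<^sup>2 - (k - y)\<^sup>2 / 4"
    by (simp add: y_def power2_eq_square field_simps)
  ultimately have "x\<^sup>2 / (16 * m) \<le> k * r * x - k\<^sup>2 / 4 + 1/16"
    using r by (simp add: power2_eq_square)
  then show "\<exists>k\<in>{-R..R}. x\<^sup>2 / (16 * m) \<le> real_of_int k * r * x - (real_of_int k)\<^sup>2 / 4 + 1/16"
    using mem k_def by blast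
  show "\<bar>real_of_int k * r\<bar> \<le> 1/2" if k: "k \<in> {-R..R}" for k :: int
  proof -
    have "\<bar>real_of_int k\<bar> \<le> real_of_int R" using k by auto
    also have "\<dots> \<le> sqrt m + 1/2" unfolding R_def by linarith
    also have "\<dots> \<le> 2 * sqrt m" using real_sqrt_ge_1_iff[of m] m by linarith
    finally have "\<bar>real_of_int k\<bar> * r \<le> 2 * sqrt m * r" using r by (intro mult_right_mono) auto
    also have "\<dots> = 1/2" using m by (simp add: r_def)
    finally show ?thesis using r by (simp add: abs_mult)
  qed
qed

text \<open>Completing the square bounds \<open>exp (x\<^sup>2 / (16 m))\<close> by a sum of exponentials of linear forms
  over an integer net; this reduces the quadratic form to \<open>gnp_mgf_edge_dev\<close>.\<close>

lemma gnp_quadratic_deviation: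
  assumes p: "0 \<le> p" "p \<le> 1" and m: "1 \<le> real n * p" and A: "A \<subseteq> {..<n}"
  shows "measure_pmf.prob (gnp n p)
           {E. (\<forall>v<n. \<bar>edge_dev p E A v\<bar> \<le> 2 * (real n * p)) \<and>
               80 * (real n)\<^sup>2 * p < (\<Sum>v<n. (edge_dev p E A v)\<^sup>2)}
         \<le> exp (- (2 * real n))"
proof -
  define m where "m = real n * p"
  define r where "r = 1 / (4 * sqrt m)"
  define R where "R = \<lfloor>sqrt m + 1/2\<rfloor>"
  have m1: "1 \<le> m" using m by (simp add: m_def)
  have r2: "r\<^sup>2 = 1 / (16 * m)" using m1 by (auto simp: r_def power_divide power_mult_distrib)
  note net = net_bound[OF m1, folded r_def R_def]
  have net2: "\<bar>real_of_int k * r\<bar> \<le> 1/2" if "k \<in> {-R..R}" for k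
    using net(2)[of 0 k] that m1 by simp
  let ?K = "PiE {..<n} (\<lambda>_. {-R..R})"
  define S where "S E \<kappa> = (\<Sum>v<n. real_of_int (\<kappa> v) * r * edge_dev p E A v)" for E \<kappa>
  define c where "c \<kappa> = (\<Sum>v<n. 1/16 - (real_of_int (\<kappa> v))\<^sup>2 / 4)" for \<kappa> :: "nat \<Rightarrow> int"
  have finK: "finite ?K" by (intro finite_PiE) auto
  have "measure_pmf.prob (gnp n p)
           {E. (\<forall>v<n. \<bar>edge_dev p E A v\<bar> \<le> 2 * (real n * p)) \<and>
               80 * (real n)\<^sup>2 * p < (\<Sum>v<n. (edge_dev p E A v)\<^sup>2)}
      \<le> measure_pmf.expectation (gnp n p) (\<lambda>E. exp (- (5 * real n)) * (\<Sum>\<kappa>\<in>?K. exp (c \<kappa>) * exp (S E \<kappa>)))"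
  proof (rule pmf_prob_le_expectation)
    fix E assume "E \<in> {E. (\<forall>v<n. \<bar>edge_dev p E A v\<bar> \<le> 2 * (real n * p)) \<and>
               80 * (real n)\<^sup>2 * p < (\<Sum>v<n. (edge_dev p E A v)\<^sup>2)}"
    then have le: "\<And>v. v < n \<Longrightarrow> \<bar>edge_dev p E A v\<bar> \<le> 2 * m"
      and gt: "80 * (real n)\<^sup>2 * p < (\<Sum>v<n. (edge_dev p E A v)\<^sup>2)" by (auto simp: m_def)
    have "\<forall>v\<in>{..<n}. \<exists>k\<in>{-R..R}. (edge_dev p E A v)\<^sup>2 / (16 * m)
        \<le> real_of_int k * r * edge_dev p E A v - (real_of_int k)\<^sup>2 / 4 + 1/16"
      using net(1) le by auto
    then obtain \<kappa> where \<kappa>: "\<And>v. v < n \<Longrightarrow> \<kappa> v \<in> {-R..R} \<and> (edge_dev p E A v)\<^sup>2 / (16 * m)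
        \<le> real_of_int (\<kappa> v) * r * edge_dev p E A v - (real_of_int (\<kappa> v))\<^sup>2 / 4 + 1/16"
      by (metis lessThan_iff)
    define \<kappa>' where "\<kappa>' = restrict \<kappa> {..<n}"
    have mem: "\<kappa>' \<in> ?K" using \<kappa> by (auto simp: \<kappa>'_def)
    \<comment> \<open>The constant 80 is worth 5 per vertex in the exponent. The sum over the net
      will cost 3 per vertex, and the remaining 2 beats a union over all 2^n sets.\<close>
    have "5 * real n = 80 * (real n)\<^sup>2 * p / (16 * m)"
      using m1 by (auto simp: m_def power2_eq_square field_simps)
    also have "\<dots> \<le> (\<Sum>v<n. (edge_dev p E A v)\<^sup>2) / (16 * m)"
      using gt m1 by (intro divide_right_mono) auto
    also have "\<dots> \<le> (\<Sum>v<n. real_of_int (\<kappa>' v) * r * edge_dev p E A v + (1/16 - (real_of_int (\<kappa>' v))\<^sup>2 / 4))"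
      unfolding sum_divide_distrib
    proof (intro sum_mono)
      fix v assume "v \<in> {..<n}"
      then show "(edge_dev p E A v)\<^sup>2 / (16 * m) \<le> real_of_int (\<kappa>' v) * r * edge_dev p E A v + (1/16 - (real_of_int (\<kappa>' v))\<^sup>2 / 4)"
        using \<kappa>[of v] by (simp add: \<kappa>'_def)
    qed
    also have "\<dots> = S E \<kappa>' + c \<kappa>'" by (simp add: S_def c_def sum.distrib)
    finally have "exp (5 * real n) \<le> exp (c \<kappa>') * exp (S E \<kappa>')"
      by (simp add: add.commute flip: exp_add)
    also have "\<dots> \<le> (\<Sum>\<kappa>\<in>?K. exp (c \<kappa>) * exp (S E \<kappa>))"
      using finK mem by (intro member_le_sum) auto
    finally show "1 \<le> exp (- (5 * real n)) * (\<Sum>\<kappa>\<in>?K. exp (c \<kappa>) * exp (S E \<kappa>))"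
      by (simp add: exp_minus field_simps)
  qed (intro integrable_measure_pmf_finite add_nonneg_nonneg mult_nonneg_nonneg sum_nonneg; simp)+
  also have "\<dots> = exp (- (5 * real n)) * (\<Sum>\<kappa>\<in>?K. exp (c \<kappa>) * measure_pmf.expectation (gnp n p) (\<lambda>E. exp (S E \<kappa>)))"
    by (simp add: Bochner_Integration.integral_sum integrable_measure_pmf_finite)
  also have "\<dots> \<le> exp (- (5 * real n)) * (\<Sum>\<kappa>\<in>?K. \<Prod>v<n. exp (1/16) * exp (- ((real_of_int (\<kappa> v))\<^sup>2 / 8)))"
  proof (intro mult_left_mono sum_mono)
    fix \<kappa> assume \<kappa>: "\<kappa> \<in> ?K"
    have "measure_pmf.expectation (gnp n p) (\<lambda>E. exp (S E \<kappa>))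
        \<le> exp (2 * p * real n * (\<Sum>v<n. (real_of_int (\<kappa> v) * r)\<^sup>2))"
      unfolding S_def using \<kappa> by (intro gnp_mgf_edge_dev p A net2) (auto simp: PiE_iff)
    \<comment> \<open>By the choice of r the moment generating function costs k^2/8, half of the
      k^2/4 gained in \<open>c \<kappa>\<close>; the surplus makes the sum over the net
      converge.\<close>
    also have "2 * p * real n * (\<Sum>v<n. (real_of_int (\<kappa> v) * r)\<^sup>2) = (\<Sum>v<n. (real_of_int (\<kappa> v))\<^sup>2 / 8)"
    proof -
      have *: "2 * p * real n = 2 * m" by (simp add: m_def)
      have "2 * p * real n * (k * r)\<^sup>2 = k\<^sup>2 / 8" for k
        unfolding * using m1 by (simp add: power_mult_distrib r2)
      then show ?thesis by (simp only: sum_distrib_left)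
    qed
    finally have "exp (c \<kappa>) * measure_pmf.expectation (gnp n p) (\<lambda>E. exp (S E \<kappa>))
       \<le> exp (c \<kappa>) * exp (\<Sum>v<n. (real_of_int (\<kappa> v))\<^sup>2 / 8)" by (intro mult_left_mono) auto
    also have "\<dots> = (\<Prod>v<n. exp (1/16) * exp (- ((real_of_int (\<kappa> v))\<^sup>2 / 8)))"
      by (simp add: c_def flip: exp_add exp_sum sum.distrib)
    finally show "exp (c \<kappa>) * measure_pmf.expectation (gnp n p) (\<lambda>E. exp (S E \<kappa>))
       \<le> (\<Prod>v<n. exp (1/16) * exp (- ((real_of_int (\<kappa> v))\<^sup>2 / 8)))" .
  qed auto
  also have "(\<Sum>\<kappa>\<in>?K. \<Prod>v<n. exp (1/16) * exp (- ((real_of_int (\<kappa> v))\<^sup>2 / 8)))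
      = (\<Prod>v<n. \<Sum>k\<in>{-R..R}. exp (1/16) * exp (- ((real_of_int k)\<^sup>2 / 8)))"
    by (rule prod_sum_PiE[symmetric]) auto
  also have "\<dots> \<le> (\<Prod>v<n. exp 3)"
  proof (intro prod_mono conjI sum_nonneg)
    have "(\<Sum>k\<in>{-R..R}. exp (1/16) * exp (- ((real_of_int k)\<^sup>2 / 8))) \<le> exp (1/16) * 17"
      unfolding sum_distrib_left[symmetric] by (intro mult_left_mono sum_exp_neg_square_le) auto
    also have "exp (1/16 :: real) * 17 \<le> (1 + 1/16 + (1/16)\<^sup>2) * 17"
      by (intro mult_right_mono exp_le_quadratic) auto
    \<comment> \<open>Numerically 18.13 against (8/3)^3 = 18.96, where 8/3 is the Taylor sum of e up
      to the cubic term.\<close>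
    also have "(1 + 1/16 + (1/16)\<^sup>2) * 17 \<le> (5/2 + 1/6 :: real) ^ 3" by (simp add: power2_eq_square power3_eq_cube)
    also have "\<dots> \<le> exp 1 ^ 3"
    proof (rule power_mono)
      obtain t where "exp 1 = (\<Sum>i<4. 1 ^ i / fact i) + exp t / fact 4 * (1::real) ^ 4"
        using Maclaurin_exp_le[of 1 4] by blast
      then show "5/2 + 1/6 \<le> exp (1::real)" by (simp add: eval_nat_numeral)
    qed simp
    also have "\<dots> = exp (3::real)" by (simp flip: exp_of_nat_mult)
    finally show "(\<Sum>k\<in>{-R..R}. exp (1/16) * exp (- ((real_of_int k)\<^sup>2 / 8))) \<le> exp 3" by simp
  qed auto
  also have "\<dots> = exp (3 * real n)" by (simp flip: exp_of_nat_mult)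
  also have "exp (- (5 * real n)) * exp (3 * real n) = exp (- (2 * real n))" by (simp flip: exp_add)
  finally show ?thesis by simp
qed

text \<open>2 to the power of the codegree counts the sets S of common neighbours. Each S requires
  2|S| distinct edges, so the expectation is the binomial sum of (p^2)^|S|, that is (1 + p^2)^|W|,
  at most exp(n p^2). Markov's inequality and \<open>exp (1/2) \<le> 2\<close> finish.\<close>

lemma gnp_codegree:
  assumes p: "0 \<le> p" "p \<le> 1" and uw: "u < n" "w < n" "u \<noteq> w"
  shows "measure_pmf.prob (gnp n p) {E. a < real (card {x\<in>{..<n}. {x, u} \<in> E \<and> {x, w} \<in> E})}
       \<le> exp (real n * p\<^sup>2 - a / 2)"
proof -
  define W where "W = {..<n} - {u, w}"
  define F where "F S = (\<lambda>x. {x, u}) ` S \<union> (\<lambda>x. {x, w}) ` S" for S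
  have fin: "finite W" "\<And>S. S \<subseteq> W \<Longrightarrow> finite S" by (auto simp: W_def intro: finite_subset)
  let ?N = "\<lambda>E. {x\<in>{..<n}. {x, u} \<in> E \<and> {x, w} \<in> E}"
  have N: "?N E \<subseteq> W" if "E \<in> set_pmf (gnp n p)" for E
  proof -
    have "{x} \<notin> E" for x using set_gnp[OF that] by (auto simp: nsets_def)
    then show ?thesis by (auto simp: W_def)
  qed
  have FE: "S \<subseteq> ?N E \<longleftrightarrow> F S \<subseteq> E" if "S \<subseteq> W" for S E using that by (auto simp: F_def W_def)
  have two: "(2::real) ^ card (?N E) = (\<Sum>S\<in>Pow W. of_bool (F S \<subseteq> E))" if E: "E \<in> set_pmf (gnp n p)" for E
  proof -
    have "(2::real) ^ card (?N E) = real (card (Pow (?N E)))" by (simp add: card_Pow)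
    also have "Pow (?N E) = {S \<in> Pow W. F S \<subseteq> E}"
      using N[OF E] FE by blast
    also have "real (card \<dots>) = (\<Sum>S\<in>Pow W. of_bool (F S \<subseteq> E))"
      using fin by (simp add: Int_def)
    finally show ?thesis .
  qed
  have prob: "measure_pmf.prob (gnp n p) {E. F S \<subseteq> E} = (p\<^sup>2) ^ card S" if S: "S \<subseteq> W" for S
  proof -
    have sub: "F S \<subseteq> nsets {..<n} 2" using S uw by (auto simp: F_def W_def)
    have "measure_pmf.prob (gnp n p) {E. F S \<subseteq> E}
        = measure_pmf.prob (pi_bernoulli (nsets {..<n} 2) (\<lambda>_. p)) {s. \<forall>e\<in>F S. s e}"
      unfolding gnp_altdef measure_map_pmf using sub by (intro arg_cong2[where f = measure_pmf.prob] refl) auto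
    also have "\<dots> = p ^ card (F S)"
      using sub p by (subst prob_all_pi_bernoulli) (auto simp: finite_imp_finite_nsets)
    also have "card (F S) = card S + card S"
    proof -
      have "card (F S) = card ((\<lambda>x. {x, u}) ` S) + card ((\<lambda>x. {x, w}) ` S)"
        unfolding F_def using S uw fin(2)[OF S] by (intro card_Un_disjoint) (auto simp: W_def doubleton_eq_iff)
      also have "\<dots> = card S + card S"
        using S by (intro arg_cong2[where f = "(+)"] card_image) (auto simp: inj_on_def doubleton_eq_iff W_def)
      finally show ?thesis .
    qed
    finally show ?thesis by (simp add: power2_eq_square power_add power_mult_distrib)
  qed
  have exp_le: "exp (real k / 2) \<le> (2::real) ^ k" for k
  proof -
    have "exp (real k / 2) = exp (1/2) ^ k" by (simp flip: exp_of_nat_mult)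
    also have "exp (1/2 :: real) \<le> 2" using exp_le_quadratic[of "1/2"] by (simp add: power2_eq_square)
    then have "exp (1/2 :: real) ^ k \<le> 2 ^ k" by (intro power_mono) auto
    finally show ?thesis .
  qed
  have "measure_pmf.prob (gnp n p) {E. a < real (card (?N E))}
      \<le> measure_pmf.expectation (gnp n p) (\<lambda>E. exp (- (a / 2)) * (\<Sum>S\<in>Pow W. of_bool (F S \<subseteq> E)))"
  proof (rule pmf_prob_le_expectation)
    fix E assume E: "E \<in> set_pmf (gnp n p)" "E \<in> {E. a < real (card (?N E))}"
    have "1 \<le> exp (- (a / 2)) * exp (real (card (?N E)) / 2)"
      using E(2) by (simp flip: exp_add)
    also have "\<dots> \<le> exp (- (a / 2)) * 2 ^ card (?N E)" by (intro mult_left_mono exp_le) auto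
    finally show "1 \<le> exp (- (a / 2)) * (\<Sum>S\<in>Pow W. of_bool (F S \<subseteq> E))" using two[OF E(1)] by simp
  qed (intro integrable_measure_pmf_finite add_nonneg_nonneg mult_nonneg_nonneg sum_nonneg; simp)+
  also have "\<dots> = exp (- (a / 2)) * (\<Sum>S\<in>Pow W. measure_pmf.prob (gnp n p) {E. F S \<subseteq> E})"
  proof -
    have "(\<lambda>E. of_bool (F S \<subseteq> E)) = (indicator {E. F S \<subseteq> E} :: _ \<Rightarrow> real)" for S
      by (auto simp: indicator_def)
    then show ?thesis
      by (simp add: Bochner_Integration.integral_sum integrable_measure_pmf_finite del: sum_of_bool_eq)
  qed
  also have "(\<Sum>S\<in>Pow W. measure_pmf.prob (gnp n p) {E. F S \<subseteq> E}) = (\<Sum>S\<in>Pow W. (\<Prod>x\<in>S. p\<^sup>2) * (\<Prod>x\<in>W-S. 1))"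
    by (intro sum.cong) (auto simp: prob)
  also have "\<dots> = (\<Prod>x\<in>W. p\<^sup>2 + 1)" using fin by (intro prod_add[symmetric]) auto
  also have "\<dots> = (1 + p\<^sup>2) ^ card W" by (simp add: add.commute)
  also have "\<dots> \<le> (1 + p\<^sup>2) ^ n"
    by (intro power_increasing) (auto simp: W_def intro: order.trans[OF card_mono[of "{..<n}"]])
  also have "\<dots> \<le> exp (p\<^sup>2) ^ n" by (intro power_mono exp_ge_add_one_self) auto
  also have "\<dots> = exp (real n * p\<^sup>2)" by (simp flip: exp_of_nat_mult)
  also have "exp (- (a / 2)) * exp (real n * p\<^sup>2) = exp (real n * p\<^sup>2 - a / 2)" by (simp flip: exp_add)
  finally show ?thesis by simp
qed


text \<open>The deterministic conditions under which the chain is analysed. Degrees make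
  \<open>\<pi>\<close> comparable to the uniform distribution, squared deviations control the
  dispersion of the walk probabilities for every A, and codegrees take over for sets too small for
  that bound to be useful.\<close>

definition pseudorandom :: "nat \<Rightarrow> real \<Rightarrow> nat set set \<Rightarrow> bool" where
  "pseudorandom n p E \<longleftrightarrow> E \<subseteq> nsets {..<n} 2
     \<and> (\<forall>v<n. real n * p / 2 \<le> real (degree_in E {..<n} v) \<and> real (degree_in E {..<n} v) \<le> 2 * (real n * p))
     \<and> (\<forall>A\<subseteq>{..<n}. (\<Sum>v<n. (edge_dev p E A v)\<^sup>2) \<le> 80 * (real n)\<^sup>2 * p)
     \<and> (\<forall>u<n. \<forall>w<n. u \<noteq> w \<longrightarrow> real (card {x\<in>{..<n}. {x, u} \<in> E \<and> {x, w} \<in> E})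
           \<le> 2 * real n * p\<^sup>2 + 8 * ln (real n))"

text \<open>Three union bounds: over n vertices, over 2^n <= e^n sets with failure probability
  exp(-2n) each, and over at most n^2 pairs with failure probability n^-4 each, the latter being
  half of the exponent 8 ln n in the codegree condition.\<close>

lemma gnp_pseudorandom:
  assumes p: "0 \<le> p" "p \<le> 1" and n: "4 \<le> n" and m: "1 \<le> real n * p"
  shows "1 - (2 * real n * exp (- (real n * p / 128)) + exp (- real n) + 1 / (real n)\<^sup>2)
       \<le> measure_pmf.prob (gnp n p) {E. pseudorandom n p E}"
proof -
  let ?P = "measure_pmf.prob (gnp n p)"
  define D where "D v = {E. real n * p / 4 \<le> \<bar>edge_dev p E {..<n} v\<bar>}" for v
  define Q where "Q A = {E. (\<forall>v<n. \<bar>edge_dev p E A v\<bar> \<le> 2 * (real n * p)) \<and>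
               80 * (real n)\<^sup>2 * p < (\<Sum>v<n. (edge_dev p E A v)\<^sup>2)}" for A
  define C where "C = (\<lambda>(u, w). {E. 2 * real n * p\<^sup>2 + 8 * ln (real n)
      < real (card {x\<in>{..<n}. {x, u} \<in> E \<and> {x, w} \<in> E})})"
  define J where "J = {(u, w). u < n \<and> w < n \<and> u \<noteq> w}"
  have finJ: "finite J" by (rule finite_subset[of _ "{..<n} \<times> {..<n}"]) (auto simp: J_def)
  have good: "pseudorandom n p E"
    if E: "E \<in> set_pmf (gnp n p)" "E \<notin> (\<Union>v<n. D v) \<union> (\<Union>A\<in>Pow {..<n}. Q A) \<union> (\<Union>e\<in>J. C e)" for E
  proof -
    have sub: "E \<subseteq> nsets {..<n} 2" by (rule set_gnp[OF E(1)])
    then have loop: "{v} \<notin> E" for v by (auto simp: nsets_def)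
    have deg: "real n * p / 2 \<le> real (degree_in E {..<n} v)" "real (degree_in E {..<n} v) \<le> 2 * (real n * p)"
      if v: "v < n" for v
    proof -
      have "\<bar>edge_dev p E {..<n} v\<bar> < real n * p / 4"
      proof -
        have "E \<notin> D v" using E(2) v by blast
        then show ?thesis by (simp add: D_def not_le)
      qed
      moreover have "edge_dev p E {..<n} v = real (degree_in E {..<n} v) - p * (real n - 1)"
        using loop v by (subst edge_dev_conv_degree_in) (auto simp: of_nat_diff)
      \<comment> \<open>The mean degree is p (n - 1) and not p n; for n >= 4 the loss is at most
        np/4, which together with the deviation np/4 still leaves np/2.\<close>
      moreover have "p * real n \<ge> p * 4" using n p by (intro mult_left_mono) auto
      moreover have "p * (real n - 1) = real n * p - p" by (simp add: algebra_simps)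
      ultimately show "real n * p / 2 \<le> real (degree_in E {..<n} v)"
        "real (degree_in E {..<n} v) \<le> 2 * (real n * p)"
        using p m unfolding abs_less_iff mult.commute[of p "real n"] by linarith+
    qed
    \<comment> \<open>Provides the pointwise bound built into \<open>Q\<close>, without which the
      quadratic estimate over the net would not apply; it follows from the degree bounds
      alone.\<close>
    have dev: "\<bar>edge_dev p E A v\<bar> \<le> 2 * (real n * p)" if A: "A \<subseteq> {..<n}" and v: "v < n" for A v
    proof -
      have finA: "finite A" using A by (rule finite_subset) simp
      have "degree_in E A v \<le> degree_in E {..<n} v"
        unfolding degree_in_def using A by (intro card_mono) auto
      moreover have "card (A - {v}) \<le> n"
        using card_mono[of "{..<n}" "A - {v}"] A by auto
      then have "p * real (card (A - {v})) \<le> p * real n" using p by (intro mult_left_mono) auto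
      moreover have "0 \<le> p * real (card (A - {v}))" "0 \<le> p * real n" using p by simp_all
      ultimately have "- (2 * (real n * p)) \<le> real (degree_in E A v) - p * real (card (A - {v}))"
        "real (degree_in E A v) - p * real (card (A - {v})) \<le> 2 * (real n * p)"
        using deg(2)[OF v] unfolding mult.commute[of p "real n"] by linarith+
      then show ?thesis unfolding edge_dev_conv_degree_in[OF finA loop] unfolding abs_le_iff by linarith
    qed
    show ?thesis unfolding pseudorandom_def
    proof (intro conjI allI impI)
      fix A assume A: "A \<subseteq> {..<n}"
      then have "E \<notin> Q A" using E(2) by blast
      then show "(\<Sum>v<n. (edge_dev p E A v)\<^sup>2) \<le> 80 * (real n)\<^sup>2 * p"
        using dev[OF A] by (auto simp: Q_def not_less)
    next
      fix u w assume "u < n" "w < n" "u \<noteq> w"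
      then have "(u, w) \<in> J" by (simp add: J_def)
      then have "E \<notin> C (u, w)" using E(2) by blast
      then show "real (card {x \<in> {..<n}. {x, u} \<in> E \<and> {x, w} \<in> E}) \<le> 2 * real n * p\<^sup>2 + 8 * ln (real n)"
        by (simp add: C_def)
    qed (use sub deg in auto)
  qed
  have PD: "?P (\<Union>v<n. D v) \<le> 2 * real n * exp (- (real n * p / 128))"
  proof -
    have "?P (\<Union>v<n. D v) \<le> (\<Sum>v<n. ?P (D v))" by (intro measure_UNION_le) auto
    also have "\<dots> \<le> (\<Sum>v<n. 2 * exp (- (real n * p / 128)))"
      using gnp_degree_deviation[OF p] by (intro sum_mono) (auto simp: D_def)
    finally show ?thesis by simp
  qed
  have PQ: "?P (\<Union>A\<in>Pow {..<n}. Q A) \<le> exp (- real n)"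
  proof -
    have "?P (\<Union>A\<in>Pow {..<n}. Q A) \<le> (\<Sum>A\<in>Pow {..<n}. ?P (Q A))" by (intro measure_UNION_le) auto
    also have "\<dots> \<le> (\<Sum>A\<in>Pow {..<n}. exp (- (2 * real n)))"
      using gnp_quadratic_deviation[OF p m] by (intro sum_mono) (auto simp: Q_def)
    also have "\<dots> = 2 ^ n * exp (- (2 * real n))" by (simp add: card_Pow)
    also have "\<dots> \<le> exp 1 ^ n * exp (- (2 * real n))"
      using exp_ge_add_one_self[of 1] by (intro mult_right_mono power_mono) auto
    also have "\<dots> = exp (- real n)" by (simp flip: exp_of_nat_mult exp_add)
    finally show ?thesis .
  qed
  have PC: "?P (\<Union>e\<in>J. C e) \<le> 1 / (real n)\<^sup>2"
  proof -
    have "?P (\<Union>e\<in>J. C e) \<le> (\<Sum>e\<in>J. ?P (C e))" by (intro measure_UNION_le finJ) auto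
    also have "\<dots> \<le> (\<Sum>e\<in>J. 1 / real n ^ 4)"
    proof (intro sum_mono)
      fix e assume "e \<in> J"
      then obtain u w where e: "e = (u, w)" "u < n" "w < n" "u \<noteq> w" by (auto simp: J_def)
      have "?P (C e) \<le> exp (real n * p\<^sup>2 - (2 * real n * p\<^sup>2 + 8 * ln (real n)) / 2)"
        unfolding C_def e(1) prod.case using e by (intro gnp_codegree p) auto
      also have "real n * p\<^sup>2 - (2 * real n * p\<^sup>2 + 8 * ln (real n)) / 2 = - ln (real n ^ 4)"
        using n by (simp add: ln_realpow field_simps)
      also have "exp \<dots> = 1 / real n ^ 4" using n by (simp add: exp_minus field_simps)
      finally show "?P (C e) \<le> 1 / real n ^ 4" .
    qed
    also have "\<dots> = real (card J) / real n ^ 4" by simp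
    also have "\<dots> \<le> (real n * real n) / real n ^ 4"
    proof (intro divide_right_mono)
      have "card J \<le> card ({..<n} \<times> {..<n})" by (intro card_mono) (auto simp: J_def)
      then show "real (card J) \<le> real n * real n" by (simp flip: of_nat_mult)
    qed auto
    also have "\<dots> = 1 / (real n)\<^sup>2" using n by (simp add: eval_nat_numeral)
    finally show ?thesis .
  qed
  have "1 - ?P {E. pseudorandom n p E} = ?P (- {E. pseudorandom n p E})"
    using measure_pmf.prob_compl[of "{E. pseudorandom n p E}" "gnp n p"] by (simp add: Compl_eq_Diff_UNIV)
  also have "\<dots> \<le> ?P ((\<Union>v<n. D v) \<union> (\<Union>A\<in>Pow {..<n}. Q A) \<union> (\<Union>e\<in>J. C e))"
  proof (intro measure_pmf.finite_measure_mono_AE AE_pmfI impI)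
    fix E assume "E \<in> set_pmf (gnp n p)" "E \<in> - {E. pseudorandom n p E}"
    then show "E \<in> (\<Union>v<n. D v) \<union> (\<Union>A\<in>Pow {..<n}. Q A) \<union> (\<Union>e\<in>J. C e)"
      using good[of E] by (metis ComplD mem_Collect_eq)
  qed simp
  also have "\<dots> \<le> ?P (\<Union>v<n. D v) + ?P (\<Union>A\<in>Pow {..<n}. Q A) + ?P (\<Union>e\<in>J. C e)"
    by (rule order.trans[OF measure_Un_le add_right_mono[OF measure_Un_le]]) auto
  finally show ?thesis using PD PQ PC by linarith
qed

section \<open>One round of functional voting on a stationary walk\<close>

text \<open>\<open>\<pi>\<close> is the stationary distribution of simple random walk and \<open>X A v\<close> its probability to
  step from \<open>v\<close> into \<open>A\<close>.\<close>

locale voting_walk =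
  fixes V :: "'a set" and \<pi> :: "'a \<Rightarrow> real" and X :: "'a set \<Rightarrow> 'a \<Rightarrow> real" and N :: real
  assumes finite_V: "finite V"
    and N_pos: "0 < N"
    and pi_lower: "v \<in> V \<Longrightarrow> 1 / (4 * N) \<le> \<pi> v"
    and pi_upper: "v \<in> V \<Longrightarrow> \<pi> v \<le> 4 / N"
    and pi_sum: "sum \<pi> V = 1"
    and X_nonneg: "A \<subseteq> V \<Longrightarrow> v \<in> V \<Longrightarrow> 0 \<le> X A v"
    and X_compl: "A \<subseteq> V \<Longrightarrow> v \<in> V \<Longrightarrow> X (V - A) v = 1 - X A v"
    and stationary: "A \<subseteq> V \<Longrightarrow> (\<Sum>v\<in>V. \<pi> v * X A v) = sum \<pi> A"
begin

text \<open>By stationarity this is the variance of \<open>X A\<close> under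
  \<open>\<pi>\<close>.\<close>

definition disp :: "'a set \<Rightarrow> real" where
  "disp A = (\<Sum>v\<in>V. \<pi> v * (X A v - sum \<pi> A)\<^sup>2)"

lemma pi_pos: "v \<in> V \<Longrightarrow> 0 < \<pi> v"
  using pi_lower[of v] N_pos by (smt (verit) divide_pos_pos)

lemma pi_nonneg: "v \<in> V \<Longrightarrow> 0 \<le> \<pi> v"
  using pi_pos by (rule less_imp_le)

lemma X_le_1: "A \<subseteq> V \<Longrightarrow> v \<in> V \<Longrightarrow> X A v \<le> 1"
  using X_nonneg[of "V - A" v] X_compl[of A v] by auto

lemma mass_compl: "A \<subseteq> V \<Longrightarrow> sum \<pi> (V - A) = 1 - sum \<pi> A"
  using finite_V pi_sum by (simp add: sum_diff)

lemma mass_bounds: assumes "A \<subseteq> V" shows "0 \<le> sum \<pi> A" "sum \<pi> A \<le> 1"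
proof -
  have *: "0 \<le> sum \<pi> B" if "B \<subseteq> V" for B
    using that pi_pos by (intro sum_nonneg) (auto intro: less_imp_le)
  show "0 \<le> sum \<pi> A" by (rule *[OF assms])
  show "sum \<pi> A \<le> 1" using *[of "V - A"] mass_compl[OF assms] by auto
qed

lemma weighted_abs_le:
  "(\<Sum>v\<in>V. \<pi> v * \<bar>x v\<bar>) \<le> sqrt (\<Sum>v\<in>V. \<pi> v * (x v)\<^sup>2)"
proof -
  have "(\<Sum>v\<in>V. \<pi> v * \<bar>x v\<bar>) = (\<Sum>v\<in>V. sqrt (\<pi> v) * (sqrt (\<pi> v) * \<bar>x v\<bar>))"
    using pi_pos by (intro sum.cong) (simp_all add: less_imp_le flip: mult.assoc)
  also have "\<dots> \<le> sqrt ((\<Sum>v\<in>V. (sqrt (\<pi> v))\<^sup>2) * (\<Sum>v\<in>V. (sqrt (\<pi> v) * \<bar>x v\<bar>)\<^sup>2))"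
    using Cauchy_Schwarz_ineq_sum[of "\<lambda>v. sqrt (\<pi> v)" "\<lambda>v. sqrt (\<pi> v) * \<bar>x v\<bar>" V]
    by (rule real_le_rsqrt)
  also have "(\<Sum>v\<in>V. (sqrt (\<pi> v))\<^sup>2) = 1"
    using pi_pos pi_sum by (simp add: less_imp_le)
  also have "(\<Sum>v\<in>V. (sqrt (\<pi> v) * \<bar>x v\<bar>)\<^sup>2) = (\<Sum>v\<in>V. \<pi> v * (x v)\<^sup>2)"
    using pi_pos by (intro sum.cong) (simp_all add: less_imp_le power_mult_distrib)
  finally show ?thesis by simp
qed

text \<open>The usual shift formula for a variance. It is used with b = |A|/n, the reference value
  natural for degrees, and with b = 0, which gives the raw second moment.\<close>

lemma disp_eq:
  assumes A: "A \<subseteq> V"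
  shows "disp A = (\<Sum>v\<in>V. \<pi> v * (X A v - b)\<^sup>2) - (sum \<pi> A - b)\<^sup>2"
proof -
  have *: "(\<Sum>v\<in>V. \<pi> v * (X A v - c)\<^sup>2) = (\<Sum>v\<in>V. \<pi> v * (X A v)\<^sup>2) - 2 * c * sum \<pi> A + c\<^sup>2" for c
  proof -
    have "(\<Sum>v\<in>V. \<pi> v * (X A v - c)\<^sup>2) = (\<Sum>v\<in>V. \<pi> v * (X A v)\<^sup>2 - 2 * c * (\<pi> v * X A v) + c\<^sup>2 * \<pi> v)"
      by (intro sum.cong) (auto simp: power2_eq_square algebra_simps)
    also have "\<dots> = (\<Sum>v\<in>V. \<pi> v * (X A v)\<^sup>2) - 2 * c * (\<Sum>v\<in>V. \<pi> v * X A v) + c\<^sup>2 * sum \<pi> V"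
      by (simp add: sum.distrib sum_subtractf sum_distrib_left)
    finally show ?thesis using stationary[OF A] pi_sum by simp
  qed
  show ?thesis unfolding disp_def * by (simp add: power2_eq_square algebra_simps)
qed

end

text \<open>What the C^2 hypothesis yields on [0,1] for the lazy rule \<open>g\<close>, with
  derivative \<open>g'\<close>. Behaviour outside [0,1] never enters, because the walk probabilities
  lie inside.\<close>

locale voting_rule =
  fixes g g' :: "real \<Rightarrow> real" and L M :: real
  assumes g_range: "x \<in> {0..1} \<Longrightarrow> g x \<in> {0..1}"
    and g_0: "g 0 = 0"
    and g_lipschitz: "x \<in> {0..1} \<Longrightarrow> y \<in> {0..1} \<Longrightarrow> \<bar>g x - g y\<bar> \<le> L * \<bar>x - y\<bar>"
    and g_taylor: "x \<in> {0..1} \<Longrightarrow> y \<in> {0..1} \<Longrightarrow> \<bar>g x - g y - g' y * (x - y)\<bar> \<le> M * (x - y)\<^sup>2"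
    and g'_lipschitz: "x \<in> {0..1} \<Longrightarrow> y \<in> {0..1} \<Longrightarrow> \<bar>g' x - g' y\<bar> \<le> M * \<bar>x - y\<bar>"
    and g'_0: "0 \<le> g' 0"
    and L_nonneg: "0 \<le> L" and M_nonneg: "0 \<le> M"
begin

text \<open>The point 1/2 is fixed by H. In the window around it only the size of the displacement
  matters, not its direction.\<close>

lemma updating_lipschitz_half:
  assumes "x \<in> {0..1}" shows "\<bar>updating g x - 1/2\<bar> \<le> (2 + L) * \<bar>x - 1/2\<bar>"
proof -
  have "updating g x - 1/2 = (x - 1/2) * (1 - g (1 - x)) - (x - 1/2) * g x
      + ((g x - g (1/2)) / 2 - (g (1 - x) - g (1/2)) / 2)"
    by (simp add: updating_def field_simps)
  also have "\<bar>\<dots>\<bar> \<le> \<bar>(x - 1/2) * (1 - g (1 - x))\<bar> + \<bar>(x - 1/2) * g x\<bar>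
      + (\<bar>g x - g (1/2)\<bar> / 2 + \<bar>g (1 - x) - g (1/2)\<bar> / 2)"
  proof -
    have "\<bar>a - b + (c / 2 - d / 2)\<bar> \<le> \<bar>a\<bar> + \<bar>b\<bar> + (\<bar>c\<bar> / 2 + \<bar>d\<bar> / 2)" for a b c d :: real by linarith
    then show ?thesis .
  qed
  also have "\<dots> \<le> \<bar>x - 1/2\<bar> * 1 + \<bar>x - 1/2\<bar> * 1 + (L * \<bar>x - 1/2\<bar> / 2 + L * \<bar>x - 1/2\<bar> / 2)"
    using g_range[of x] g_range[of "1 - x"] assms g_lipschitz[of x "1/2"] g_lipschitz[of "1 - x" "1/2"]
    unfolding abs_mult
    by (intro add_mono mult_left_mono divide_right_mono) (auto simp: abs_minus_commute)
  also have "\<dots> = (2 + L) * \<bar>x - 1/2\<bar>" by (simp add: algebra_simps)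
  finally show ?thesis .
qed

end

locale voting = voting_walk V \<pi> X N + voting_rule g g' L M
  for V :: "'a set" and \<pi> X N g g' L M
begin

text \<open>Probability that v holds opinion 0 after the round.\<close>

definition rate :: "'a set \<Rightarrow> 'a \<Rightarrow> real" where
  "rate A v = (if v \<in> A then 1 - g (X (V - A) v) else g (X A v))"

definition drift :: "'a set \<Rightarrow> real" where
  "drift A = (\<Sum>v\<in>V. \<pi> v * rate A v)"

lemma rate_bounds: assumes "A \<subseteq> V" "v \<in> V" shows "0 \<le> rate A v" "rate A v \<le> 1"
  using g_range[of "X A v"] g_range[of "X (V - A) v"] assms
    X_nonneg[of A v] X_nonneg[of "V - A" v] X_le_1[of A v] X_le_1[of "V - A" v]
  by (auto simp: rate_def)

lemma drift_bounds: assumes "A \<subseteq> V" shows "0 \<le> drift A" "drift A \<le> 1"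
proof -
  show "0 \<le> drift A" unfolding drift_def
    using rate_bounds[OF assms] pi_pos by (intro sum_nonneg mult_nonneg_nonneg) (auto intro: less_imp_le)
  have "drift A \<le> (\<Sum>v\<in>V. \<pi> v * 1)" unfolding drift_def
    using rate_bounds[OF assms] pi_pos by (intro sum_mono mult_left_mono) (auto intro: less_imp_le)
  then show "drift A \<le> 1" using pi_sum by simp
qed

lemma rate_compl: "A \<subseteq> V \<Longrightarrow> v \<in> V \<Longrightarrow> rate (V - A) v = 1 - rate A v"
  by (auto simp: rate_def double_diff)

lemma drift_compl: "A \<subseteq> V \<Longrightarrow> drift (V - A) = 1 - drift A"
  using pi_sum by (simp add: drift_def rate_compl right_diff_distrib sum_subtractf)

text \<open>Stationarity makes the first-order terms over \<open>A\<close> and over \<open>V - A\<close> opposite to each other,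
  so that only the small factor \<open>g' (1 - \<alpha>) - g' \<alpha>\<close> remains in front of them.\<close>

lemma drift_approx:
  assumes A: "A \<subseteq> V"
  defines "\<alpha> \<equiv> sum \<pi> A"
  shows "\<bar>drift A - updating g \<alpha>\<bar> \<le> M * \<bar>1 - 2 * \<alpha>\<bar> * sqrt (disp A) + M * disp A"
proof -
  define \<delta> where "\<delta> v = X A v - \<alpha>" for v
  define lin where "lin v = (if v \<in> A then 1 - g (1 - \<alpha>) + g' (1 - \<alpha>) * \<delta> v else g \<alpha> + g' \<alpha> * \<delta> v)" for v
  have \<alpha>: "\<alpha> \<in> {0..1}" "1 - \<alpha> \<in> {0..1}" using mass_bounds[OF A] by (auto simp: \<alpha>_def)
  have \<delta>0: "(\<Sum>v\<in>V. \<pi> v * \<delta> v) = 0"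
    using stationary[OF A] pi_sum by (simp add: \<delta>_def right_diff_distrib sum_subtractf flip: sum_distrib_right) (simp add: \<alpha>_def)
  have split: "(\<Sum>v\<in>V. F v) = (\<Sum>v\<in>A. F v) + (\<Sum>v\<in>V - A. F v)" for F :: "'a \<Rightarrow> real"
    using A finite_V by (simp add: sum.subset_diff add.commute)
  have "(\<Sum>v\<in>V. \<pi> v * lin v) = (\<Sum>v\<in>A. \<pi> v * (1 - g (1 - \<alpha>)) + g' (1 - \<alpha>) * (\<pi> v * \<delta> v))
      + (\<Sum>v\<in>V - A. \<pi> v * g \<alpha> + g' \<alpha> * (\<pi> v * \<delta> v))"
    unfolding split by (intro arg_cong2[where f = "(+)"] sum.cong) (auto simp: lin_def algebra_simps)
  also have "\<dots> = \<alpha> * (1 - g (1 - \<alpha>)) + g' (1 - \<alpha>) * (\<Sum>v\<in>A. \<pi> v * \<delta> v)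
      + ((1 - \<alpha>) * g \<alpha> + g' \<alpha> * (\<Sum>v\<in>V - A. \<pi> v * \<delta> v))"
    using mass_compl[OF A] by (simp add: sum.distrib \<alpha>_def flip: sum_distrib_left sum_distrib_right)
  also have "(\<Sum>v\<in>V - A. \<pi> v * \<delta> v) = - (\<Sum>v\<in>A. \<pi> v * \<delta> v)"
    using \<delta>0 split[of "\<lambda>v. \<pi> v * \<delta> v"] by simp
  finally have lin: "(\<Sum>v\<in>V. \<pi> v * lin v) = updating g \<alpha> + (g' (1 - \<alpha>) - g' \<alpha>) * (\<Sum>v\<in>A. \<pi> v * \<delta> v)"
    by (simp add: updating_def algebra_simps)
  have "\<bar>drift A - (\<Sum>v\<in>V. \<pi> v * lin v)\<bar> = \<bar>\<Sum>v\<in>V. \<pi> v * (rate A v - lin v)\<bar>"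
    by (simp add: drift_def right_diff_distrib sum_subtractf)
  also have "\<dots> \<le> (\<Sum>v\<in>V. \<bar>\<pi> v * (rate A v - lin v)\<bar>)" by (rule sum_abs)
  also have "\<dots> \<le> (\<Sum>v\<in>V. M * (\<pi> v * (\<delta> v)\<^sup>2))"
  proof (intro sum_mono)
    fix v assume v: "v \<in> V"
    have X: "X A v \<in> {0..1}" "1 - X A v \<in> {0..1}" using X_nonneg[OF A v] X_le_1[OF A v] by auto
    have "\<bar>rate A v - lin v\<bar> \<le> M * (\<delta> v)\<^sup>2"
    proof (cases "v \<in> A")
      case True
      have "rate A v - lin v = - (g (1 - X A v) - g (1 - \<alpha>) - g' (1 - \<alpha>) * ((1 - X A v) - (1 - \<alpha>)))"
        using True by (simp add: rate_def lin_def \<delta>_def X_compl[OF A v]) (simp add: algebra_simps)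
      then show ?thesis using g_taylor[OF X(2) \<alpha>(2)] by (simp add: \<delta>_def power2_commute abs_minus_commute)
    next
      case False
      then show ?thesis using g_taylor[OF X(1) \<alpha>(1)] by (simp add: rate_def lin_def \<delta>_def algebra_simps)
    qed
    then have "\<pi> v * \<bar>rate A v - lin v\<bar> \<le> \<pi> v * (M * (\<delta> v)\<^sup>2)"
      using pi_pos[OF v] by (intro mult_left_mono) auto
    then show "\<bar>\<pi> v * (rate A v - lin v)\<bar> \<le> M * (\<pi> v * (\<delta> v)\<^sup>2)"
      using pi_pos[OF v] by (simp add: abs_mult mult_ac)
  qed
  also have "\<dots> = M * disp A" by (simp add: disp_def \<delta>_def \<alpha>_def sum_distrib_left)
  finally have 1: "\<bar>drift A - (\<Sum>v\<in>V. \<pi> v * lin v)\<bar> \<le> M * disp A" .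
  have "\<bar>\<Sum>v\<in>A. \<pi> v * \<delta> v\<bar> \<le> (\<Sum>v\<in>A. \<pi> v * \<bar>\<delta> v\<bar>)"
    by (intro order.trans[OF sum_abs] sum_mono) (simp add: abs_mult abs_of_pos[OF pi_pos[OF subsetD[OF A]]])
  also have "\<dots> \<le> (\<Sum>v\<in>V. \<pi> v * \<bar>\<delta> v\<bar>)"
    using A finite_V by (intro sum_mono2) (auto intro!: mult_nonneg_nonneg pi_nonneg)
  also have "\<dots> \<le> sqrt (disp A)"
    using weighted_abs_le[of \<delta>] by (simp add: disp_def \<delta>_def \<alpha>_def)
  finally have "\<bar>(g' (1 - \<alpha>) - g' \<alpha>) * (\<Sum>v\<in>A. \<pi> v * \<delta> v)\<bar> \<le> M * \<bar>1 - 2 * \<alpha>\<bar> * sqrt (disp A)"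
    using g'_lipschitz[OF \<alpha>(2,1)] M_nonneg unfolding abs_mult
    by (intro mult_mono) (auto simp: algebra_simps)
  then show ?thesis using 1 lin by linarith
qed

text \<open>The factor approximates the derivative 1 - g(1) + g'(0) of H at 0. A vertex of A sees
  mostly the other opinion, so it stays with probability close to 1 - g(1). Outside A the linear
  term g'(0) X sums to the mass of A by stationarity. The estimate X <= s + X^2/s trades the
  remaining first-order error in A for the second moment.\<close>

lemma drift_small:
  assumes A: "A \<subseteq> V" and s: "0 < s" and S: "(\<Sum>v\<in>V. \<pi> v * (X A v)\<^sup>2) \<le> \<kappa> * sum \<pi> A"
  shows "drift A \<le> (1 - g 1 + g' 0 + L * s + (L / s + M) * \<kappa>) * sum \<pi> A"
proof -
  let ?S = "\<Sum>v\<in>V. \<pi> v * (X A v)\<^sup>2"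
  have split: "(\<Sum>v\<in>V. F v) = (\<Sum>v\<in>A. F v) + (\<Sum>v\<in>V - A. F v)" for F :: "'a \<Rightarrow> real"
    using A finite_V by (simp add: sum.subset_diff add.commute)
  have "(\<Sum>v\<in>A. \<pi> v * rate A v) \<le> (\<Sum>v\<in>A. (1 - g 1 + L * s) * \<pi> v + L / s * (\<pi> v * (X A v)\<^sup>2))"
  proof (intro sum_mono)
    fix v assume vA: "v \<in> A"
    then have v: "v \<in> V" using A by auto
    have X: "0 \<le> X A v" "X A v \<le> 1" using X_nonneg[OF A v] X_le_1[OF A v] by auto
    have "X A v \<le> s + (X A v)\<^sup>2 / s"
    proof (cases "X A v \<le> s")
      case False
      then have "X A v * s \<le> (X A v)\<^sup>2" using X by (simp add: power2_eq_square mult_left_mono)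
      then have "X A v \<le> (X A v)\<^sup>2 / s" using s by (simp add: field_simps)
      then show ?thesis using s by simp
    qed (use s in \<open>simp add: add_increasing2\<close>)
    then have "L * X A v \<le> L * (s + (X A v)\<^sup>2 / s)" using L_nonneg by (intro mult_left_mono) auto
    moreover have "rate A v \<le> 1 - g 1 + L * X A v"
      using g_lipschitz[of "1 - X A v" 1] X vA X_compl[OF A v] by (auto simp: rate_def)
    ultimately have "rate A v \<le> 1 - g 1 + L * s + L / s * (X A v)\<^sup>2" by (simp add: algebra_simps)
    then have "\<pi> v * rate A v \<le> \<pi> v * (1 - g 1 + L * s + L / s * (X A v)\<^sup>2)"
      using pi_pos[OF v] by (intro mult_left_mono) auto
    then show "\<pi> v * rate A v \<le> (1 - g 1 + L * s) * \<pi> v + L / s * (\<pi> v * (X A v)\<^sup>2)"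
      by (simp add: algebra_simps)
  qed
  also have "\<dots> = (1 - g 1 + L * s) * sum \<pi> A + L / s * (\<Sum>v\<in>A. \<pi> v * (X A v)\<^sup>2)"
    by (simp add: sum.distrib sum_distrib_left)
  also have "\<dots> \<le> (1 - g 1 + L * s) * sum \<pi> A + L / s * ?S"
    using A finite_V pi_pos s L_nonneg by (intro add_left_mono mult_left_mono sum_mono2) (auto intro!: mult_nonneg_nonneg pi_nonneg)
  finally have 1: "(\<Sum>v\<in>A. \<pi> v * rate A v) \<le> (1 - g 1 + L * s) * sum \<pi> A + L / s * ?S" .
  have "(\<Sum>v\<in>V - A. \<pi> v * rate A v) \<le> (\<Sum>v\<in>V - A. g' 0 * (\<pi> v * X A v) + M * (\<pi> v * (X A v)\<^sup>2))"
  proof (intro sum_mono)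
    fix v assume v: "v \<in> V - A"
    then have vV: "v \<in> V" by auto
    have X: "X A v \<in> {0..1}" using X_nonneg[OF A vV] X_le_1[OF A vV] by auto
    have "rate A v \<le> g' 0 * X A v + M * (X A v)\<^sup>2"
      using g_taylor[OF X, of 0] v g_0 by (auto simp: rate_def)
    then have "\<pi> v * rate A v \<le> \<pi> v * (g' 0 * X A v + M * (X A v)\<^sup>2)"
      using pi_pos[OF vV] by (intro mult_left_mono) auto
    then show "\<pi> v * rate A v \<le> g' 0 * (\<pi> v * X A v) + M * (\<pi> v * (X A v)\<^sup>2)"
      by (simp add: algebra_simps)
  qed
  \<comment> \<open>The sum can be enlarged from \<open>V - A\<close> to \<open>V\<close> because
    \<open>g' 0\<close> is nonnegative; only on \<open>V\<close> does stationarity evaluate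
    it.\<close>
  also have "\<dots> \<le> (\<Sum>v\<in>V. g' 0 * (\<pi> v * X A v) + M * (\<pi> v * (X A v)\<^sup>2))"
    using finite_V pi_pos g'_0 M_nonneg X_nonneg[OF A]
    by (intro sum_mono2) (auto intro!: add_nonneg_nonneg mult_nonneg_nonneg pi_nonneg)
  also have "\<dots> = g' 0 * sum \<pi> A + M * ?S"
    using stationary[OF A] by (simp add: sum.distrib flip: sum_distrib_left)
  finally have "drift A \<le> (1 - g 1 + L * s + g' 0) * sum \<pi> A + (L / s + M) * ?S"
    using 1 split[of "\<lambda>v. \<pi> v * rate A v"] by (simp add: drift_def algebra_simps)
  also have "\<dots> \<le> (1 - g 1 + L * s + g' 0) * sum \<pi> A + (L / s + M) * (\<kappa> * sum \<pi> A)"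
    using S L_nonneg M_nonneg s by (intro add_left_mono mult_left_mono add_nonneg_nonneg) auto
  finally show ?thesis by (simp add: algebra_simps)
qed

text \<open>One factor \<open>\<pi> v\<close> is bounded by 4/N, the other rebuilds the drift.
  Keeping the drift makes Chebyshev's error proportional to the mass, as needed near
  consensus.\<close>

lemma variance_le:
  assumes A: "A \<subseteq> V"
  shows "(\<Sum>v\<in>V. (\<pi> v)\<^sup>2 * (rate A v * (1 - rate A v))) \<le> 4 / N * drift A"
    and "(\<Sum>v\<in>V. (\<pi> v)\<^sup>2 * (rate A v * (1 - rate A v))) \<le> 4 / N * (1 - drift A)"
proof -
  have *: "(\<Sum>v\<in>V. (\<pi> v)\<^sup>2 * (rate B v * (1 - rate B v))) \<le> 4 / N * drift B" if B: "B \<subseteq> V" for B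
    unfolding drift_def sum_distrib_left
  proof (intro sum_mono)
    fix v assume v: "v \<in> V"
    have "(\<pi> v)\<^sup>2 * (rate B v * (1 - rate B v)) \<le> (\<pi> v * (4 / N)) * (rate B v * 1)"
      unfolding power2_eq_square using rate_bounds[OF B v] pi_pos[OF v] pi_upper[OF v] N_pos
      by (intro mult_mono mult_nonneg_nonneg) auto
    then show "(\<pi> v)\<^sup>2 * (rate B v * (1 - rate B v)) \<le> 4 / N * (\<pi> v * rate B v)" by (simp add: mult_ac)
  qed
  show "(\<Sum>v\<in>V. (\<pi> v)\<^sup>2 * (rate A v * (1 - rate A v))) \<le> 4 / N * drift A" by (rule *[OF A])
  show "(\<Sum>v\<in>V. (\<pi> v)\<^sup>2 * (rate A v * (1 - rate A v))) \<le> 4 / N * (1 - drift A)"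
    using *[of "V - A"] A by (simp add: rate_compl drift_compl mult.commute[of "1 - _"] cong: sum.cong)
qed

text \<open>g (1 - g) inherits the Lipschitz constant L, since its increments factor as (g x - g
  y)(1 - g x - g y) with second factor at most 1 in modulus. On average X is within \<bar>\<alpha> -
  1/2\<bar> + \<surd>disp of 1/2, so most vertices are as undecided as at 1/2.\<close>

lemma variance_ge:
  assumes A: "A \<subseteq> V"
  shows "1 / (4 * N) * (g (1/2) * (1 - g (1/2)) - L * (\<bar>sum \<pi> A - 1/2\<bar> + sqrt (disp A)))
       \<le> (\<Sum>v\<in>V. (\<pi> v)\<^sup>2 * (rate A v * (1 - rate A v)))"
proof -
  define \<gamma> where "\<gamma> x = g x * (1 - g x)" for x
  let ?\<alpha> = "sum \<pi> A"
  have \<gamma>: "\<gamma> (1/2) - L * \<bar>x - 1/2\<bar> \<le> \<gamma> x" if x: "x \<in> {0..1}" for x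
  proof -
    have h: "g x \<in> {0..1}" "g (1/2) \<in> {0..1}" using g_range x by auto
    have "\<bar>\<gamma> (1/2) - \<gamma> x\<bar> = \<bar>g x - g (1/2)\<bar> * \<bar>1 - g x - g (1/2)\<bar>"
      unfolding abs_mult[symmetric] \<gamma>_def by (subst abs_minus_cancel[symmetric]) (rule arg_cong[where f = abs], simp add: algebra_simps)
    also have "\<dots> \<le> (L * \<bar>x - 1/2\<bar>) * 1"
      using h g_lipschitz[OF x, of "1/2"] L_nonneg by (intro mult_mono) auto
    finally show ?thesis by linarith
  qed
  have rate: "\<gamma> (1/2) - L * \<bar>X A v - 1/2\<bar> \<le> rate A v * (1 - rate A v)" if v: "v \<in> V" for v
    using \<gamma>[of "X A v"] \<gamma>[of "1 - X A v"] X_nonneg[OF A v] X_le_1[OF A v]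
    by (auto simp: rate_def X_compl[OF A v] \<gamma>_def abs_minus_commute mult.commute)
  have "(\<Sum>v\<in>V. \<pi> v * \<bar>X A v - 1/2\<bar>) \<le> (\<Sum>v\<in>V. \<pi> v * \<bar>X A v - ?\<alpha>\<bar> + \<bar>?\<alpha> - 1/2\<bar> * \<pi> v)"
  proof (intro sum_mono)
    fix v assume v: "v \<in> V"
    have "\<pi> v * \<bar>X A v - 1/2\<bar> \<le> \<pi> v * (\<bar>X A v - ?\<alpha>\<bar> + \<bar>?\<alpha> - 1/2\<bar>)"
      using pi_pos[OF v] by (intro mult_left_mono) auto
    then show "\<pi> v * \<bar>X A v - 1/2\<bar> \<le> \<pi> v * \<bar>X A v - ?\<alpha>\<bar> + \<bar>?\<alpha> - 1/2\<bar> * \<pi> v"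
      by (simp add: algebra_simps)
  qed
  also have "\<dots> \<le> sqrt (disp A) + \<bar>?\<alpha> - 1/2\<bar>"
    using weighted_abs_le[of "\<lambda>v. X A v - ?\<alpha>"] pi_sum
    by (simp add: disp_def sum.distrib flip: sum_distrib_left)
  finally have dev: "(\<Sum>v\<in>V. \<pi> v * \<bar>X A v - 1/2\<bar>) \<le> sqrt (disp A) + \<bar>?\<alpha> - 1/2\<bar>" .
  have "\<gamma> (1/2) - L * (\<bar>?\<alpha> - 1/2\<bar> + sqrt (disp A)) \<le> \<gamma> (1/2) - L * (\<Sum>v\<in>V. \<pi> v * \<bar>X A v - 1/2\<bar>)"
    using dev L_nonneg by (intro diff_left_mono mult_left_mono) auto
  also have "\<dots> = (\<Sum>v\<in>V. \<pi> v * (\<gamma> (1/2) - L * \<bar>X A v - 1/2\<bar>))"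
    using pi_sum by (simp add: right_diff_distrib sum_subtractf sum_distrib_left mult_ac flip: sum_distrib_right)
  also have "\<dots> \<le> (\<Sum>v\<in>V. \<pi> v * (rate A v * (1 - rate A v)))"
    using rate pi_pos by (intro sum_mono mult_left_mono) (auto intro: less_imp_le)
  finally have "1 / (4 * N) * (\<gamma> (1/2) - L * (\<bar>?\<alpha> - 1/2\<bar> + sqrt (disp A)))
      \<le> 1 / (4 * N) * (\<Sum>v\<in>V. \<pi> v * (rate A v * (1 - rate A v)))"
    using N_pos by (intro mult_left_mono) auto
  also have "\<dots> \<le> (\<Sum>v\<in>V. (\<pi> v)\<^sup>2 * (rate A v * (1 - rate A v)))"
    unfolding sum_distrib_left
  proof (intro sum_mono)
    fix v assume v: "v \<in> V"
    have "1 / (4 * N) * (\<pi> v * (rate A v * (1 - rate A v))) \<le> \<pi> v * (\<pi> v * (rate A v * (1 - rate A v)))"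
      using pi_lower[OF v] rate_bounds[OF A v] pi_pos[OF v] by (intro mult_right_mono mult_nonneg_nonneg) auto
    then show "1 / (4 * N) * (\<pi> v * (rate A v * (1 - rate A v))) \<le> (\<pi> v)\<^sup>2 * (rate A v * (1 - rate A v))"
      by (simp add: power2_eq_square mult_ac)
  qed
  finally show ?thesis by (simp add: \<gamma>_def)
qed

end

section \<open>The Lyapunov function\<close>

text \<open>This is \<open>min (1, K (1/2 - u) / (u \<surd>N))\<close> with \<open>u = \<bar>\<alpha> - 1/2\<bar>\<close>, written so that its value is 1 and
  not the junk value of a division by 0 at \<open>\<alpha> = 1/2\<close>.\<close>

definition lyap :: "real \<Rightarrow> real \<Rightarrow> real \<Rightarrow> real" where
  "lyap K N \<alpha> = K * (1/2 - \<bar>\<alpha> - 1/2\<bar>) / max (K * (1/2 - \<bar>\<alpha> - 1/2\<bar>)) (sqrt N * \<bar>\<alpha> - 1/2\<bar>)"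

lemma lyap_compl: "lyap K N (1 - \<alpha>) = lyap K N \<alpha>"
  by (simp add: lyap_def abs_minus_commute)

lemma lyap_denominator_pos:
  assumes "0 < K" "0 < N" "\<alpha> \<in> {0..1}"
  shows "0 < max (K * (1/2 - \<bar>\<alpha> - 1/2\<bar>)) (sqrt N * \<bar>\<alpha> - 1/2\<bar>)"
proof (cases "\<alpha> = 1/2")
  case True then show ?thesis using assms by (simp add: less_max_iff_disj)
next
  case False then have "0 < sqrt N * \<bar>\<alpha> - 1/2\<bar>" using assms by simp
  then show ?thesis by linarith
qed

lemma lyap_bounds:
  assumes "0 < K" "0 < N" "\<alpha> \<in> {0..1}"
  shows "0 \<le> lyap K N \<alpha>" "lyap K N \<alpha> \<le> 1"
proof -
  have "0 \<le> K * (1/2 - \<bar>\<alpha> - 1/2\<bar>)" using assms by (auto simp: abs_if)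
  then show "0 \<le> lyap K N \<alpha>" "lyap K N \<alpha> \<le> 1"
    using lyap_denominator_pos[OF assms] unfolding lyap_def by (auto simp: divide_le_eq)
qed

lemma lyap_le_ratio:
  assumes "0 < K" "0 < N" "\<alpha> \<in> {0..1}" "0 < u" "u \<le> \<bar>\<alpha> - 1/2\<bar>"
  shows "lyap K N \<alpha> \<le> K * (1/2 - u) / (sqrt N * u)"
proof -
  have "0 < sqrt N * u" using assms by simp
  moreover have "sqrt N * u \<le> sqrt N * \<bar>\<alpha> - 1/2\<bar>" using assms by (intro mult_left_mono) auto
  moreover have "0 \<le> K * (1/2 - \<bar>\<alpha> - 1/2\<bar>)" using assms by (auto simp: abs_if)
  moreover have "K * (1/2 - \<bar>\<alpha> - 1/2\<bar>) \<le> K * (1/2 - u)" using assms by (intro mult_left_mono) auto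
  ultimately show ?thesis unfolding lyap_def by (intro frac_le) auto
qed

lemma lyap_eq_ratio:
  assumes "K * (1/2 - \<bar>\<alpha> - 1/2\<bar>) \<le> sqrt N * \<bar>\<alpha> - 1/2\<bar>"
  shows "lyap K N \<alpha> = K * (1/2 - \<bar>\<alpha> - 1/2\<bar>) / (sqrt N * \<bar>\<alpha> - 1/2\<bar>)"
  using assms by (simp add: lyap_def max_def)

lemma lyap_eq_1:
  assumes "0 < K" "0 < N" "\<alpha> \<in> {0..1}" "sqrt N * \<bar>\<alpha> - 1/2\<bar> \<le> K * (1/2 - \<bar>\<alpha> - 1/2\<bar>)"
  shows "lyap K N \<alpha> = 1"
  using lyap_denominator_pos[OF assms(1-3)] unfolding lyap_def max.absorb1[OF assms(4)]
  by (intro divide_self) linarith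

text \<open>Off consensus both opinions have mass at least 1/(4N), because every vertex has. The
  bound needs only to be polynomial in N: its logarithm is what the number of rounds has to pay
  for.\<close>

lemma lyap_ge:
  assumes "1 \<le> K" "1 \<le> N" "\<alpha> \<in> {0..1}" "1 / (4 * N) \<le> \<alpha>" "1 / (4 * N) \<le> 1 - \<alpha>"
  shows "1 / (4 * N\<^sup>2) \<le> lyap K N \<alpha>"
proof (cases "K * (1/2 - \<bar>\<alpha> - 1/2\<bar>) \<le> sqrt N * \<bar>\<alpha> - 1/2\<bar>")
  case True
  have m: "1 / (4 * N) \<le> 1/2 - \<bar>\<alpha> - 1/2\<bar>" using assms by (auto simp: abs_if)
  have N: "0 < 1 / (4 * N)" using assms by simp
  have "sqrt N * \<bar>\<alpha> - 1/2\<bar> \<le> N * 1"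
  proof (intro mult_mono)
    show "sqrt N \<le> N" using assms by (intro real_le_lsqrt) (auto simp: power2_eq_square)
  qed (use assms in \<open>auto simp: abs_if\<close>)
  moreover have "1 * (1 / (4 * N)) \<le> K * (1/2 - \<bar>\<alpha> - 1/2\<bar>)" using assms m N by (intro mult_mono) auto
  moreover have "0 < sqrt N * \<bar>\<alpha> - 1/2\<bar>" using True calculation N by linarith
  ultimately have "(1 / (4 * N)) / N \<le> K * (1/2 - \<bar>\<alpha> - 1/2\<bar>) / (sqrt N * \<bar>\<alpha> - 1/2\<bar>)"
    using N by (intro frac_le) linarith+
  then show ?thesis using lyap_eq_ratio[OF True] by (simp add: power2_eq_square)
next
  case False
  then have "lyap K N \<alpha> = 1" using assms by (intro lyap_eq_1) auto
  moreover have "1 \<le> N\<^sup>2" using assms by (intro one_le_power)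
  then have "1 / (4 * N\<^sup>2) \<le> 1" unfolding divide_le_eq_1 by (intro disjI1 conjI; linarith)
  ultimately show ?thesis by simp
qed

section \<open>Contraction of the Lyapunov function in three regimes, for an abstract next value
  Y\<close>

text \<open>Near consensus \<open>lyap\<close> is almost the linear function 2 K a / \<surd>N, so
  the contraction of the mean carries over. Chebyshev at distance \<epsilon>/8 costs 256 a / (N
  \<epsilon>^2), which is a small part of this linear function once \<surd>N >=
  512/\<epsilon>^3.\<close>

lemma lyap_contract_small:
  fixes M :: "'s pmf" and Y :: "'s \<Rightarrow> real"
  assumes fin: "finite (set_pmf M)" and Y: "\<And>s. s \<in> set_pmf M \<Longrightarrow> Y s \<in> {0..1}"
    and K: "1 \<le> K" and N: "512 / \<epsilon>^3 \<le> sqrt N" "K \<le> sqrt N" and \<epsilon>: "0 < \<epsilon>" "\<epsilon> \<le> 1"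
    and a: "0 \<le> a" "a \<le> \<epsilon> / 8"
    and h: "measure_pmf.expectation M Y \<le> (1 - \<epsilon>) * a"
    and cheb: "\<And>\<tau>. \<tau> > 0 \<Longrightarrow>
      measure_pmf.prob M {s. \<tau> \<le> \<bar>Y s - measure_pmf.expectation M Y\<bar>} \<le> 4 / N * a / \<tau>\<^sup>2"
  shows "measure_pmf.expectation M (\<lambda>s. lyap K N (Y s)) \<le> (1 - \<epsilon> / 4) * lyap K N a"
proof -
  let ?h = "measure_pmf.expectation M Y"
  define R where "R = sqrt N"
  have [simp]: "integrable (measure_pmf M) F" for F :: "'s \<Rightarrow> real"
    by (rule integrable_measure_pmf_finite[OF fin])
  have R: "1 \<le> R" using N K unfolding R_def by linarith
  then have N0: "0 < N" "R\<^sup>2 = N" by (auto simp: R_def)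
  let ?B = "{s. \<epsilon> / 8 \<le> \<bar>Y s - ?h\<bar>}"
  have pt: "lyap K N (Y s) \<le> K / (R * (1/2 - \<epsilon> / 4)) * Y s + indicator ?B s" if s: "s \<in> set_pmf M" for s
  proof (cases "Y s \<le> \<epsilon> / 4")
    case True
    have "lyap K N (Y s) \<le> K * (1/2 - (1/2 - Y s)) / (sqrt N * (1/2 - Y s))"
      using Y[OF s] K N0 True \<epsilon> by (intro lyap_le_ratio) auto
    also have "\<dots> \<le> K * Y s / (R * (1/2 - \<epsilon> / 4))"
      using Y[OF s] K R True \<epsilon> unfolding R_def[symmetric]
      by (intro frac_le mult_nonneg_nonneg mult_pos_pos mult_left_mono) auto
    finally show ?thesis by (simp add: indicator_def)
  next
    case False
    have "(1 - \<epsilon>) * a \<le> 1 * (\<epsilon> / 8)" using a \<epsilon> by (intro mult_mono) auto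
    then have "\<epsilon> / 8 \<le> \<bar>Y s - ?h\<bar>" using False h by linarith
    then have "s \<in> ?B" by simp
    moreover have "lyap K N (Y s) \<le> 1" using Y[OF s] K N0 by (intro lyap_bounds) auto
    moreover have "0 \<le> K / (R * (1/2 - \<epsilon> / 4)) * Y s" using Y[OF s] K R \<epsilon> by (intro mult_nonneg_nonneg divide_nonneg_nonneg) auto
    ultimately show ?thesis by simp
  qed
  have "measure_pmf.expectation M (\<lambda>s. lyap K N (Y s))
      \<le> measure_pmf.expectation M (\<lambda>s. K / (R * (1/2 - \<epsilon> / 4)) * Y s + indicator ?B s)"
    using pt by (intro integral_mono_AE AE_pmfI) auto
  also have "\<dots> = K / (R * (1/2 - \<epsilon> / 4)) * ?h + measure_pmf.prob M ?B" by simp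
  also have "\<dots> \<le> K / (R * (1/2 - \<epsilon> / 4)) * ((1 - \<epsilon>) * a) + 4 / N * a / (\<epsilon> / 8)\<^sup>2"
    using h cheb[of "\<epsilon> / 8"] \<epsilon> K R by (intro add_mono mult_left_mono divide_nonneg_nonneg) auto
  also have "K / (R * (1/2 - \<epsilon> / 4)) * ((1 - \<epsilon>) * a) \<le> (1 - \<epsilon> / 2) * (2 * K / R * a)"
  proof -
    \<comment> \<open>This is 1 - \<epsilon> <= (1 - \<epsilon>/2)^2.\<close>
    have "(1 - \<epsilon>) / (1/2 - \<epsilon> / 4) \<le> 2 * (1 - \<epsilon> / 2)"
    proof (subst pos_divide_le_eq)
      show "1 - \<epsilon> \<le> 2 * (1 - \<epsilon> / 2) * (1/2 - \<epsilon> / 4)" by (simp add: algebra_simps)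
    qed (use \<epsilon> in simp)
    then have "(1 - \<epsilon>) / (1/2 - \<epsilon> / 4) * (K / R * a) \<le> 2 * (1 - \<epsilon> / 2) * (K / R * a)"
      using K R a by (intro mult_right_mono) auto
    then show ?thesis by (simp add: mult_ac)
  qed
  also have "4 / N * a / (\<epsilon> / 8)\<^sup>2 \<le> \<epsilon> / 4 * (2 * K / R * a)"
  proof -
    have "512 \<le> R * \<epsilon>^3" using N \<epsilon> by (simp add: R_def field_simps)
    also have "\<dots> \<le> (R * \<epsilon>^3) * K" using mult_left_mono[of 1 K "R * \<epsilon>^3"] K R \<epsilon> by simp
    finally have "512 * a \<le> R * \<epsilon>^3 * K * a" using a by (intro mult_right_mono) auto
    then show ?thesis using R \<epsilon> unfolding N0(2)[symmetric]
      by (simp add: field_simps power2_eq_square power3_eq_cube)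
  qed
  also have "(1 - \<epsilon> / 2) * (2 * K / R * a) + \<epsilon> / 4 * (2 * K / R * a) = (1 - \<epsilon> / 4) * (2 * K / R * a)"
    by (simp only: distrib_right[symmetric]) simp
  finally have "measure_pmf.expectation M (\<lambda>s. lyap K N (Y s)) \<le> (1 - \<epsilon> / 4) * (2 * K / R * a)"
    by simp
  also have "\<dots> \<le> (1 - \<epsilon> / 4) * lyap K N a"
  proof (intro mult_left_mono)
    have abs: "\<bar>a - 1/2\<bar> = 1/2 - a" using a \<epsilon> by auto
    have "K * a \<le> R * (1/2 - a)" using N a \<epsilon> K unfolding R_def[symmetric] by (intro mult_mono) auto
    then have "lyap K N a = K * a / (R * (1/2 - a))"
      by (subst lyap_eq_ratio) (auto simp: abs R_def)
    also have "\<dots> \<ge> K * a / (R * (1/2))" using K a R \<epsilon> by (intro divide_left_mono mult_left_mono mult_pos_pos) auto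
    finally show "2 * K / R * a \<le> lyap K N a" by (simp add: mult_ac)
  qed (use \<epsilon> in auto)
  finally show ?thesis .
qed

text \<open>If the noise is below \<epsilon> u / 8, the distance u to 1/2 still grows by the factor
  1 + \<epsilon>/8, and the 1/u in \<open>lyap\<close> shrinks accordingly. The probability of
  larger noise is of order 1/(\<surd>N u)^2, to be compared with \<open>lyap\<close> of order K c /
  (\<surd>N u); this is where K must be large in terms of \<epsilon> and c.\<close>

lemma lyap_contract_mid:
  fixes M :: "'s pmf" and Y :: "'s \<Rightarrow> real"
  assumes fin: "finite (set_pmf M)" and Y: "\<And>s. s \<in> set_pmf M \<Longrightarrow> Y s \<in> {0..1}"
    and K: "1 \<le> K" "32768 / (\<epsilon>^3 * c) \<le> K" and N: "K \<le> sqrt N" and \<epsilon>: "0 < \<epsilon>" "\<epsilon> \<le> 1" and c: "0 < c"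
    and a: "a \<in> {0..1}" "c \<le> 1/2 - \<bar>a - 1/2\<bar>"
      "K * (1/2 - \<bar>a - 1/2\<bar>) \<le> sqrt N * \<bar>a - 1/2\<bar>"
    and h: "(1 + \<epsilon> / 4) * \<bar>a - 1/2\<bar> \<le> \<bar>measure_pmf.expectation M Y - 1/2\<bar>"
    and cheb: "\<And>\<tau>. \<tau> > 0 \<Longrightarrow>
      measure_pmf.prob M {s. \<tau> \<le> \<bar>Y s - measure_pmf.expectation M Y\<bar>} \<le> 4 / N / \<tau>\<^sup>2"
  shows "measure_pmf.expectation M (\<lambda>s. lyap K N (Y s)) \<le> (1 - \<epsilon> / 32) * lyap K N a"
proof -
  let ?h = "measure_pmf.expectation M Y"
  define R where "R = sqrt N"
  define u where "u = \<bar>a - 1/2\<bar>"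
  have [simp]: "integrable (measure_pmf M) F" for F :: "'s \<Rightarrow> real"
    by (rule integrable_measure_pmf_finite[OF fin])
  have R: "1 \<le> R" "K \<le> R" using N K unfolding R_def by linarith+
  then have N0: "0 < N" "R\<^sup>2 = N" by (auto simp: R_def)
  have ucap: "K * (1/2 - u) \<le> R * u" and uc: "c \<le> 1/2 - u" using a by (auto simp: u_def R_def)
  \<comment> \<open>Outside the window the rescaled distance to 1/2 is at least K/4: by the window
    condition if u <= 1/4, and by K <= \<surd>N otherwise.\<close>
  have Ru: "K / 4 \<le> R * u"
  proof (cases "u \<le> 1/4")
    case True
    have "K * (1/4) \<le> K * (1/2 - u)" using True K by (intro mult_left_mono) auto
    then show ?thesis using ucap by simp
  next
    case False
    then have "K * (1/4) \<le> R * u" using R K by (intro mult_mono) auto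
    then show ?thesis by simp
  qed
  have u: "0 < u" using Ru K R by (smt (verit) u_def mult_eq_0_iff divide_pos_pos)
  have ly: "lyap K N a = K * (1/2 - u) / (R * u)"
    using a by (subst lyap_eq_ratio) (auto simp: u_def R_def)
  let ?B = "{s. \<epsilon> * u / 8 \<le> \<bar>Y s - ?h\<bar>}"
  have pt: "lyap K N (Y s) \<le> (1 - \<epsilon> / 16) * lyap K N a + indicator ?B s" if s: "s \<in> set_pmf M" for s
  proof (cases "s \<in> ?B")
    case True
    have "lyap K N (Y s) \<le> 1" using Y[OF s] K N0 by (intro lyap_bounds) auto
    moreover have "0 \<le> (1 - \<epsilon> / 16) * lyap K N a" using a K N0 \<epsilon> by (intro mult_nonneg_nonneg lyap_bounds) auto
    ultimately show ?thesis using True by simp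
  next
    case False
    have eq: "(1 + \<epsilon> / 4) * u = u + \<epsilon> * u / 4" "(1 + \<epsilon> / 8) * u = u + \<epsilon> * u / 8" by (simp_all add: algebra_simps)
    have "u + t / 8 \<le> \<bar>y - 1/2\<bar>" if "\<not> t / 8 \<le> \<bar>y - x\<bar>" "u + t / 4 \<le> \<bar>x - 1/2\<bar>" for t x y :: real
      using that by linarith
    then have far: "(1 + \<epsilon> / 8) * u \<le> \<bar>Y s - 1/2\<bar>"
      using False h unfolding u_def[symmetric] mem_Collect_eq eq by blast
    then have "lyap K N (Y s) \<le> K * (1/2 - (1 + \<epsilon> / 8) * u) / (sqrt N * ((1 + \<epsilon> / 8) * u))"
      using Y[OF s] K N0 u \<epsilon> by (intro lyap_le_ratio) auto
    also have "\<dots> \<le> K * (1/2 - u) / (R * ((1 + \<epsilon> / 8) * u))"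
      unfolding R_def[symmetric] using K u R \<epsilon> by (intro divide_right_mono mult_left_mono) auto
    also have "\<dots> = lyap K N a * (1 / (1 + \<epsilon> / 8))" using \<epsilon> by (simp add: ly)
    also have "\<dots> \<le> lyap K N a * (1 - \<epsilon> / 16)"
    proof (intro mult_left_mono lyap_bounds)
      have "\<epsilon> * \<epsilon> \<le> 1 * \<epsilon>" using \<epsilon> by (intro mult_right_mono) auto
      then show "1 / (1 + \<epsilon> / 8) \<le> 1 - \<epsilon> / 16" using \<epsilon> by (simp add: field_simps)
    qed (use a K N0 in auto)
    finally show ?thesis using False by (simp add: mult.commute)
  qed
  have "measure_pmf.expectation M (\<lambda>s. lyap K N (Y s))
      \<le> measure_pmf.expectation M (\<lambda>s. (1 - \<epsilon> / 16) * lyap K N a + indicator ?B s)"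
    using pt by (intro integral_mono_AE AE_pmfI) auto
  also have "\<dots> = (1 - \<epsilon> / 16) * lyap K N a + measure_pmf.prob M ?B" by simp
  also have "measure_pmf.prob M ?B \<le> 4 / N / (\<epsilon> * u / 8)\<^sup>2" using \<epsilon> u by (intro cheb) auto
  also have "\<dots> = 256 / (\<epsilon>\<^sup>2 * (R * u)) / (R * u)"
    using N0 by (simp add: power2_eq_square field_simps flip: N0(2))
  also have "\<dots> \<le> (\<epsilon> / 32 * (K * (1/2 - u))) / (R * u)"
  proof (intro divide_right_mono)
    have "256 / (\<epsilon>\<^sup>2 * (R * u)) \<le> 256 / (\<epsilon>\<^sup>2 * (K / 4))"
      using \<epsilon> Ru K R u by (intro divide_left_mono mult_left_mono mult_pos_pos) auto
    also have "\<dots> \<le> \<epsilon> / 32 * (K * c)"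
    proof -
      have "32768 \<le> K * (\<epsilon>^3 * c)" using K \<epsilon> c by (simp add: field_simps)
      also have "\<dots> \<le> K * (K * (\<epsilon>^3 * c))"
        using mult_right_mono[of 1 K "K * (\<epsilon>^3 * c)"] K \<epsilon> c by simp
      finally show ?thesis using K \<epsilon> c by (simp add: field_simps power2_eq_square power3_eq_cube)
    qed
    also have "\<dots> \<le> \<epsilon> / 32 * (K * (1/2 - u))" using \<epsilon> K uc by (intro mult_left_mono) auto
    finally show "256 / (\<epsilon>\<^sup>2 * (R * u)) \<le> \<epsilon> / 32 * (K * (1/2 - u))" .
  qed (use u R in auto)
  also have "\<dots> = \<epsilon> / 32 * lyap K N a" by (simp add: ly)
  finally show ?thesis by (simp add: algebra_simps)
qed

text \<open>In the window \<open>lyap\<close> sits at its cap 1 and cannot increase. Beyond twice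
  the width it is at most (K/2)/(2K) = 1/4, so each escape gains 3/4.\<close>

lemma lyap_contract_centre:
  fixes M :: "'s pmf" and Y :: "'s \<Rightarrow> real"
  assumes fin: "finite (set_pmf M)" and Y: "\<And>s. s \<in> set_pmf M \<Longrightarrow> Y s \<in> {0..1}"
    and K: "1 \<le> K" and N: "0 < N" and a: "a \<in> {0..1}" "sqrt N * \<bar>a - 1/2\<bar> \<le> K * (1/2 - \<bar>a - 1/2\<bar>)"
    and P: "q \<le> measure_pmf.prob M {s. 2 * K < sqrt N * \<bar>Y s - 1/2\<bar>}"
  shows "measure_pmf.expectation M (\<lambda>s. lyap K N (Y s)) \<le> (1 - 3/4 * q) * lyap K N a"
proof -
  let ?B = "{s. 2 * K < sqrt N * \<bar>Y s - 1/2\<bar>}"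
  have [simp]: "integrable (measure_pmf M) F" for F :: "'s \<Rightarrow> real"
    by (rule integrable_measure_pmf_finite[OF fin])
  have pt: "lyap K N (Y s) \<le> 1 - 3/4 * indicator ?B s" if s: "s \<in> set_pmf M" for s
  proof (cases "s \<in> ?B")
    case True
    define u where "u = \<bar>Y s - 1/2\<bar>"
    have u: "2 * K < sqrt N * u" using True by (simp add: u_def)
    then have u0: "0 < u" using K N by (smt (verit) u_def mult_eq_0_iff)
    have "lyap K N (Y s) \<le> K * (1/2 - u) / (sqrt N * u)"
      using Y[OF s] K N u0 by (intro lyap_le_ratio) (auto simp: u_def)
    also have "\<dots> \<le> K * (1/2) / (2 * K)"
      using u u0 K by (intro frac_le mult_left_mono) auto
    also have "\<dots> = 1/4" using K by simp
    finally show ?thesis using True by simp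
  next
    case False
    then show ?thesis using lyap_bounds[of K N "Y s"] Y[OF s] K N by auto
  qed
  have "measure_pmf.expectation M (\<lambda>s. lyap K N (Y s))
      \<le> measure_pmf.expectation M (\<lambda>s. 1 - 3/4 * indicator ?B s)"
    using pt by (intro integral_mono_AE AE_pmfI) auto
  also have "\<dots> = 1 - 3/4 * measure_pmf.prob M ?B" by simp
  also have "\<dots> \<le> 1 - 3/4 * q" using P by simp
  finally show ?thesis using lyap_eq_1[of K N a] K N a by simp
qed

lemma cosh_square_le_cosh_double: "(cosh x)\<^sup>2 \<le> cosh (2 * x :: real)"
  using zero_le_power2[of "sinh x"] by (simp add: cosh_double)

section \<open>The three regimes for one round of voting\<close>

context voting
begin

abbreviation step :: "'a set \<Rightarrow> ('a \<Rightarrow> bool) pmf" where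
  "step A \<equiv> pi_bernoulli V (rate A)"

definition mass :: "('a \<Rightarrow> bool) \<Rightarrow> real" where
  "mass s = (\<Sum>v\<in>V. \<pi> v * of_bool (s v))"

lemma mass_conv_sum: "mass s = sum \<pi> {v \<in> V. s v}"
  using finite_V by (simp add: mass_def Int_def)

lemma mass_range: "mass s \<in> {0..1}"
  using mass_bounds[of "{v \<in> V. s v}"] by (simp add: mass_conv_sum)

lemma expectation_mass: "A \<subseteq> V \<Longrightarrow> measure_pmf.expectation (step A) mass = drift A"
  unfolding mass_def drift_def using finite_V rate_bounds by (intro expectation_sum_pi_bernoulli) auto

lemma mass_Chebyshev:
  assumes A: "A \<subseteq> V" and \<tau>: "\<tau> > 0"
    and var: "(\<Sum>v\<in>V. (\<pi> v)\<^sup>2 * (rate A v * (1 - rate A v))) \<le> b"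
  shows "measure_pmf.prob (step A) {s. \<tau> \<le> \<bar>mass s - drift A\<bar>} \<le> b / \<tau>\<^sup>2"
proof -
  have "measure_pmf.prob (step A) {s. \<tau> \<le> \<bar>mass s - drift A\<bar>}
      \<le> (\<Sum>v\<in>V. (\<pi> v)\<^sup>2 * (rate A v * (1 - rate A v))) / \<tau>\<^sup>2"
    unfolding mass_def drift_def using finite_V rate_bounds[OF A] \<tau>
    by (intro pi_bernoulli_Chebyshev) auto
  also have "\<dots> \<le> b / \<tau>\<^sup>2" using var by (intro divide_right_mono) auto
  finally show ?thesis .
qed

text \<open>As \<open>\<pi> v\<close> is at most 4/N, the condition on t keeps the weights t
  \<surd>N \<pi> v within 1. The rescaled mass then has Gaussian exponential moments from both
  sides.\<close>

lemma expectation_exp_mass: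
  assumes A: "A \<subseteq> V" and t: "4 * \<bar>t\<bar> \<le> sqrt N"
  shows "exp (t * (sqrt N * (drift A - 1/2))) * exp (t\<^sup>2 * N * (\<Sum>v\<in>V. (\<pi> v)\<^sup>2 * (rate A v * (1 - rate A v))) / 6)
      \<le> measure_pmf.expectation (step A) (\<lambda>s. exp (t * (sqrt N * (mass s - 1/2))))"
    and "measure_pmf.expectation (step A) (\<lambda>s. exp (t * (sqrt N * (mass s - 1/2))))
      \<le> exp (t * (sqrt N * (drift A - 1/2))) * exp (4 * t\<^sup>2)"
proof -
  define w where "w v = t * sqrt N * \<pi> v" for v
  let ?m = "t * (sqrt N * (drift A - 1/2))"
  have w: "\<bar>w v\<bar> \<le> 1" if "v \<in> V" for v
  proof -
    have "\<bar>w v\<bar> = \<bar>t\<bar> * sqrt N * \<pi> v" using pi_pos[OF that] N_pos by (simp add: w_def abs_mult)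
    also have "\<dots> \<le> (sqrt N / 4) * sqrt N * (4 / N)"
      using t pi_upper[OF that] pi_nonneg[OF that] N_pos by (intro mult_mono mult_nonneg_nonneg) auto
    also have "\<dots> = 1" using N_pos by simp
    finally show ?thesis .
  qed
  have w2: "(w v)\<^sup>2 = t\<^sup>2 * N * (\<pi> v)\<^sup>2" for v using N_pos by (simp add: w_def power_mult_distrib)
  have "t * (sqrt N * (mass s - 1/2)) = ?m + (\<Sum>v\<in>V. w v * (of_bool (s v) - rate A v))" for s
  proof -
    have "(\<Sum>v\<in>V. w v * (of_bool (s v) - rate A v)) = (\<Sum>v\<in>V. t * sqrt N * (\<pi> v * of_bool (s v) - \<pi> v * rate A v))"
      by (intro sum.cong) (simp_all add: w_def algebra_simps)
    also have "\<dots> = t * sqrt N * (mass s - drift A)"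
      unfolding mass_def drift_def sum_subtractf[symmetric] by (rule sum_distrib_left[symmetric])
    finally show ?thesis by (simp add: algebra_simps)
  qed
  then have E: "measure_pmf.expectation (step A) (\<lambda>s. exp (t * (sqrt N * (mass s - 1/2))))
      = exp ?m * measure_pmf.expectation (step A) (\<lambda>s. exp (\<Sum>v\<in>V. w v * (of_bool (s v) - rate A v)))"
    by (simp add: exp_add)
  have "exp ((\<Sum>v\<in>V. (w v)\<^sup>2 * (rate A v * (1 - rate A v))) / 6)
      \<le> measure_pmf.expectation (step A) (\<lambda>s. exp (\<Sum>v\<in>V. w v * (of_bool (s v) - rate A v)))"
    using finite_V rate_bounds[OF A] w by (intro pi_bernoulli_mgf_ge) auto
  then show "exp ?m * exp (t\<^sup>2 * N * (\<Sum>v\<in>V. (\<pi> v)\<^sup>2 * (rate A v * (1 - rate A v))) / 6)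
      \<le> measure_pmf.expectation (step A) (\<lambda>s. exp (t * (sqrt N * (mass s - 1/2))))"
    unfolding E by (intro mult_left_mono) (simp_all add: w2 sum_distrib_left mult_ac)
  have "measure_pmf.expectation (step A) (\<lambda>s. exp (\<Sum>v\<in>V. w v * (of_bool (s v) - rate A v)))
      \<le> exp (\<Sum>v\<in>V. rate A v * (w v)\<^sup>2)"
    using finite_V rate_bounds[OF A] w by (intro pi_bernoulli_mgf_le) auto
  also have "(\<Sum>v\<in>V. rate A v * (w v)\<^sup>2) \<le> (\<Sum>v\<in>V. 4 * t\<^sup>2 * \<pi> v)"
  proof (intro sum_mono)
    fix v assume v: "v \<in> V"
    have "rate A v * (w v)\<^sup>2 \<le> 1 * (w v)\<^sup>2" using rate_bounds[OF A v] by (intro mult_right_mono) auto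
    also have "\<dots> = t\<^sup>2 * N * (\<pi> v * \<pi> v)" by (simp add: w2 power2_eq_square[of "\<pi> v"])
    also have "\<dots> \<le> t\<^sup>2 * N * (\<pi> v * (4 / N))"
      using pi_upper[OF v] pi_nonneg[OF v] N_pos by (intro mult_left_mono) auto
    also have "\<dots> = 4 * t\<^sup>2 * \<pi> v" using N_pos by simp
    finally show "rate A v * (w v)\<^sup>2 \<le> 4 * t\<^sup>2 * \<pi> v" .
  qed
  also have "\<dots> = 4 * t\<^sup>2" using pi_sum by (simp flip: sum_distrib_left)
  finally show "measure_pmf.expectation (step A) (\<lambda>s. exp (t * (sqrt N * (mass s - 1/2))))
      \<le> exp ?m * exp (4 * t\<^sup>2)"
    unfolding E by (intro mult_left_mono) auto
qed

text \<open>A drift towards 1/2 of order \<open>1 / sqrt N\<close> cannot confine the process: the hyperbolic cosine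
  of the rescaled deviation grows in expectation by a factor exponential in \<open>\<theta>\<^sup>2\<close>, while
  the drift costs nothing because \<open>cosh \<ge> 1\<close>.\<close>

lemma escape_centre:
  assumes A: "A \<subseteq> V" and K: "1 \<le> K" and \<theta>: "1 \<le> \<theta>" "8 * \<theta> \<le> sqrt N" "2 * K + 1 \<le> \<theta> * \<kappa> / 48"
    and noise: "\<kappa> / 8 \<le> N * (\<Sum>v\<in>V. (\<pi> v)\<^sup>2 * (rate A v * (1 - rate A v)))"
    and m: "sqrt N * \<bar>drift A - 1/2\<bar> \<le> m"
  shows "exp (- (2 * \<theta> * m + 16 * \<theta>\<^sup>2))
      \<le> measure_pmf.prob (step A) {s. 2 * K < sqrt N * \<bar>mass s - 1/2\<bar>}"
proof -
  let ?E = "measure_pmf.expectation (step A)"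
  let ?T = "\<lambda>s. sqrt N * (mass s - 1/2)" and ?d = "sqrt N * (drift A - 1/2)"
  have [simp]: "integrable (measure_pmf (step A)) F" for F :: "_ \<Rightarrow> real" using finite_V by simp
  have cosh_E: "?E (\<lambda>s. cosh (t * ?T s)) = (?E (\<lambda>s. exp (t * ?T s)) + ?E (\<lambda>s. exp (- t * ?T s))) / 2" for t
    by (simp add: cosh_field_def)
  have t1: "4 * \<bar>\<theta>\<bar> \<le> sqrt N" "4 * \<bar>- \<theta>\<bar> \<le> sqrt N" "4 * \<bar>2 * \<theta>\<bar> \<le> sqrt N" "4 * \<bar>- (2 * \<theta>)\<bar> \<le> sqrt N"
    using \<theta> by auto
  \<comment> \<open>The threshold grows like exp(2 K \<theta>) while the noise contributes
    exp(\<theta>^2 \<kappa>/48). The choice of \<theta> makes the latter exponent at least \<theta>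
    (2K + 1) >= 2 K \<theta> + 1, which also covers the gap 1 of Paley-Zygmund.\<close>
  have "cosh (2 * K * \<theta>) + 1 \<le> exp (2 * K * \<theta>) + exp (2 * K * \<theta>)"
  proof -
    have "0 \<le> 2 * K * \<theta>" using K \<theta> by simp
    then have "exp (- (2 * K * \<theta>)) \<le> exp (2 * K * \<theta>)" "1 \<le> exp (2 * K * \<theta>)" by simp_all
    moreover have "(x + y) / 2 + 1 \<le> x + x" if "y \<le> x" "1 \<le> x" for x y :: real using that by (simp add: field_simps)
    ultimately show ?thesis unfolding cosh_field_def by blast
  qed
  also have "\<dots> \<le> exp 1 * exp (2 * K * \<theta>)"
    using exp_ge_add_one_self[of 1] mult_right_mono[of 2 "exp 1" "exp (2 * K * \<theta>)"] by simp
  also have "\<dots> \<le> exp (\<theta>\<^sup>2 * (\<kappa> / 8) / 6)"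
  proof -
    have "1 + 2 * K * \<theta> \<le> \<theta> * (2 * K + 1)" using \<theta> by (simp add: algebra_simps)
    also have "\<dots> \<le> \<theta> * (\<theta> * \<kappa> / 48)" using \<theta> by (intro mult_left_mono) auto
    finally show ?thesis by (simp add: power2_eq_square flip: exp_add)
  qed
  also have "\<dots> \<le> exp (\<theta>\<^sup>2 * N * (\<Sum>v\<in>V. (\<pi> v)\<^sup>2 * (rate A v * (1 - rate A v))) / 6)" (is "_ \<le> ?g")
    using noise \<theta> by (simp add: mult.assoc)
  also have "?g \<le> cosh (\<theta> * ?d) * ?g" using cosh_real_ge_1[of "\<theta> * ?d"] by simp
  also have "\<dots> = (exp (\<theta> * ?d) * ?g + exp (- \<theta> * ?d) * ?g) / 2"
    by (simp add: cosh_field_def algebra_simps)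
  also have "\<dots> \<le> ?E (\<lambda>s. cosh (\<theta> * ?T s))"
    unfolding cosh_E using expectation_exp_mass(1)[OF A t1(1)] expectation_exp_mass(1)[OF A t1(2)]
    by (intro divide_right_mono add_mono) (simp_all add: power2_eq_square)
  finally have lower: "cosh (2 * K * \<theta>) + 1 \<le> ?E (\<lambda>s. cosh (\<theta> * ?T s))" .
  \<comment> \<open>The second moment is read off the exponential moment at 2\<theta>; hence the
    condition 8 \<theta> <= \<surd>N.\<close>
  have "?E (\<lambda>s. (cosh (\<theta> * ?T s))\<^sup>2) \<le> ?E (\<lambda>s. cosh ((2 * \<theta>) * ?T s))"
    using cosh_square_le_cosh_double by (intro integral_mono) (simp_all add: mult.assoc)
  also have "\<dots> \<le> (exp ((2 * \<theta>) * ?d) * exp (4 * (2 * \<theta>)\<^sup>2) + exp (- (2 * \<theta>) * ?d) * exp (4 * (- (2 * \<theta>))\<^sup>2)) / 2"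
    unfolding cosh_E using expectation_exp_mass(2)[OF A t1(3)] expectation_exp_mass(2)[OF A t1(4)]
    by (intro divide_right_mono add_mono) auto
  also have "\<dots> \<le> (exp (2 * \<theta> * m) * exp (16 * \<theta>\<^sup>2) + exp (2 * \<theta> * m) * exp (16 * \<theta>\<^sup>2)) / 2"
  proof -
    have "\<bar>?d\<bar> \<le> m" using m N_pos by (simp add: abs_mult)
    then have "?d \<le> m" "- ?d \<le> m" by auto
    moreover have "0 \<le> 2 * \<theta>" using \<theta> by simp
    ultimately have "(2 * \<theta>) * ?d \<le> 2 * \<theta> * m" "(2 * \<theta>) * (- ?d) \<le> 2 * \<theta> * m"
      by (simp_all only: mult_left_mono)
    then have "(2 * \<theta>) * ?d \<le> 2 * \<theta> * m" "- (2 * \<theta>) * ?d \<le> 2 * \<theta> * m"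
      by (simp_all only: mult_minus_left mult_minus_right)
    then show ?thesis by (intro divide_right_mono add_mono mult_mono) (auto simp: power2_eq_square)
  qed
  finally have upper: "?E (\<lambda>s. (cosh (\<theta> * ?T s))\<^sup>2) \<le> exp (2 * \<theta> * m + 16 * \<theta>\<^sup>2)"
    by (simp add: exp_add)
  have "1 / exp (2 * \<theta> * m + 16 * \<theta>\<^sup>2) \<le> measure_pmf.prob (step A) {s. cosh (2 * K * \<theta>) < cosh (\<theta> * ?T s)}"
    using lower upper finite_V by (intro pmf_Paley_Zygmund finite_set_pi_bernoulli) auto
  also have "{s. cosh (2 * K * \<theta>) < cosh (\<theta> * ?T s)} = {s. 2 * K < sqrt N * \<bar>mass s - 1/2\<bar>}"
  proof (intro Collect_cong)
    fix s
    have "cosh (2 * K * \<theta>) < cosh (\<theta> * ?T s) \<longleftrightarrow> cosh (2 * K * \<theta>) < cosh \<bar>\<theta> * ?T s\<bar>" by (simp add: cosh_real_abs)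
    also have "\<dots> \<longleftrightarrow> 2 * K * \<theta> < \<bar>\<theta> * ?T s\<bar>" using K \<theta> by (intro cosh_real_nonneg_less_iff) auto
    also have "\<bar>\<theta> * ?T s\<bar> = sqrt N * \<bar>mass s - 1/2\<bar> * \<theta>" using \<theta> N_pos by (simp add: abs_mult)
    also have "2 * K * \<theta> < sqrt N * \<bar>mass s - 1/2\<bar> * \<theta> \<longleftrightarrow> 2 * K < sqrt N * \<bar>mass s - 1/2\<bar>"
      using \<theta> by simp
    finally show "cosh (2 * K * \<theta>) < cosh (\<theta> * ?T s) \<longleftrightarrow> 2 * K < sqrt N * \<bar>mass s - 1/2\<bar>" .
  qed
  finally show ?thesis by (simp only: exp_minus inverse_eq_divide)
qed

text \<open>In the window the distance to 1/2 and the dispersion error are both O(1/\<surd>N), so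
  the rescaled drift is bounded by a constant, while N times the variance is bounded below. The
  escape probability is therefore free of N.\<close>

lemma contract_centre:
  assumes A: "A \<subseteq> V" and K: "1 \<le> K" and \<theta>: "1 \<le> \<theta>" "8 * \<theta> \<le> sqrt N"
    "2 * K + 1 \<le> \<theta> * (g (1/2) * (1 - g (1/2))) / 48"
    and Q: "disp A \<le> C / sqrt N" "disp A \<le> 1"
    and small: "L * (K / sqrt N + sqrt (disp A)) \<le> g (1/2) * (1 - g (1/2)) / 2"
    and cap: "sqrt N * \<bar>sum \<pi> A - 1/2\<bar> \<le> K * (1/2 - \<bar>sum \<pi> A - 1/2\<bar>)"
  shows "measure_pmf.expectation (step A) (\<lambda>s. lyap K N (mass s))
      \<le> (1 - 3/4 * exp (- (2 * \<theta> * ((2 + L + 2 * M) * K + M * C) + 16 * \<theta>\<^sup>2))) * lyap K N (sum \<pi> A)"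
proof -
  let ?u = "\<bar>sum \<pi> A - 1/2\<bar>" and ?R = "sqrt N" and ?k = "g (1/2) * (1 - g (1/2))"
  have R: "0 < ?R" using N_pos by simp
  have Ru: "?R * ?u \<le> K"
  proof -
    have "K * (1/2 - ?u) \<le> K * 1" using K by (intro mult_left_mono) auto
    then show ?thesis using cap by simp
  qed
  then have u: "?u \<le> K / ?R" using R by (simp add: field_simps)
  have "?k - L * (?u + sqrt (disp A)) \<ge> ?k - L * (K / ?R + sqrt (disp A))"
    using u L_nonneg by (intro diff_left_mono mult_left_mono) auto
  then have "?k / 2 \<le> ?k - L * (?u + sqrt (disp A))" using small by linarith
  then have "N * (1 / (4 * N) * (?k / 2)) \<le> N * (1 / (4 * N) * (?k - L * (?u + sqrt (disp A))))"
    using N_pos by (intro mult_left_mono) auto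
  also have "\<dots> \<le> N * (\<Sum>v\<in>V. (\<pi> v)\<^sup>2 * (rate A v * (1 - rate A v)))"
    using variance_ge[OF A] N_pos by (intro mult_left_mono) auto
  finally have noise: "?k / 8 \<le> N * (\<Sum>v\<in>V. (\<pi> v)\<^sup>2 * (rate A v * (1 - rate A v)))"
    using N_pos by simp
  have "\<bar>drift A - 1/2\<bar> \<le> \<bar>drift A - updating g (sum \<pi> A)\<bar> + \<bar>updating g (sum \<pi> A) - 1/2\<bar>" by linarith
  also have "\<dots> \<le> (M * \<bar>1 - 2 * sum \<pi> A\<bar> * sqrt (disp A) + M * disp A) + (2 + L) * ?u"
    using mass_bounds[OF A] by (intro add_mono drift_approx[OF A] updating_lipschitz_half) auto
  also have "\<bar>1 - 2 * sum \<pi> A\<bar> = 2 * ?u" by (simp add: abs_if)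
  also have "M * (2 * ?u) * sqrt (disp A) \<le> M * (2 * ?u) * 1"
    using Q M_nonneg by (intro mult_left_mono) auto
  finally have "\<bar>drift A - 1/2\<bar> \<le> (2 + L + 2 * M) * ?u + M * (C / ?R)"
    using mult_left_mono[OF Q(1) M_nonneg] by (simp add: algebra_simps)
  then have "?R * \<bar>drift A - 1/2\<bar> \<le> ?R * ((2 + L + 2 * M) * ?u + M * (C / ?R))"
    using R by (intro mult_left_mono) auto
  also have "\<dots> = (2 + L + 2 * M) * (?R * ?u) + M * C" using R by (simp add: algebra_simps)
  also have "\<dots> \<le> (2 + L + 2 * M) * K + M * C"
    using Ru L_nonneg M_nonneg by (intro add_right_mono mult_left_mono) auto
  finally have m: "?R * \<bar>drift A - 1/2\<bar> \<le> (2 + L + 2 * M) * K + M * C" .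
  show ?thesis
    using escape_centre[OF A K \<theta> noise m] mass_bounds[OF A] finite_V K N_pos mass_range cap
    by (intro lyap_contract_centre finite_set_pi_bernoulli) auto
qed

text \<open>The repulsion \<epsilon> u pays for both drift errors. The first-order one carries a
  factor 2u and costs \<epsilon> u / 4; the second-order one is at most M C / \<surd>N, below
  \<epsilon> u / 2 because u >= K / (4 \<surd>N) and K >= 8 M C / \<epsilon>. A surplus \<epsilon> u
  / 4 remains.\<close>

lemma contract_mid:
  assumes A: "A \<subseteq> V" and \<epsilon>: "0 < \<epsilon>" "\<epsilon> \<le> 1" and c: "0 < c" "c \<le> 1/2 - \<bar>sum \<pi> A - 1/2\<bar>"
    and K: "1 \<le> K" "32768 / (\<epsilon>^3 * c) \<le> K" "8 * M * C / \<epsilon> \<le> K" "K \<le> sqrt N"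
    and Q: "disp A \<le> C / sqrt N" "2 * M * sqrt (disp A) \<le> \<epsilon> / 4"
    and H: "(1 + \<epsilon>) * \<bar>sum \<pi> A - 1/2\<bar> \<le> \<bar>updating g (sum \<pi> A) - 1/2\<bar>"
    and cap: "K * (1/2 - \<bar>sum \<pi> A - 1/2\<bar>) \<le> sqrt N * \<bar>sum \<pi> A - 1/2\<bar>"
  shows "measure_pmf.expectation (step A) (\<lambda>s. lyap K N (mass s)) \<le> (1 - \<epsilon> / 32) * lyap K N (sum \<pi> A)"
proof -
  let ?u = "\<bar>sum \<pi> A - 1/2\<bar>" and ?R = "sqrt N"
  have R: "1 \<le> ?R" using K by linarith
  have Ru: "K / 4 \<le> ?R * ?u"
  proof (cases "?u \<le> 1/4")
    case True
    have "K * (1/4) \<le> K * (1/2 - ?u)" using True K by (intro mult_left_mono) auto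
    then show ?thesis using cap by linarith
  next
    case False
    then have "K * (1/4) \<le> ?R * ?u" using R K by (intro mult_mono) auto
    then show ?thesis by simp
  qed
  have "M * disp A \<le> M * (C / ?R)" using Q M_nonneg by (intro mult_left_mono) auto
  also have "\<dots> \<le> (\<epsilon> / 2 * (K / 4)) / ?R" using K \<epsilon> R by (simp add: field_simps)
  also have "\<dots> \<le> (\<epsilon> / 2 * (?R * ?u)) / ?R" using Ru \<epsilon> R by (intro divide_right_mono mult_left_mono) auto
  also have "\<dots> = \<epsilon> / 2 * ?u" using R by auto
  finally have 1: "M * disp A \<le> \<epsilon> / 2 * ?u" .
  have "\<bar>1 - 2 * sum \<pi> A\<bar> = 2 * ?u" by (simp add: abs_if)
  then have "M * \<bar>1 - 2 * sum \<pi> A\<bar> * sqrt (disp A) = ?u * (2 * M * sqrt (disp A))" by simp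
  also have "\<dots> \<le> ?u * (\<epsilon> / 4)" using Q by (intro mult_left_mono) auto
  finally have "\<bar>drift A - updating g (sum \<pi> A)\<bar> \<le> ?u * (\<epsilon> / 4) + \<epsilon> / 2 * ?u"
    using drift_approx[OF A] 1 by linarith
  moreover have "u + t / 4 \<le> \<bar>x - 1/2\<bar>" if "\<bar>x - y\<bar> \<le> t / 4 + t / 2" "u + t \<le> \<bar>y - 1/2\<bar>" for t u x y :: real
    using that by linarith
  ultimately have h: "(1 + \<epsilon> / 4) * ?u \<le> \<bar>drift A - 1/2\<bar>" using H by (simp add: algebra_simps)
  have var: "(\<Sum>v\<in>V. (\<pi> v)\<^sup>2 * (rate A v * (1 - rate A v))) \<le> 4 / N"
  proof -
    have "4 / N * drift A \<le> 4 / N * 1" using drift_bounds[OF A] N_pos by (intro mult_left_mono) auto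
    then show ?thesis using variance_le(1)[OF A] by linarith
  qed
  show ?thesis
    using h mass_Chebyshev[OF A _ var] mass_bounds[OF A] finite_V K c \<epsilon> mass_range cap
    by (intro lyap_contract_mid[where c = c] finite_set_pi_bernoulli) (auto simp: expectation_mass[OF A])
qed

text \<open>The mirrored statement is not deduced from the first but obtained by applying
  \<open>lyap_contract_small\<close> to the complementary mass 1 - \<open>mass\<close>;
  \<open>lyap\<close> is symmetric, and the variances for A and V - A agree.\<close>

lemma contract_small:
  assumes A: "A \<subseteq> V" and \<epsilon>: "0 < \<epsilon>" "\<epsilon> \<le> 1" and K: "1 \<le> K" "K \<le> sqrt N" "512 / \<epsilon>^3 \<le> sqrt N"
    and a: "sum \<pi> A \<le> \<epsilon> / 8" and h: "drift A \<le> (1 - \<epsilon>) * sum \<pi> A"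
  shows "measure_pmf.expectation (step A) (\<lambda>s. lyap K N (mass s)) \<le> (1 - \<epsilon> / 4) * lyap K N (sum \<pi> A)"
    and "measure_pmf.expectation (step (V - A)) (\<lambda>s. lyap K N (mass s)) \<le> (1 - \<epsilon> / 4) * lyap K N (sum \<pi> (V - A))"
proof -
  have a0: "0 \<le> sum \<pi> A" using mass_bounds[OF A] by auto
  have "(1 - \<epsilon>) * sum \<pi> A \<le> 1 * sum \<pi> A" using \<epsilon> a0 by (intro mult_right_mono) auto
  then have "4 / N * drift A \<le> 4 / N * sum \<pi> A" using h N_pos by (intro mult_left_mono) auto
  then have var: "(\<Sum>v\<in>V. (\<pi> v)\<^sup>2 * (rate A v * (1 - rate A v))) \<le> 4 / N * sum \<pi> A"
    using variance_le(1)[OF A] by linarith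
  show "measure_pmf.expectation (step A) (\<lambda>s. lyap K N (mass s)) \<le> (1 - \<epsilon> / 4) * lyap K N (sum \<pi> A)"
    using h mass_Chebyshev[OF A _ var] a0 a finite_V K \<epsilon> mass_range
    by (intro lyap_contract_small finite_set_pi_bernoulli) (auto simp: expectation_mass[OF A])
  let ?B = "V - A"
  have B: "?B \<subseteq> V" by auto
  have varB: "(\<Sum>v\<in>V. (\<pi> v)\<^sup>2 * (rate ?B v * (1 - rate ?B v))) \<le> 4 / N * sum \<pi> A"
    using var A by (simp add: rate_compl mult.commute[of "1 - _"] cong: sum.cong)
  have EB: "measure_pmf.expectation (step ?B) (\<lambda>s. 1 - mass s) = drift A"
    using finite_V expectation_mass[OF B] A by (simp add: drift_compl)
  have "\<bar>1 - mass s - drift A\<bar> = \<bar>mass s - drift ?B\<bar>" for s using drift_compl[OF A] by linarith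
  then have cheb: "measure_pmf.prob (step ?B) {s. \<tau> \<le> \<bar>1 - mass s - drift A\<bar>} \<le> 4 / N * sum \<pi> A / \<tau>\<^sup>2" if "\<tau> > 0" for \<tau>
    using mass_Chebyshev[OF B that varB] by simp
  have "measure_pmf.expectation (step ?B) (\<lambda>s. lyap K N (1 - mass s)) \<le> (1 - \<epsilon> / 4) * lyap K N (sum \<pi> A)"
    using h cheb a0 a finite_V K \<epsilon> mass_range
    by (intro lyap_contract_small finite_set_pi_bernoulli) (auto simp: EB)
  then show "measure_pmf.expectation (step ?B) (\<lambda>s. lyap K N (mass s)) \<le> (1 - \<epsilon> / 4) * lyap K N (sum \<pi> ?B)"
    using A by (simp add: lyap_compl mass_compl)
qed

end

text \<open>Constants are fixed in the order \<kappa>, c, \<epsilon>, K, \<theta>, \<delta>, and N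
  last. The quantifiers over V, \<pi> and X stand inside the eventuality, so the threshold for N is
  uniform over all graphs.\<close>

lemma (in voting_rule) lyap_contraction:
  fixes C\<^sub>1 C\<^sub>2 :: real
  assumes half: "0 < g (1/2)" "g (1/2) < 1"
    and end_point: "g' 0 < g 1"
    and repelling: "\<And>c. 0 < c \<Longrightarrow> \<exists>\<epsilon>>0. \<forall>x\<in>{c..1-c}. (1 + \<epsilon>) * \<bar>x - 1/2\<bar> \<le> \<bar>updating g x - 1/2\<bar>"
    and C: "0 \<le> C\<^sub>1" "0 \<le> C\<^sub>2"
  obtains \<delta> K \<eta> where "0 < \<delta>" "\<delta> < 1" "1 \<le> K" "0 < \<eta>"
    and "\<forall>\<^sub>F N in at_top. \<forall>(V :: 'a set) \<pi> X. voting_walk V \<pi> X N \<longrightarrow>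
      (\<forall>A\<subseteq>V. voting_walk.disp V \<pi> X A \<le> C\<^sub>1 / sqrt N \<and>
        (\<Sum>v\<in>V. \<pi> v * (X A v)\<^sup>2) \<le> (C\<^sub>2 * sum \<pi> A + \<eta>) * sum \<pi> A) \<longrightarrow>
      (\<forall>A\<subseteq>V. measure_pmf.expectation
           (pi_bernoulli V (\<lambda>v. if v \<in> A then 1 - g (X (V - A) v) else g (X A v)))
           (\<lambda>s. lyap K N (sum \<pi> {v\<in>V. s v}))
         \<le> (1 - \<delta>) * lyap K N (sum \<pi> A))"
proof -
  \<comment> \<open>A third of the margin at 0: one third absorbs L s, one absorbs the second-moment
    term, and the last is the contraction that remains.\<close>
  define \<epsilon>\<^sub>2 where "\<epsilon>\<^sub>2 = (g 1 - g' 0) / 3"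
  have \<epsilon>\<^sub>2: "0 < \<epsilon>\<^sub>2" "\<epsilon>\<^sub>2 \<le> 1" using end_point g'_0 g_range[of 1] by (auto simp: \<epsilon>\<^sub>2_def)
  define s where "s = \<epsilon>\<^sub>2 / (L + 1)"
  have s: "0 < s" "L * s \<le> \<epsilon>\<^sub>2"
    using \<epsilon>\<^sub>2 L_nonneg by (auto simp: s_def field_simps)
  define \<kappa> where "\<kappa> = \<epsilon>\<^sub>2 / (L / s + M + 1)"
  have den: "0 < L / s + M + 1" using s L_nonneg M_nonneg by (simp add: add_nonneg_pos)
  have \<kappa>: "0 < \<kappa>" "(L / s + M) * \<kappa> \<le> \<epsilon>\<^sub>2"
  proof -
    show \<kappa>0: "0 < \<kappa>" using \<epsilon>\<^sub>2 den by (simp add: \<kappa>_def)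
    have "(L / s + M) * \<kappa> \<le> (L / s + M + 1) * \<kappa>" using \<kappa>0 by (intro mult_right_mono) auto
    also have "\<dots> = \<epsilon>\<^sub>2" using den by (simp add: \<kappa>_def)
    finally show "(L / s + M) * \<kappa> \<le> \<epsilon>\<^sub>2" .
  qed
  \<comment> \<open>Below mass c, half of \<kappa> covers the term with \<open>C\<^sub>2\<close>;
    the other half is the allowance returned as \<eta>.\<close>
  define c where "c = min (\<epsilon>\<^sub>2 / 8) (\<kappa> / (2 * (C\<^sub>2 + 1)))"
  have c: "0 < c" "c \<le> \<epsilon>\<^sub>2 / 8" "C\<^sub>2 * c \<le> \<kappa> / 2"
  proof -
    show "0 < c" using \<epsilon>\<^sub>2 \<kappa> C by (auto simp: c_def)
    show "c \<le> \<epsilon>\<^sub>2 / 8" unfolding c_def by (rule min.cobounded1)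
    have "C\<^sub>2 * c \<le> (C\<^sub>2 + 1) * (\<kappa> / (2 * (C\<^sub>2 + 1)))"
      using C \<open>0 < c\<close> by (intro mult_mono) (auto simp: c_def)
    also have "\<dots> = \<kappa> / 2" using C by (simp add: field_simps)
    finally show "C\<^sub>2 * c \<le> \<kappa> / 2" .
  qed
  obtain \<epsilon>' where \<epsilon>': "\<epsilon>' > 0" "\<And>x. x \<in> {c..1-c} \<Longrightarrow> (1 + \<epsilon>') * \<bar>x - 1/2\<bar> \<le> \<bar>updating g x - 1/2\<bar>"
    using repelling[OF c(1)] by blast
  define \<epsilon> where "\<epsilon> = min \<epsilon>' 1"
  have \<epsilon>: "0 < \<epsilon>" "\<epsilon> \<le> 1" using \<epsilon>' by (auto simp: \<epsilon>_def)
  have rep: "(1 + \<epsilon>) * \<bar>x - 1/2\<bar> \<le> \<bar>updating g x - 1/2\<bar>" if "x \<in> {c..1-c}" for x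
  proof -
    have "(1 + \<epsilon>) * \<bar>x - 1/2\<bar> \<le> (1 + \<epsilon>') * \<bar>x - 1/2\<bar>" by (intro mult_right_mono) (auto simp: \<epsilon>_def)
    then show ?thesis using \<epsilon>'(2)[OF that] by linarith
  qed
  define K where "K = max 1 (max (32768 / (\<epsilon>^3 * c)) (8 * M * C\<^sub>1 / \<epsilon>))"
  have K: "1 \<le> K" "32768 / (\<epsilon>^3 * c) \<le> K" "8 * M * C\<^sub>1 / \<epsilon> \<le> K" by (auto simp: K_def)
  define k where "k = g (1/2) * (1 - g (1/2))"
  have k: "0 < k" using half by (simp add: k_def)
  \<comment> \<open>Large enough for the noise of strength k to carry the process across the doubled
    window, as \<open>escape_centre\<close> requires.\<close>
  define \<theta> where "\<theta> = max 1 (48 * (2 * K + 1) / k)"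
  have \<theta>: "1 \<le> \<theta>" "2 * K + 1 \<le> \<theta> * k / 48"
  proof -
    have "48 * (2 * K + 1) / k \<le> \<theta>" by (simp add: \<theta>_def)
    then show "2 * K + 1 \<le> \<theta> * k / 48" using k by (simp add: field_simps)
  qed (simp add: \<theta>_def)
  define q where "q = 3/4 * exp (- (2 * \<theta> * ((2 + L + 2 * M) * K + M * C\<^sub>1) + 16 * \<theta>\<^sup>2))"
  define \<delta> where "\<delta> = min (min (\<epsilon>\<^sub>2 / 4) (\<epsilon> / 32)) q"
  have \<delta>: "0 < \<delta>" "\<delta> < 1" "\<delta> \<le> \<epsilon>\<^sub>2 / 4" "\<delta> \<le> \<epsilon> / 32" "\<delta> \<le> q"
    using \<epsilon> \<epsilon>\<^sub>2 by (auto simp: \<delta>_def q_def)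
  have sqrt_top: "filterlim sqrt at_top (at_top :: real filter)" by (rule sqrt_at_top)
  have big: "\<forall>\<^sub>F N in at_top. b \<le> sqrt N" for b
    using filterlim_at_top_imp_at_infinity sqrt_top by (auto simp: filterlim_at_top)
  have lim: "((\<lambda>N. sqrt (C\<^sub>1 / sqrt N)) \<longlongrightarrow> sqrt 0) at_top"
    by (intro tendsto_real_sqrt real_tendsto_divide_at_top[OF tendsto_const sqrt_top])
  have lim1: "((\<lambda>N. L * (K / sqrt N + sqrt (C\<^sub>1 / sqrt N))) \<longlongrightarrow> L * (0 + sqrt 0)) at_top"
    by (intro tendsto_mult tendsto_add tendsto_const lim real_tendsto_divide_at_top[OF tendsto_const sqrt_top])
  have lim2: "((\<lambda>N. 2 * M * sqrt (C\<^sub>1 / sqrt N)) \<longlongrightarrow> 2 * M * sqrt 0) at_top"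
    by (intro tendsto_mult tendsto_const lim)
  have "\<forall>\<^sub>F N in at_top. L * (K / sqrt N + sqrt (C\<^sub>1 / sqrt N)) < k / 2"
    using k by (intro order_tendstoD(2)[OF lim1]) auto
  moreover have "\<forall>\<^sub>F N in at_top. 2 * M * sqrt (C\<^sub>1 / sqrt N) < \<epsilon> / 4"
    using \<epsilon> by (intro order_tendstoD(2)[OF lim2]) auto
  moreover note big[of K] big[of "512 / \<epsilon>\<^sub>2^3"] big[of "8 * \<theta>"] big[of "C\<^sub>1"]
  ultimately have "\<forall>\<^sub>F N in at_top. \<forall>(V :: 'a set) \<pi> X. voting_walk V \<pi> X N \<longrightarrow>
      (\<forall>A\<subseteq>V. voting_walk.disp V \<pi> X A \<le> C\<^sub>1 / sqrt N \<and>
        (\<Sum>v\<in>V. \<pi> v * (X A v)\<^sup>2) \<le> (C\<^sub>2 * sum \<pi> A + \<kappa> / 2) * sum \<pi> A) \<longrightarrow>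
      (\<forall>A\<subseteq>V. measure_pmf.expectation
           (pi_bernoulli V (\<lambda>v. if v \<in> A then 1 - g (X (V - A) v) else g (X A v)))
           (\<lambda>s. lyap K N (sum \<pi> {v\<in>V. s v}))
         \<le> (1 - \<delta>) * lyap K N (sum \<pi> A))"
  proof eventually_elim
    case (elim N)
    show ?case
    proof (intro allI impI)
      fix V :: "'a set" and \<pi> X A
      assume "voting_walk V \<pi> X N"
        and props: "\<forall>A\<subseteq>V. voting_walk.disp V \<pi> X A \<le> C\<^sub>1 / sqrt N \<and>
          (\<Sum>v\<in>V. \<pi> v * (X A v)\<^sup>2) \<le> (C\<^sub>2 * sum \<pi> A + \<kappa> / 2) * sum \<pi> A"
        and A: "A \<subseteq> V"
      then interpret voting_walk V \<pi> X N by simp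
      interpret voting V \<pi> X N g g' L M by unfold_locales
      have R: "1 \<le> sqrt N" using elim K by linarith
      have disp: "disp A \<le> C\<^sub>1 / sqrt N" if "A \<subseteq> V" for A using props that by auto
      have disp1: "disp A \<le> 1"
      proof -
        have "C\<^sub>1 / sqrt N \<le> 1" using elim R by (simp add: divide_le_eq)
        then show ?thesis using disp[OF A] by linarith
      qed
      have sqrt_disp: "sqrt (disp A) \<le> sqrt (C\<^sub>1 / sqrt N)" using disp[OF A] by simp
      have weak: "e \<le> (1 - \<delta>) * lyap K N (sum \<pi> A)"
        if "e \<le> (1 - d) * lyap K N (sum \<pi> A)" "\<delta> \<le> d" for e d
      proof -
        have "(1 - d) * lyap K N (sum \<pi> A) \<le> (1 - \<delta>) * lyap K N (sum \<pi> A)"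
          using that K N_pos mass_bounds[OF A] by (intro mult_right_mono lyap_bounds) auto
        then show ?thesis using that by linarith
      qed
      have small: "drift B \<le> (1 - \<epsilon>\<^sub>2) * sum \<pi> B" if B: "B \<subseteq> V" "sum \<pi> B \<le> c" for B
      proof -
        have B0: "0 \<le> sum \<pi> B" using mass_bounds[OF B(1)] by auto
        have "C\<^sub>2 * sum \<pi> B \<le> C\<^sub>2 * c" using C B by (intro mult_left_mono) auto
        then have "C\<^sub>2 * sum \<pi> B + \<kappa> / 2 \<le> \<kappa>" using c by linarith
        then have "(C\<^sub>2 * sum \<pi> B + \<kappa> / 2) * sum \<pi> B \<le> \<kappa> * sum \<pi> B"
          using B0 by (intro mult_right_mono) auto
        then have "(\<Sum>v\<in>V. \<pi> v * (X B v)\<^sup>2) \<le> \<kappa> * sum \<pi> B" using props B by (meson order.trans)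
        then have "drift B \<le> (1 - g 1 + g' 0 + L * s + (L / s + M) * \<kappa>) * sum \<pi> B"
          by (rule drift_small[OF B(1) s(1)])
        also have "\<dots> \<le> (1 - \<epsilon>\<^sub>2) * sum \<pi> B"
        proof (intro mult_right_mono B0)
          have "g' 0 = g 1 - 3 * \<epsilon>\<^sub>2" by (simp add: \<epsilon>\<^sub>2_def diff_divide_distrib)
          then show "1 - g 1 + g' 0 + L * s + (L / s + M) * \<kappa> \<le> 1 - \<epsilon>\<^sub>2" using s \<kappa> by linarith
        qed
        finally show ?thesis .
      qed
      consider "sum \<pi> A \<le> c" | "sum \<pi> (V - A) \<le> c"
        | "sum \<pi> A \<in> {c..1-c}" "sqrt N * \<bar>sum \<pi> A - 1/2\<bar> \<le> K * (1/2 - \<bar>sum \<pi> A - 1/2\<bar>)"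
        | "sum \<pi> A \<in> {c..1-c}" "K * (1/2 - \<bar>sum \<pi> A - 1/2\<bar>) \<le> sqrt N * \<bar>sum \<pi> A - 1/2\<bar>"
        using mass_compl[OF A] by fastforce
      then have "measure_pmf.expectation (step A) (\<lambda>s. lyap K N (mass s)) \<le> (1 - \<delta>) * lyap K N (sum \<pi> A)"
      proof cases
        case 1
        then have "sum \<pi> A \<le> \<epsilon>\<^sub>2 / 8" using c by linarith
        then show ?thesis
          by (rule weak[OF contract_small(1)[OF A \<epsilon>\<^sub>2 K(1) elim(3,4) _ small[OF A 1]] \<delta>(3)])
      next
        case 2
        let ?B = "V - A"
        have "sum \<pi> ?B \<le> \<epsilon>\<^sub>2 / 8" using 2 c by linarith
        then have "measure_pmf.expectation (step (V - ?B)) (\<lambda>s. lyap K N (mass s))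
            \<le> (1 - \<epsilon>\<^sub>2 / 4) * lyap K N (sum \<pi> (V - ?B))"
          by (rule contract_small(2)[OF Diff_subset \<epsilon>\<^sub>2 K(1) elim(3,4) _ small[OF Diff_subset 2]])
        then show ?thesis unfolding double_diff[OF A order.refl] by (rule weak[OF _ \<delta>(3)])
      next
        case 3
        have "L * (K / sqrt N + sqrt (disp A)) \<le> L * (K / sqrt N + sqrt (C\<^sub>1 / sqrt N))"
          using sqrt_disp L_nonneg by (intro mult_left_mono) auto
        then have "L * (K / sqrt N + sqrt (disp A)) \<le> k / 2" using elim(1) by linarith
        note contract_centre[OF A K(1) \<theta>(1) elim(5) \<theta>(2)[unfolded k_def] disp[OF A] disp1 this[unfolded k_def] 3(2)]
        then show ?thesis unfolding q_def[symmetric] by (rule weak[OF _ \<delta>(5)])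
      next
        case 4
        have "2 * M * sqrt (disp A) \<le> 2 * M * sqrt (C\<^sub>1 / sqrt N)"
          using sqrt_disp M_nonneg by (intro mult_left_mono) auto
        then have q: "2 * M * sqrt (disp A) \<le> \<epsilon> / 4" using elim(2) by linarith
        have "c \<le> 1/2 - \<bar>sum \<pi> A - 1/2\<bar>" using 4(1) by (auto simp: abs_if)
        note contract_mid[OF A \<epsilon> c(1) this K elim(3) disp[OF A] q rep[OF 4(1)] 4(2)]
        then show ?thesis by (rule weak[OF _ \<delta>(4)])
      qed
      moreover have "rate A = (\<lambda>v. if v \<in> A then 1 - g (X (V - A) v) else g (X A v))"
        by (rule ext) (rule rate_def)
      ultimately show "measure_pmf.expectation
           (pi_bernoulli V (\<lambda>v. if v \<in> A then 1 - g (X (V - A) v) else g (X A v)))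
           (\<lambda>s. lyap K N (sum \<pi> {v\<in>V. s v})) \<le> (1 - \<delta>) * lyap K N (sum \<pi> A)"
        by (simp only: mass_conv_sum)
    qed
  qed
  then show thesis by (rule that[OF \<delta>(1,2) K(1) half_gt_zero[OF \<kappa>(1)]])
qed

section \<open>Quasi-majority functions\<close>

lemma updating_lazy: "updating (\<lambda>x. \<rho> * f x) x = (1 - \<rho>) * x + \<rho> * updating f x"
  by (simp add: updating_def algebra_simps)

lemma updating_compl: "updating f (1 - x) = 1 - updating f x"
  by (simp add: updating_def algebra_simps)

lemma C2_derivs:
  assumes "C2 f"
  shows "(f has_real_derivative deriv f x) (at x)"
    and "(deriv f has_real_derivative deriv (deriv f) x) (at x)"
  using assms unfolding C2_def differentiable_on_def
  by (simp_all add: DERIV_deriv_iff_real_differentiable)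

lemma C2_lipschitz_bounds:
  assumes "C2 f"
  obtains L M where "0 \<le> L" "0 \<le> M"
    and "\<And>x y. x \<in> {0..1} \<Longrightarrow> y \<in> {0..1} \<Longrightarrow> \<bar>f x - f y\<bar> \<le> L * \<bar>x - y\<bar>"
    and "\<And>x y. x \<in> {0..1} \<Longrightarrow> y \<in> {0..1} \<Longrightarrow> \<bar>deriv f x - deriv f y\<bar> \<le> M * \<bar>x - y\<bar>"
    and "\<And>x y. x \<in> {0..1} \<Longrightarrow> y \<in> {0..1} \<Longrightarrow> \<bar>f x - f y - deriv f y * (x - y)\<bar> \<le> M * (x - y)\<^sup>2"
proof -
  note D = C2_derivs[OF assms]
  have bound: "\<exists>B\<ge>0. \<forall>x\<in>{0..1}. \<bar>h x\<bar> \<le> B" if "continuous_on {0..1} h" for h :: "real \<Rightarrow> real"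
  proof -
    have "bounded (h ` {0..1})" using that by (intro compact_imp_bounded compact_continuous_image) auto
    then obtain B where "\<forall>x\<in>{0..1}. \<bar>h x\<bar> \<le> B" unfolding bounded_iff real_norm_def by blast
    then show ?thesis by (intro exI[of _ "max B 0"]) (auto simp: le_max_iff_disj)
  qed
  have "continuous_on {0..1} (deriv f)" using D(2) by (intro DERIV_continuous_on) (blast intro: DERIV_subset)
  then obtain L where L: "0 \<le> L" "\<And>x. x \<in> {0..1} \<Longrightarrow> \<bar>deriv f x\<bar> \<le> L" using bound by blast
  have "continuous_on {0..1} (deriv (deriv f))" using assms unfolding C2_def by (blast intro: continuous_on_subset)
  then obtain M where M: "0 \<le> M" "\<And>x. x \<in> {0..1} \<Longrightarrow> \<bar>deriv (deriv f) x\<bar> \<le> M" using bound by blast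
  have lip: "\<bar>h x - h y\<bar> \<le> B * \<bar>x - y\<bar>"
    if "\<And>z. (h has_real_derivative h' z) (at z)" "\<And>z. z \<in> closed_segment x y \<Longrightarrow> \<bar>h' z\<bar> \<le> B"
    for h h' :: "real \<Rightarrow> real" and x y B
  proof -
    have "norm (h x - h y) \<le> B * norm (x - y)"
      using that by (intro field_differentiable_bound[of "closed_segment x y" h h'])
        (auto intro: has_field_derivative_at_within)
    then show ?thesis by simp
  qed
  have seg: "z \<in> {0..1}" if "x \<in> {0..1}" "y \<in> {0..1}" "z \<in> closed_segment x y" for x y z :: real
    using that by (auto simp: closed_segment_eq_real_ivl split: if_splits)
  have d: "\<bar>deriv f x - deriv f y\<bar> \<le> M * \<bar>x - y\<bar>" if "x \<in> {0..1}" "y \<in> {0..1}" for x y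
    using M(2) seg[OF that] by (intro lip[OF D(2)]) auto
  show thesis
  proof (rule that[OF L(1) M(1)])
    fix x y :: real assume xy: "x \<in> {0..1}" "y \<in> {0..1}"
    show "\<bar>f x - f y\<bar> \<le> L * \<bar>x - y\<bar>" using L(2) seg[OF xy] by (intro lip[OF D(1)]) auto
    show "\<bar>deriv f x - deriv f y\<bar> \<le> M * \<bar>x - y\<bar>" by (rule d[OF xy])
    \<comment> \<open>Mean value inequality for f minus its tangent slope at y, whose derivative is
      at most M \<bar>x - y\<bar> on the segment. The constant M in place of M/2 is
      harmless.\<close>
    have "\<bar>(f x - deriv f y * x) - (f y - deriv f y * y)\<bar> \<le> (M * \<bar>x - y\<bar>) * \<bar>x - y\<bar>"
    proof (rule lip)
      fix z show "((\<lambda>z. f z - deriv f y * z) has_real_derivative deriv f z - deriv f y) (at z)"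
        by (auto intro!: derivative_eq_intros D(1))
    next
      fix z assume z: "z \<in> closed_segment x y"
      then have "\<bar>z - y\<bar> \<le> \<bar>x - y\<bar>" by (auto simp: closed_segment_eq_real_ivl split: if_splits)
      then show "\<bar>deriv f z - deriv f y\<bar> \<le> M * \<bar>x - y\<bar>"
        using d[OF seg[OF xy z] xy(2)] M(1) by (meson mult_left_mono order.trans)
    qed
    then show "\<bar>f x - f y - deriv f y * (x - y)\<bar> \<le> M * (x - y)\<^sup>2"
      by (simp add: power2_eq_square algebra_simps abs_mult_self_eq flip: abs_mult)
  qed
qed

lemma has_real_derivative_updating:
  assumes "C2 f"
  shows "(updating f has_real_derivative
    1 - f (1 - x) + x * deriv f (1 - x) - f x + (1 - x) * deriv f x) (at x)"
proof -
  note D = C2_derivs(1)[OF assms]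
  have 1: "((\<lambda>x. f (1 - x)) has_real_derivative - deriv f (1 - x)) (at x)"
  proof -
    have "((\<lambda>x. 1 - x) has_real_derivative -1) (at x)" by (auto intro!: derivative_eq_intros)
    then show ?thesis
      using DERIV_chain2[where f = f and g = "\<lambda>x. 1 - x" and s = UNIV, OF D] by fastforce
  qed
  show ?thesis unfolding updating_def[abs_def]
    by (rule derivative_eq_intros 1 D refl | simp add: algebra_simps)+
qed

text \<open>The slope of H from 1/2, continued by H'(1/2), is continuous on the compact interval and
  exceeds 1 throughout: at 1/2 by the derivative condition, elsewhere by H(x) < x. Its minimum is
  attained and gives \<epsilon>. At 0 the slope equals 1, hence the cutoff c.\<close>

lemma updating_repelling:
  assumes f: "quasi_majority f" and c: "0 < c" "c \<le> 1/2"
  shows "\<exists>\<epsilon>>0. \<forall>x\<in>{c..1/2}. (1 + \<epsilon>) * (1/2 - x) \<le> 1/2 - updating f x"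
proof -
  define D where "D = deriv (updating f) (1/2)"
  have D1: "1 < D" and C2: "C2 f" using f by (auto simp: quasi_majority_def D_def)
  have half: "updating f (1/2) = 1/2" by (simp add: updating_def field_simps)
  have DH: "(updating f has_real_derivative D) (at (1/2))"
    using has_real_derivative_updating[OF C2] DERIV_imp_deriv unfolding D_def by metis
  define k where "k x = (if x = 1/2 then D else (updating f x - 1/2) / (x - 1/2))" for x
  have "isCont k x" for x
  proof (cases "x = 1/2")
    case True
    have "((\<lambda>y. (updating f y - updating f (1/2)) / (y - 1/2)) \<longlongrightarrow> D) (at (1/2))"
      using DH by (simp add: has_field_derivative_iff)
    then have "(k \<longlongrightarrow> D) (at (1/2))"
      by (rule Lim_transform_eventually) (auto simp: k_def half eventually_at_filter)
    moreover have "k (1/2) = D" by (simp add: k_def)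
    ultimately show ?thesis unfolding isCont_def True by simp
  next
    case False
    have cont: "isCont (updating f) x" using has_real_derivative_updating[OF C2] by (rule DERIV_isCont)
    have "isCont (\<lambda>y. (updating f y - 1/2) / (y - 1/2)) x"
      using False cont by (intro continuous_intros) auto
    moreover have "\<forall>\<^sub>F y in nhds x. y \<noteq> 1/2"
      using False by (intro t1_space_nhds) auto
    then have "\<forall>\<^sub>F y in nhds x. k y = (updating f y - 1/2) / (y - 1/2)"
      by eventually_elim (simp add: k_def)
    ultimately show ?thesis by (simp add: isCont_cong)
  qed
  then have "continuous_on {c..1/2} k" by (simp add: continuous_at_imp_continuous_on)
  then obtain x\<^sub>0 where x0: "x\<^sub>0 \<in> {c..1/2}" "\<And>x. x \<in> {c..1/2} \<Longrightarrow> k x\<^sub>0 \<le> k x"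
    using continuous_attains_inf[of "{c..1/2}" k] c by auto
  have "1 < k x\<^sub>0"
  proof (cases "x\<^sub>0 = 1/2")
    case False
    then have "updating f x\<^sub>0 < x\<^sub>0" using x0(1) c f by (auto simp: quasi_majority_def)
    then have "(1/2 - x\<^sub>0) < 1/2 - updating f x\<^sub>0" by simp
    moreover have "k x\<^sub>0 = (1/2 - updating f x\<^sub>0) / (1/2 - x\<^sub>0)"
      using False by (simp add: k_def) (metis minus_diff_eq minus_divide_divide)
    ultimately show ?thesis using False x0(1) by (simp add: less_divide_eq)
  qed (use D1 in \<open>simp add: k_def\<close>)
  moreover have "k x\<^sub>0 * (1/2 - x) \<le> 1/2 - updating f x" if x: "x \<in> {c..1/2}" for x
  proof (cases "x = 1/2")
    case False
    then have "k x * (1/2 - x) = 1/2 - updating f x" by (simp add: k_def field_simps)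
    then show ?thesis using x0(2)[OF x] x mult_right_mono[of "k x\<^sub>0" "k x" "1/2 - x"] by simp
  next
    case True
    show ?thesis unfolding True half by simp
  qed
  ultimately show ?thesis by (intro exI[of _ "k x\<^sub>0 - 1"]) auto
qed

text \<open>Laziness mixes H with the identity and only reduces the excess \<epsilon> to \<rho>
  \<epsilon>. The right half follows by the symmetry H(1 - x) = 1 - H(x); for c > 1/2 the interval
  is empty.\<close>

lemma lazy_updating_repelling:
  assumes f: "quasi_majority f" and \<rho>: "0 < \<rho>" "\<rho> \<le> 1" and c: "0 < c"
  shows "\<exists>\<epsilon>>0. \<forall>x\<in>{c..1-c}. (1 + \<epsilon>) * \<bar>x - 1/2\<bar> \<le> \<bar>updating (\<lambda>x. \<rho> * f x) x - 1/2\<bar>"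
proof (cases "c \<le> 1/2")
  case True
  obtain \<epsilon> where \<epsilon>: "\<epsilon> > 0" "\<And>x. x \<in> {c..1/2} \<Longrightarrow> (1 + \<epsilon>) * (1/2 - x) \<le> 1/2 - updating f x"
    using updating_repelling[OF f c True] by auto
  let ?H = "updating (\<lambda>x. \<rho> * f x)"
  have left: "(1 + \<rho> * \<epsilon>) * \<bar>x - 1/2\<bar> \<le> \<bar>?H x - 1/2\<bar>" if x: "x \<in> {c..1/2}" for x
  proof -
    have "(1 + \<rho> * \<epsilon>) * (1/2 - x) = (1 - \<rho>) * (1/2 - x) + \<rho> * ((1 + \<epsilon>) * (1/2 - x))"
      by (simp add: field_simps)
    also have "\<dots> \<le> (1 - \<rho>) * (1/2 - x) + \<rho> * (1/2 - updating f x)"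
      using \<epsilon>(2)[OF x] \<rho> by (intro add_left_mono mult_left_mono) auto
    also have "\<dots> = 1/2 - ?H x" by (simp add: updating_lazy algebra_simps diff_divide_distrib)
    also have "\<dots> \<le> \<bar>?H x - 1/2\<bar>" by linarith
    also have "1/2 - x = \<bar>x - 1/2\<bar>" using x by simp
    finally show ?thesis .
  qed
  have "(1 + \<rho> * \<epsilon>) * \<bar>x - 1/2\<bar> \<le> \<bar>?H x - 1/2\<bar>" if x: "x \<in> {c..1-c}" for x
  proof (cases "x \<le> 1/2")
    case False
    have "(1 + \<rho> * \<epsilon>) * \<bar>(1 - x) - 1/2\<bar> \<le> \<bar>?H (1 - x) - 1/2\<bar>" using False x by (intro left) auto
    moreover have "\<bar>(1 - y) - 1/2\<bar> = \<bar>y - 1/2\<bar>" for y :: real by linarith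
    ultimately show ?thesis by (simp only: updating_compl)
  qed (use left x in auto)
  then show ?thesis using \<epsilon> \<rho> by (intro exI[of _ "\<rho> * \<epsilon>"]) auto
qed (auto intro: exI[of _ 1])

text \<open>A negative slope at 0 would push f below f(0) = 0 inside [0,1]. The second inequality is
  the condition on H'(0), since H'(0) = 1 - f(1) + f'(0).\<close>

lemma quasi_majority_endpoint_derivs:
  assumes f: "quasi_majority f"
  shows "0 \<le> deriv f 0" "deriv f 0 < f 1"
proof -
  have C2: "C2 f" and f0: "f 0 = 0" and img: "f ` {0..1} = {0..1}" and D0: "deriv (updating f) 0 < 1"
    using f by (auto simp: quasi_majority_def voting_function_def)
  show "0 \<le> deriv f 0"
  proof (rule ccontr)
    assume "\<not> 0 \<le> deriv f 0"
    then obtain d where d: "d > 0" "\<And>h. 0 < h \<Longrightarrow> h < d \<Longrightarrow> f (0 + h) < f 0"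
      using DERIV_neg_dec_right[OF C2_derivs(1)[OF C2, of 0]] by auto
    have "f (min (d / 2) 1) < 0" using d(2)[of "min (d / 2) 1"] d(1) f0 by simp
    moreover have "f (min (d / 2) 1) \<in> f ` {0..1}" using d(1) by (intro imageI) auto
    ultimately show False using img by auto
  qed
  show "deriv f 0 < f 1"
    using DERIV_imp_deriv[OF has_real_derivative_updating[OF C2, of 0]] D0 f0 by simp
qed

lemma quasi_majority_voting_rule:
  assumes f: "quasi_majority f" and \<rho>: "0 < \<rho>" "\<rho> \<le> 1"
  obtains L M where "voting_rule (\<lambda>x. \<rho> * f x) (\<lambda>x. \<rho> * deriv f x) L M"
proof -
  have C2: "C2 f" and f0: "f 0 = 0" and img: "f ` {0..1} = {0..1}"
    using f by (auto simp: quasi_majority_def voting_function_def)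
  obtain L M where LM: "0 \<le> L" "0 \<le> M"
    "\<And>x y. x \<in> {0..1} \<Longrightarrow> y \<in> {0..1} \<Longrightarrow> \<bar>f x - f y\<bar> \<le> L * \<bar>x - y\<bar>"
    "\<And>x y. x \<in> {0..1} \<Longrightarrow> y \<in> {0..1} \<Longrightarrow> \<bar>deriv f x - deriv f y\<bar> \<le> M * \<bar>x - y\<bar>"
    "\<And>x y. x \<in> {0..1} \<Longrightarrow> y \<in> {0..1} \<Longrightarrow> \<bar>f x - f y - deriv f y * (x - y)\<bar> \<le> M * (x - y)\<^sup>2"
    using C2_lipschitz_bounds[OF C2] by metis
  have scale: "\<bar>\<rho> * t\<bar> \<le> b" if "\<bar>t\<bar> \<le> b" for t b
  proof -
    have "\<bar>\<rho> * t\<bar> \<le> 1 * \<bar>t\<bar>" unfolding abs_mult using \<rho> by (intro mult_right_mono) auto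
    then show ?thesis using that by simp
  qed
  have "voting_rule (\<lambda>x. \<rho> * f x) (\<lambda>x. \<rho> * deriv f x) L M"
  proof
    fix x y :: real assume x: "x \<in> {0..1}"
    then have fx: "f x \<in> {0..1}" using img by auto
    then have "\<rho> * f x \<le> 1 * 1" using \<rho> by (intro mult_mono) auto
    then show "\<rho> * f x \<in> {0..1}" using fx \<rho> by auto
    assume y: "y \<in> {0..1}"
    show "\<bar>\<rho> * f x - \<rho> * f y\<bar> \<le> L * \<bar>x - y\<bar>"
      using scale[OF LM(3)[OF x y]] by (simp add: right_diff_distrib)
    show "\<bar>\<rho> * deriv f x - \<rho> * deriv f y\<bar> \<le> M * \<bar>x - y\<bar>"
      using scale[OF LM(4)[OF x y]] by (simp add: right_diff_distrib)
    show "\<bar>\<rho> * f x - \<rho> * f y - \<rho> * deriv f y * (x - y)\<bar> \<le> M * (x - y)\<^sup>2"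
      using scale[OF LM(5)[OF x y]] by (simp add: right_diff_distrib mult.assoc)
  qed (use f0 \<rho> LM quasi_majority_endpoint_derivs[OF f] in auto)
  then show thesis by (rule that)
qed

section \<open>The walk on a pseudorandom graph\<close>

lemma degree_in_conv_sum:
  "finite A \<Longrightarrow> real (degree_in E A v) = (\<Sum>u\<in>A. of_bool ({u, v} \<in> E))"
  by (simp add: degree_in_def Int_def)

text \<open>Both sides count walks of length two with both ends in A, by middle vertex and by ends.
  Codegrees thus control second moments.\<close>

lemma sum_degree_in_squares:
  assumes "finite V" "A \<subseteq> V"
  shows "(\<Sum>v\<in>V. (real (degree_in E A v))\<^sup>2)
    = (\<Sum>u\<in>A. \<Sum>w\<in>A. real (card {x\<in>V. {x, u} \<in> E \<and> {x, w} \<in> E}))"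
proof -
  have finA: "finite A" using assms finite_subset by auto
  have "(\<Sum>v\<in>V. (real (degree_in E A v))\<^sup>2)
      = (\<Sum>v\<in>V. \<Sum>u\<in>A. \<Sum>w\<in>A. of_bool ({v, u} \<in> E \<and> {v, w} \<in> E))"
    by (simp only: degree_in_conv_sum[OF finA] power2_eq_square sum_product of_bool_conj insert_commute)
  also have "\<dots> = (\<Sum>u\<in>A. \<Sum>w\<in>A. \<Sum>v\<in>V. of_bool ({v, u} \<in> E \<and> {v, w} \<in> E))"
    by (subst sum.swap) (intro sum.cong refl sum.swap)
  also have "\<dots> = (\<Sum>u\<in>A. \<Sum>w\<in>A. real (card {x\<in>V. {x, u} \<in> E \<and> {x, w} \<in> E}))"
    using assms by (simp add: Int_def)
  finally show ?thesis .
qed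

locale pseudorandom_graph =
  fixes n :: nat and p :: real and E :: "nat set set"
  assumes pseudorandom: "pseudorandom n p E" and p: "0 < p" "p \<le> 1" and m: "1 \<le> real n * p"
begin

abbreviation "deg \<equiv> (\<lambda>v. real (degree_in E {..<n} v))"

definition "walk_pi v = deg v / sum deg {..<n}"
definition "walk_X A v = real (degree_in E A v) / deg v"

lemma n_pos: "0 < n" using m by (cases n) auto

lemma deg_bounds: "v < n \<Longrightarrow> real n * p / 2 \<le> deg v" "v < n \<Longrightarrow> deg v \<le> 2 * (real n * p)"
  using pseudorandom by (auto simp: pseudorandom_def)

lemma deg_pos: "v < n \<Longrightarrow> 0 < deg v"
  using deg_bounds(1)[of v] m by linarith

lemma sum_deg_bounds:
  "real n * (real n * p / 2) \<le> sum deg {..<n}" "sum deg {..<n} \<le> real n * (2 * (real n * p))"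
  using sum_mono[of "{..<n}" "\<lambda>_. real n * p / 2" deg] sum_mono[of "{..<n}" deg "\<lambda>_. 2 * (real n * p)"] deg_bounds
  by auto

lemma sum_deg_pos: "0 < sum deg {..<n}"
proof -
  have "0 < real n * (real n * p / 2)" using n_pos p by simp
  then show ?thesis using sum_deg_bounds(1) by linarith
qed

lemma walk_weight_le: "v < n \<Longrightarrow> 1 / (sum deg {..<n} * deg v) \<le> 4 / (real n ^ 3 * p\<^sup>2)"
proof -
  assume v: "v < n"
  have "(real n * (real n * p / 2)) * (real n * p / 2) \<le> sum deg {..<n} * deg v"
    using sum_deg_bounds(1) deg_bounds(1)[OF v] p sum_deg_pos by (intro mult_mono) auto
  then have "1 / (sum deg {..<n} * deg v) \<le> 1 / ((real n * (real n * p / 2)) * (real n * p / 2))"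
    using n_pos p sum_deg_pos deg_pos[OF v] by (intro divide_left_mono mult_pos_pos) auto
  also have "\<dots> = 4 / (real n ^ 3 * p\<^sup>2)" by (simp add: power3_eq_cube power2_eq_square mult_ac)
  finally show ?thesis .
qed

sublocale voting_walk "{..<n}" walk_pi walk_X "real n"
proof
  show "finite {..<n}" "0 < real n" using n_pos by auto
  show "sum walk_pi {..<n} = 1"
    using sum_deg_pos by (simp add: walk_pi_def flip: sum_divide_distrib)
next
  fix v assume "v \<in> {..<n}"
  then have v: "v < n" by simp
  have "1 / (4 * real n) = (real n * p / 2) / (real n * (2 * (real n * p)))"
    using n_pos p by (simp add: field_simps)
  also have "\<dots> \<le> walk_pi v" unfolding walk_pi_def
    using deg_bounds[OF v] sum_deg_bounds sum_deg_pos p by (intro frac_le) auto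
  finally show "1 / (4 * real n) \<le> walk_pi v" .
  have "walk_pi v \<le> (2 * (real n * p)) / (real n * (real n * p / 2))" unfolding walk_pi_def
    using deg_bounds[OF v] sum_deg_bounds n_pos p by (intro frac_le) auto
  also have "\<dots> = 4 / real n" using n_pos p by (simp add: field_simps)
  finally show "walk_pi v \<le> 4 / real n" .
next
  fix A v assume A: "A \<subseteq> {..<n}" and v: "v \<in> {..<n}"
  show "0 \<le> walk_X A v" by (simp add: walk_X_def)
  have finA: "finite A" using A finite_subset by auto
  have "real (degree_in E ({..<n} - A) v) = deg v - real (degree_in E A v)"
    using A finA by (simp only: degree_in_conv_sum finite_Diff finite_lessThan sum_diff)
  then show "walk_X ({..<n} - A) v = 1 - walk_X A v"
    using deg_pos[of v] v by (simp add: walk_X_def diff_divide_distrib)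
next
  fix A assume A: "A \<subseteq> {..<n}"
  then have finA: "finite A" using finite_subset by auto
  have "(\<Sum>v<n. walk_pi v * walk_X A v) = (\<Sum>v<n. real (degree_in E A v)) / sum deg {..<n}"
    unfolding sum_divide_distrib
  proof (intro sum.cong refl)
    fix v assume "v \<in> {..<n}"
    then have "deg v \<noteq> 0" using deg_pos[of v] by simp
    then show "walk_pi v * walk_X A v = real (degree_in E A v) / sum deg {..<n}"
      by (simp add: walk_pi_def walk_X_def)
  qed
  \<comment> \<open>Stationarity of the walk comes down to the symmetry of adjacency.\<close>
  also have "(\<Sum>v<n. real (degree_in E A v)) = (\<Sum>u\<in>A. deg u)"
    by (simp only: degree_in_conv_sum[OF finA] degree_in_conv_sum[OF finite_lessThan])
      (subst sum.swap, simp only: insert_commute)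
  finally show "(\<Sum>v<n. walk_pi v * walk_X A v) = sum walk_pi A"
    by (simp add: walk_pi_def sum_divide_distrib)
qed

text \<open>The weight of \<open>(y v)^2\<close> is 1 / (sum of degrees * degree of v), and all
  these weights have the same order.\<close>

lemma second_moment_le:
  assumes "\<And>v. v < n \<Longrightarrow> deg v * x v = y v"
  shows "(\<Sum>v<n. walk_pi v * (x v)\<^sup>2) \<le> 4 / (real n ^ 3 * p\<^sup>2) * (\<Sum>v<n. (y v)\<^sup>2)"
  unfolding sum_distrib_left
proof (intro sum_mono)
  fix v assume "v \<in> {..<n}"
  then have v: "v < n" by simp
  have "walk_pi v * (x v)\<^sup>2 = 1 / (sum deg {..<n} * deg v) * (y v)\<^sup>2"
    using deg_pos[OF v] unfolding assms[OF v, symmetric] walk_pi_def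
    by (simp add: power2_eq_square)
  also have "\<dots> \<le> 4 / (real n ^ 3 * p\<^sup>2) * (y v)\<^sup>2"
    using walk_weight_le[OF v] by (intro mult_right_mono) auto
  finally show "walk_pi v * (x v)\<^sup>2 \<le> 4 / (real n ^ 3 * p\<^sup>2) * (y v)\<^sup>2" .
qed

text \<open>The degree into A is compared with the share b of the full degree, so both sides have
  expectation p |A| up to O(p). The difference is the deviation for A, minus b times the deviation
  for the whole vertex set, plus a term of size at most p from the missing loop. Hence 1932 = 4 * 3
  * (80 + 80 + 1).\<close>

lemma disp_le:
  assumes A: "A \<subseteq> {..<n}"
  shows "disp A \<le> 1932 / (real n * p)"
proof -
  define b where "b = real (card A) / real n"
  have finA: "finite A" using A finite_subset by auto
  have cA: "card A \<le> n" using card_mono[OF _ A] by simp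
  have b: "0 \<le> b" "b \<le> 1" "b * real n = real (card A)" using n_pos cA by (auto simp: b_def)
  have loop: "{v} \<notin> E" for v using pseudorandom by (auto simp: pseudorandom_def nsets_def)
  have dev: "(\<Sum>v<n. (edge_dev p E B v)\<^sup>2) \<le> 80 * (real n)\<^sup>2 * p" if "B \<subseteq> {..<n}" for B
    using pseudorandom that by (auto simp: pseudorandom_def)
  have sq3: "(x + y + z)\<^sup>2 \<le> 3 * (x\<^sup>2 + y\<^sup>2 + z\<^sup>2)" for x y z :: real
    using zero_le_power2[of "x - y"] zero_le_power2[of "y - z"] zero_le_power2[of "x - z"]
    by (simp add: power2_eq_square algebra_simps)
  have "(\<Sum>v<n. (real (degree_in E A v) - b * deg v)\<^sup>2)
      \<le> (\<Sum>v<n. 3 * ((edge_dev p E A v)\<^sup>2 + (edge_dev p E {..<n} v)\<^sup>2 + p))"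
  proof (intro sum_mono)
    fix v assume "v \<in> {..<n}"
    then have v: "v < n" by simp
    let ?r = "p * (b - of_bool (v \<in> A))"
    have "real (card (A - {v})) = real (card A) - of_bool (v \<in> A)"
    proof (cases "v \<in> A")
      case True
      then have "card A = Suc (card (A - {v}))" using finA by (simp only: card_Suc_Diff1)
      then show ?thesis using True by simp
    qed simp
    then have h1: "edge_dev p E A v = real (degree_in E A v) - p * (real (card A) - of_bool (v \<in> A))"
      using edge_dev_conv_degree_in[OF finA loop] by simp
    have h2: "edge_dev p E {..<n} v = deg v - p * (real n - 1)"
      using edge_dev_conv_degree_in[OF finite_lessThan loop, of p n v] v by (simp add: of_nat_diff)
    have "real (degree_in E A v) - b * deg v
        = edge_dev p E A v + - (b * edge_dev p E {..<n} v) + ?r"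
      unfolding h1 h2 b(3)[symmetric] by (simp add: algebra_simps)
    then have "(real (degree_in E A v) - b * deg v)\<^sup>2
        \<le> 3 * ((edge_dev p E A v)\<^sup>2 + (b * edge_dev p E {..<n} v)\<^sup>2 + ?r\<^sup>2)"
      using sq3[of "edge_dev p E A v" "- (b * edge_dev p E {..<n} v)" ?r] by (simp only: power2_minus)
    also have "(b * edge_dev p E {..<n} v)\<^sup>2 \<le> (edge_dev p E {..<n} v)\<^sup>2"
      using b by (simp add: power_mult_distrib mult_left_le_one_le power_le_one)
    also have "?r\<^sup>2 \<le> p"
    proof -
      have "(b - of_bool (v \<in> A))\<^sup>2 \<le> 1" using b by (simp add: abs_square_le_1)
      moreover have "p\<^sup>2 \<le> p" using p by (simp add: power2_eq_square mult_left_le)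
      ultimately have "p\<^sup>2 * (b - of_bool (v \<in> A))\<^sup>2 \<le> p * 1" using p by (intro mult_mono) auto
      then show ?thesis by (simp add: power_mult_distrib)
    qed
    finally show "(real (degree_in E A v) - b * deg v)\<^sup>2
        \<le> 3 * ((edge_dev p E A v)\<^sup>2 + (edge_dev p E {..<n} v)\<^sup>2 + p)" by simp
  qed
  also have "\<dots> = 3 * ((\<Sum>v<n. (edge_dev p E A v)\<^sup>2) + (\<Sum>v<n. (edge_dev p E {..<n} v)\<^sup>2) + real n * p)"
    by (simp add: sum.distrib flip: sum_distrib_left)
  also have "\<dots> \<le> 3 * (80 * (real n)\<^sup>2 * p + 80 * (real n)\<^sup>2 * p + real n * p)"
    by (intro mult_left_mono add_mono dev A order.refl) auto
  also have "\<dots> \<le> 3 * (161 * ((real n)\<^sup>2 * p))"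
  proof -
    have "real n * 1 \<le> real n * real n" using n_pos by (intro mult_left_mono) auto
    then have "real n * 1 * p \<le> real n * real n * p" using p by (intro mult_right_mono) auto
    then show ?thesis by (simp add: power2_eq_square mult_ac)
  qed
  finally have sq: "(\<Sum>v<n. (real (degree_in E A v) - b * deg v)\<^sup>2) \<le> 3 * (161 * ((real n)\<^sup>2 * p))" .
  have "disp A \<le> (\<Sum>v<n. walk_pi v * (walk_X A v - b)\<^sup>2)" using disp_eq[OF A, of b] by simp
  also have "\<dots> \<le> 4 / (real n ^ 3 * p\<^sup>2) * (\<Sum>v<n. (real (degree_in E A v) - b * deg v)\<^sup>2)"
  proof (rule second_moment_le)
    fix v assume v: "v < n"
    show "deg v * (walk_X A v - b) = real (degree_in E A v) - b * deg v"
      using deg_pos[OF v] by (simp add: walk_X_def algebra_simps)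
  qed
  also have "\<dots> \<le> 4 / (real n ^ 3 * p\<^sup>2) * (3 * (161 * ((real n)\<^sup>2 * p)))"
    using sq p by (intro mult_left_mono) auto
  also have "4 / (real n ^ 3 * p\<^sup>2) * (3 * (161 * ((real n)\<^sup>2 * p))) = 1932 / (real n * p)"
    using n_pos p by (simp add: power3_eq_cube power2_eq_square)
  finally show ?thesis .
qed

text \<open>Walks returning to their start number at most 2np per vertex of A and give the term
  32/(np). The others are counted by codegrees: the part 2np^2 gives a multiple of the mass, the
  logarithm gives the last term.\<close>

lemma second_moment_small_set:
  assumes A: "A \<subseteq> {..<n}"
  shows "(\<Sum>v<n. walk_pi v * (walk_X A v)\<^sup>2)
    \<le> (128 * sum walk_pi A + 32 / (real n * p) + 128 * real (card A) * ln (real n) / (real n * p)\<^sup>2) * sum walk_pi A"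
proof -
  let ?a = "real (card A)" and ?\<alpha> = "sum walk_pi A"
  have finA: "finite A" using A finite_subset by auto
  have ln: "0 \<le> ln (real n)" using n_pos by simp
  have a\<alpha>: "?a \<le> 4 * real n * ?\<alpha>"
  proof -
    have "(\<Sum>v\<in>A. 1 / (4 * real n)) \<le> ?\<alpha>" using A pi_lower by (intro sum_mono) auto
    then show ?thesis using n_pos by (simp add: field_simps)
  qed
  have "(\<Sum>v<n. (real (degree_in E A v))\<^sup>2)
      = (\<Sum>u\<in>A. \<Sum>w\<in>A. real (card {x\<in>{..<n}. {x, u} \<in> E \<and> {x, w} \<in> E}))"
    using A by (intro sum_degree_in_squares) auto
  also have "\<dots> \<le> (\<Sum>u\<in>A. \<Sum>w\<in>A. (if u = w then 2 * (real n * p) else 0) + (2 * real n * p\<^sup>2 + 8 * ln (real n)))"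
  proof (intro sum_mono)
    fix u w assume uw: "u \<in> A" "w \<in> A"
    then have "u < n" "w < n" using A by auto
    show "real (card {x\<in>{..<n}. {x, u} \<in> E \<and> {x, w} \<in> E})
        \<le> (if u = w then 2 * (real n * p) else 0) + (2 * real n * p\<^sup>2 + 8 * ln (real n))"
    proof (cases "u = w")
      case True
      have "0 \<le> 2 * real n * p\<^sup>2 + 8 * ln (real n)" using ln by simp
      then show ?thesis using True deg_bounds(2)[OF \<open>u < n\<close>] by (simp add: degree_in_def)
    next
      case False
      then show ?thesis using pseudorandom \<open>u < n\<close> \<open>w < n\<close> by (simp add: pseudorandom_def)
    qed
  qed
  also have "\<dots> = ?a * (2 * (real n * p)) + ?a * ?a * (2 * real n * p\<^sup>2 + 8 * ln (real n))"
    using finA by (simp add: sum.distrib algebra_simps)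
  finally have sq: "(\<Sum>v<n. (real (degree_in E A v))\<^sup>2)
      \<le> ?a * (2 * (real n * p)) + ?a * ?a * (2 * real n * p\<^sup>2 + 8 * ln (real n))" .
  have "(\<Sum>v<n. walk_pi v * (walk_X A v)\<^sup>2) \<le> 4 / (real n ^ 3 * p\<^sup>2) * (\<Sum>v<n. (real (degree_in E A v))\<^sup>2)"
  proof (rule second_moment_le)
    fix v assume v: "v < n"
    show "deg v * walk_X A v = real (degree_in E A v)" using deg_pos[OF v] by (simp add: walk_X_def)
  qed
  also have "\<dots> \<le> 4 / (real n ^ 3 * p\<^sup>2)
      * (?a * (2 * (real n * p)) + ?a * ?a * (2 * real n * p\<^sup>2 + 8 * ln (real n)))"
    using sq p by (intro mult_left_mono) auto
  also have "\<dots>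
      = ?a * (8 / ((real n)\<^sup>2 * p) + 8 * ?a / (real n)\<^sup>2 + 32 * ?a * ln (real n) / (real n ^ 3 * p\<^sup>2))"
    using n_pos p by (simp add: field_simps power3_eq_cube power2_eq_square)
  also have "\<dots> \<le> (4 * real n * ?\<alpha>) * (8 / ((real n)\<^sup>2 * p) + 8 * (4 * real n * ?\<alpha>) / (real n)\<^sup>2
      + 32 * ?a * ln (real n) / (real n ^ 3 * p\<^sup>2))"
    using a\<alpha> p ln mass_bounds[OF A]
    by (intro mult_mono add_mono divide_right_mono) (auto intro!: add_nonneg_nonneg divide_nonneg_nonneg mult_nonneg_nonneg)
  also have "\<dots> = (128 * ?\<alpha> + 32 / (real n * p) + 128 * ?a * ln (real n) / (real n * p)\<^sup>2) * ?\<alpha>"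
    using n_pos p by (simp add: field_simps power3_eq_cube power2_eq_square)
  finally show ?thesis .
qed

text \<open>The logarithmic codegree term is negligible for sets of at most n^(3/4) vertices. Larger
  sets have mass at least n^(-1/4)/4, and then the additive dispersion bound of order n^(-1/2) is
  itself n^(-1/4) times the mass up to a constant; 7728 is 4 * 1932.\<close>

lemma second_moment_le_mass:
  assumes A: "A \<subseteq> {..<n}" and c: "0 < c" "c * sqrt (real n) \<le> real n * p"
  shows "(\<Sum>v<n. walk_pi v * (walk_X A v)\<^sup>2)
    \<le> (128 * sum walk_pi A + (7728 / c * real n powr (-1/4) + 32 / c * real n powr (-1/2)
        + 128 / c\<^sup>2 * real n powr (-1/4) * ln (real n))) * sum walk_pi A"
proof -
  let ?a = "real (card A)" and ?\<alpha> = "sum walk_pi A" and ?n = "real n"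
  have n: "1 \<le> ?n" using n_pos by simp
  have ln: "0 \<le> ln ?n" using n_pos by simp
  have \<alpha>: "0 \<le> ?\<alpha>" using mass_bounds[OF A] by auto
  have half: "?n powr (-1/2) = inverse (sqrt ?n)"
    using powr_minus[of ?n "1/2"] powr_half_sqrt[of ?n] by simp
  have np: "0 < c * sqrt ?n" using c n by simp
  show ?thesis
  proof (cases "?a \<le> ?n powr (3/4)")
    case True
    have "32 / (?n * p) \<le> 32 / (c * sqrt ?n)" using c np p n_pos by (intro divide_left_mono mult_pos_pos) auto
    also have "\<dots> = 32 / c * ?n powr (-1/2)" unfolding half by (simp only: divide_inverse inverse_mult_distrib mult.assoc)
    finally have 1: "32 / (?n * p) \<le> 32 / c * ?n powr (-1/2)" .
    have "128 * ?a * ln ?n / (?n * p)\<^sup>2 \<le> 128 * ?n powr (3/4) * ln ?n / (c * sqrt ?n)\<^sup>2"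
    proof (rule frac_le)
      show "128 * ?a * ln ?n \<le> 128 * ?n powr (3/4) * ln ?n" using True ln by (intro mult_right_mono) auto
      show "(c * sqrt ?n)\<^sup>2 \<le> (?n * p)\<^sup>2" using c np by (intro power_mono) auto
      show "0 < (c * sqrt ?n)\<^sup>2" using np by (rule zero_less_power)
      show "0 \<le> 128 * ?n powr (3/4) * ln ?n" using ln by (intro mult_nonneg_nonneg) auto
    qed
    also have "\<dots> = 128 / c\<^sup>2 * (?n powr (3/4) / ?n) * ln ?n"
      by (simp add: power_mult_distrib)
    also have "?n powr (3/4) / ?n = ?n powr (-1/4)"
    proof -
      have "?n powr (3/4) / ?n powr 1 = ?n powr (3/4 - 1)" by (rule powr_diff[symmetric])
      then show ?thesis using n by simp
    qed
    finally have 2: "128 * ?a * ln ?n / (?n * p)\<^sup>2 \<le> 128 / c\<^sup>2 * ?n powr (-1/4) * ln ?n" .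
    have 3: "0 \<le> 7728 / c * ?n powr (-1/4)" using c by simp
    show ?thesis
      by (rule order.trans[OF second_moment_small_set[OF A]]) (intro mult_right_mono \<alpha>, use 1 2 3 in linarith)
  next
    case False
    have "(\<Sum>v\<in>A. 1 / (4 * ?n)) \<le> ?\<alpha>" using A pi_lower by (intro sum_mono) auto
    then have "?a / (4 * ?n) \<le> ?\<alpha>" by simp
    moreover have "?n powr (3/4) / (4 * ?n) \<le> ?a / (4 * ?n)"
      using False n by (intro divide_right_mono) auto
    ultimately have *: "?n powr (3/4) / (4 * ?n) \<le> ?\<alpha>" by linarith
    have \<alpha>_ge: "?n powr (-1/4) \<le> 4 * ?\<alpha>"
    proof -
      have "?n powr (-1/4) = ?n powr (3/4) / ?n powr 1" by (subst powr_diff[symmetric]) simp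
      then show ?thesis using * n by simp
    qed
    have "(\<Sum>v<n. walk_pi v * (walk_X A v)\<^sup>2) = disp A + ?\<alpha>\<^sup>2" using disp_eq[OF A, of 0] by simp
    also have "disp A \<le> 1932 / (?n * p)" by (rule disp_le[OF A])
    also have "\<dots> \<le> 1932 / (c * sqrt ?n)" using c np p n_pos by (intro divide_left_mono mult_pos_pos) auto
    also have "\<dots> = 1932 / c * ?n powr (-1/2)" unfolding half by (simp only: divide_inverse inverse_mult_distrib mult.assoc)
    also have "?n powr (-1/2) = ?n powr (-1/4) * ?n powr (-1/4)" by (simp flip: powr_add)
    also have "1932 / c * (?n powr (-1/4) * ?n powr (-1/4)) = 1932 / c * ?n powr (-1/4) * ?n powr (-1/4)"
      by (simp only: mult.assoc)
    also have "\<dots> \<le> 1932 / c * ?n powr (-1/4) * (4 * ?\<alpha>)" using \<alpha>_ge c by (intro mult_left_mono) auto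
    finally have "(\<Sum>v<n. walk_pi v * (walk_X A v)\<^sup>2) \<le> (?\<alpha> + 7728 / c * ?n powr (-1/4)) * ?\<alpha>"
      by (simp add: algebra_simps power2_eq_square)
    also have "\<dots> \<le> (128 * ?\<alpha> + (7728 / c * ?n powr (-1/4) + 32 / c * ?n powr (-1/2)
        + 128 / c\<^sup>2 * ?n powr (-1/4) * ln ?n)) * ?\<alpha>"
      using \<alpha> c ln by (intro mult_right_mono) (auto simp: add_nonneg_nonneg)
    finally show ?thesis .
  qed
qed

end

section \<open>Lyapunov functions of Markov chains\<close>

lemma cylinder_in_sets_markov_chain:
  "{\<omega>. \<forall>i\<le>t. \<omega> i = x i} \<in> sets (markov_chain K a)" "{\<omega>. \<omega> t \<in> G} \<in> sets (markov_chain K a)"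
proof -
  have *: "{\<omega>. \<omega> i \<in> G} \<in> sets (markov_chain K a)" for i :: nat and G
  proof -
    have "(\<lambda>\<omega>. \<omega> i) \<in> PiM UNIV (\<lambda>_. count_space UNIV) \<rightarrow>\<^sub>M count_space UNIV"
      by (rule measurable_component_singleton) simp
    then have "(\<lambda>\<omega>. \<omega> i) -` G \<inter> space (PiM UNIV (\<lambda>_. count_space UNIV)) \<in> sets (PiM UNIV (\<lambda>_. count_space UNIV))"
      by (rule measurable_sets) simp
    then show ?thesis by (simp add: sets_markov_chain space_PiM vimage_def)
  qed
  show "{\<omega>. \<omega> t \<in> G} \<in> sets (markov_chain K a)" by (rule *)
  have "{\<omega>. \<forall>i\<le>t. \<omega> i = x i} = (\<Inter>i\<le>t. {\<omega>. \<omega> i \<in> {x i}})" by auto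
  also have "\<dots> \<in> sets (markov_chain K a)" by (intro sets.finite_INT *) auto
  finally show "{\<omega>. \<forall>i\<le>t. \<omega> i = x i} \<in> sets (markov_chain K a)" .
qed

text \<open>The expectation of F at time t for a chain confined to a finite \<Omega>, written with
  the cylinder probabilities of \<open>emeasure_markov_chain\<close>. Expectations then need no
  integration over the trajectory space.\<close>

definition path_sum :: "'s set \<Rightarrow> ('s \<Rightarrow> 's pmf) \<Rightarrow> 's \<Rightarrow> nat \<Rightarrow> ('s \<Rightarrow> real) \<Rightarrow> real" where
  "path_sum \<Omega> K a t F = (\<Sum>x\<in>PiE {..t} (\<lambda>_. \<Omega>).
     indicator {a} (x 0) * (\<Prod>i<t. pmf (K (x i)) (x (Suc i))) * F (x t))"

lemma path_sum_mono:
  assumes "\<And>s. s \<in> \<Omega> \<Longrightarrow> F s \<le> F' s"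
  shows "path_sum \<Omega> K a t F \<le> path_sum \<Omega> K a t F'"
  unfolding path_sum_def using assms
  by (intro sum_mono mult_left_mono mult_nonneg_nonneg prod_nonneg) (auto simp: PiE_iff)

lemma path_sum_0:
  assumes "finite \<Omega>" "a \<in> \<Omega>"
  shows "path_sum \<Omega> K a 0 F = F a"
proof -
  have "path_sum \<Omega> K a 0 F = (\<Sum>s\<in>\<Omega>. indicator {a} s * F s)"
    unfolding path_sum_def
    by (rule sum.reindex_bij_witness[where i = "\<lambda>s. (\<lambda>i\<in>{..0}. s)" and j = "\<lambda>x. x 0"])
      (auto simp: PiE_iff extensional_def fun_eq_iff)
  also have "\<dots> = F a" using assms by (simp add: indicator_def if_distrib[of "\<lambda>y. y * _"] cong: if_cong)
  finally show ?thesis .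
qed

text \<open>The Markov property in summed form: a path up to time t + 1 is a path up to time t with
  one value appended, and the sum over that value is a conditional expectation.\<close>

lemma path_sum_Suc:
  assumes "finite \<Omega>" "\<And>s. s \<in> \<Omega> \<Longrightarrow> set_pmf (K s) \<subseteq> \<Omega>"
  shows "path_sum \<Omega> K a (Suc t) F = path_sum \<Omega> K a t (\<lambda>s. measure_pmf.expectation (K s) F)"
proof -
  let ?w = "\<lambda>x. indicator {a} (x 0) * (\<Prod>i<t. pmf (K (x i)) (x (Suc i))) :: real"
  have img: "PiE {..Suc t} (\<lambda>_. \<Omega>) = (\<lambda>(y, x). x(Suc t := y)) ` (\<Omega> \<times> PiE {..t} (\<lambda>_. \<Omega>))"
    unfolding atMost_Suc by (rule PiE_insert_eq)
  have inj: "inj_on (\<lambda>(y, x). x(Suc t := y)) (\<Omega> \<times> PiE {..t} (\<lambda>_. \<Omega>))"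
    by (rule inj_combinator) auto
  have "path_sum \<Omega> K a (Suc t) F
      = (\<Sum>(y, x)\<in>\<Omega> \<times> PiE {..t} (\<lambda>_. \<Omega>). ?w x * (pmf (K (x t)) y * F y))"
    unfolding path_sum_def img sum.reindex[OF inj] o_def
    by (intro sum.cong refl) (auto intro!: prod.cong)
  also have "\<dots> = (\<Sum>x\<in>PiE {..t} (\<lambda>_. \<Omega>). \<Sum>y\<in>\<Omega>. ?w x * (pmf (K (x t)) y * F y))"
    by (subst sum.cartesian_product[symmetric]) (rule sum.swap)
  also have "\<dots> = path_sum \<Omega> K a t (\<lambda>s. measure_pmf.expectation (K s) F)"
    unfolding path_sum_def
  proof (intro sum.cong refl)
    fix x assume "x \<in> PiE {..t} (\<lambda>_. \<Omega>)"
    then have "set_pmf (K (x t)) \<subseteq> \<Omega>" using assms by auto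
    then have "measure_pmf.expectation (K (x t)) F = (\<Sum>y\<in>\<Omega>. pmf (K (x t)) y * F y)"
      using assms(1) by (subst integral_measure_pmf[of \<Omega>]) auto
    then show "(\<Sum>y\<in>\<Omega>. ?w x * (pmf (K (x t)) y * F y)) = ?w x * measure_pmf.expectation (K (x t)) F"
      by (simp add: sum_distrib_left)
  qed
  finally show ?thesis .
qed

text \<open>Different paths have disjoint cylinders, and those ending in G lie in the event on the
  right.\<close>

lemma path_sum_le_prob:
  assumes "finite \<Omega>"
  shows "path_sum \<Omega> K a t (indicator G) \<le> measure (markov_chain K a) {\<omega>. \<omega> t \<in> G}"
proof -
  interpret prob_space "markov_chain K a" by (rule prob_space_markov_chain)
  define P where "P = {x \<in> PiE {..t} (\<lambda>_. \<Omega>). x t \<in> G}"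
  let ?c = "\<lambda>x. {\<omega>. \<forall>i\<le>t. \<omega> i = x i}"
  have finP: "finite P" unfolding P_def using assms by (intro finite_subset[OF _ finite_PiE[of "{..t}" "\<lambda>_. \<Omega>"]]) auto
  have "path_sum \<Omega> K a t (indicator G) = (\<Sum>x\<in>P. indicator {a} (x 0) * (\<Prod>i<t. pmf (K (x i)) (x (Suc i))))"
    unfolding path_sum_def P_def using assms
    by (intro sum.mono_neutral_cong_right finite_PiE) (auto simp: indicator_def)
  also have "\<dots> = (\<Sum>x\<in>P. measure (markov_chain K a) (?c x))"
    by (intro sum.cong refl)
      (simp add: measure_def emeasure_markov_chain prod_nonneg)
  also have "\<dots> = measure (markov_chain K a) (\<Union>x\<in>P. ?c x)"
  proof (intro finite_measure_finite_Union[symmetric] finP)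
    show "disjoint_family_on ?c P"
      unfolding disjoint_family_on_def
    proof (intro ballI impI)
      fix x y assume xy: "x \<in> P" "y \<in> P" "x \<noteq> y"
      then have "\<exists>i\<le>t. x i \<noteq> y i" by (auto simp: P_def PiE_eq_iff extensional_def PiE_def fun_eq_iff) metis
      then show "?c x \<inter> ?c y = {}" by force
    qed
  qed (auto intro: cylinder_in_sets_markov_chain)
  also have "\<dots> \<le> measure (markov_chain K a) {\<omega>. \<omega> t \<in> G}"
    by (intro finite_measure_mono cylinder_in_sets_markov_chain) (auto simp: P_def)
  finally show ?thesis .
qed

text \<open>Iterating the contraction gives mean at most r^t \<Phi>(a) at time t. Markov's
  inequality at level b then takes the pointwise form 1 - \<Phi>/b <= indicator of G. The
  contraction is assumed at all states, also in G, so no stopping time is involved.\<close>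

lemma markov_chain_Lyapunov:
  fixes \<Phi> :: "'s \<Rightarrow> real"
  assumes \<Omega>: "finite \<Omega>" "\<And>s. s \<in> \<Omega> \<Longrightarrow> set_pmf (K s) \<subseteq> \<Omega>" "a \<in> \<Omega>"
    and r: "0 \<le> r" and b: "0 < b" "\<And>s. s \<in> \<Omega> \<Longrightarrow> 0 \<le> \<Phi> s" "\<And>s. s \<in> \<Omega> \<Longrightarrow> s \<notin> G \<Longrightarrow> b \<le> \<Phi> s"
    and contr: "\<And>s. s \<in> \<Omega> \<Longrightarrow> measure_pmf.expectation (K s) \<Phi> \<le> r * \<Phi> s"
  shows "1 - r ^ t * \<Phi> a / b \<le> measure (markov_chain K a) {\<omega>. \<omega> t \<in> G}"
proof -
  have scale: "path_sum \<Omega> K a t (\<lambda>s. c * F s) = c * path_sum \<Omega> K a t F" for t c F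
    by (simp add: path_sum_def sum_distrib_left mult_ac)
  have one: "path_sum \<Omega> K a t (\<lambda>_. 1) = 1" for t
  proof (induction t)
    case 0 then show ?case using \<Omega> by (simp add: path_sum_0)
  next
    case (Suc t) then show ?case using \<Omega> by (simp add: path_sum_Suc)
  qed
  have \<Phi>: "path_sum \<Omega> K a t \<Phi> \<le> r ^ t * \<Phi> a" for t
  proof (induction t)
    case 0 then show ?case using \<Omega> by (simp add: path_sum_0)
  next
    case (Suc t)
    have "path_sum \<Omega> K a (Suc t) \<Phi> \<le> path_sum \<Omega> K a t (\<lambda>s. r * \<Phi> s)"
      using \<Omega> by (simp add: path_sum_Suc path_sum_mono contr)
    also have "\<dots> = r * path_sum \<Omega> K a t \<Phi>" by (rule scale)
    also have "\<dots> \<le> r * (r ^ t * \<Phi> a)" using Suc r by (intro mult_left_mono)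
    finally show ?case by simp
  qed
  have "1 - r ^ t * \<Phi> a / b \<le> path_sum \<Omega> K a t (\<lambda>_. 1) - 1 / b * path_sum \<Omega> K a t \<Phi>"
    using \<Phi>[of t] b(1) by (simp add: one divide_right_mono)
  also have "\<dots> = path_sum \<Omega> K a t (\<lambda>s. 1 - 1 / b * \<Phi> s)"
    by (simp only: scale[symmetric]) (simp add: path_sum_def sum_subtractf right_diff_distrib)
  also have "\<dots> \<le> path_sum \<Omega> K a t (indicator G)"
  proof (rule path_sum_mono)
    fix s assume s: "s \<in> \<Omega>"
    show "1 - 1 / b * \<Phi> s \<le> indicator G s"
      using b(1) b(2)[OF s] b(3)[OF s] by (cases "s \<in> G") (auto simp: le_divide_eq)
  qed
  also have "\<dots> \<le> measure (markov_chain K a) {\<omega>. \<omega> t \<in> G}" by (rule path_sum_le_prob[OF \<Omega>(1)])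
  finally show ?thesis .
qed

lemma T_cons_le: "\<omega> t \<in> {{}, V} \<Longrightarrow> T_cons V \<omega> \<le> enat t"
  unfolding T_cons_def by (rule INF_lower) simp

lemma prob_T_cons_ge:
  assumes "real t \<le> b"
  shows "measure (markov_chain K a) {\<omega>. \<omega> t \<in> {{}, V}}
    \<le> measure (markov_chain K a) {\<omega>. ereal_of_enat (T_cons V \<omega>) \<le> ereal b}"
proof -
  interpret prob_space "markov_chain K a" by (rule prob_space_markov_chain)
  have "T_cons V -` {x. ereal_of_enat x \<le> ereal b} \<inter> space (PiM UNIV (\<lambda>_. count_space UNIV))
      \<in> sets (PiM UNIV (\<lambda>_. count_space UNIV))"
    using measurable_T_cons by (rule measurable_sets) simp
  then have "{\<omega>. ereal_of_enat (T_cons V \<omega>) \<le> ereal b} \<in> sets (markov_chain K a)"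
    by (simp add: sets_markov_chain space_PiM vimage_def)
  then show ?thesis
  proof (rule finite_measure_mono[rotated])
    show "{\<omega>. \<omega> t \<in> {{}, V}} \<subseteq> {\<omega>. ereal_of_enat (T_cons V \<omega>) \<le> ereal b}"
    proof
      fix \<omega> assume "\<omega> \<in> {\<omega>. \<omega> t \<in> {{}, V}}"
      then have "ereal_of_enat (T_cons V \<omega>) \<le> ereal_of_enat (enat t)"
        using T_cons_le[of \<omega> t V] by (simp only: ereal_of_enat_le_iff) simp
      also have "\<dots> \<le> ereal b" using assms by simp
      finally show "\<omega> \<in> {\<omega>. ereal_of_enat (T_cons V \<omega>) \<le> ereal b}" by simp
    qed
  qed
qed

section \<open>Consensus time\<close>

lemma map_Not_bernoulli: "0 \<le> q \<Longrightarrow> q \<le> 1 \<Longrightarrow> map_pmf Not (bernoulli_pmf q) = bernoulli_pmf (1 - q)"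
proof (rule pmf_eqI)
  fix b assume "0 \<le> q" "q \<le> 1"
  then show "pmf (map_pmf Not (bernoulli_pmf q)) b = pmf (bernoulli_pmf (1 - q)) b"
    using pmf_map_inj'[of Not "bernoulli_pmf q" "\<not> b"] by (cases b) (auto simp: inj_def)
qed

lemma mixture_bernoulli:
  assumes "0 \<le> \<rho>" "\<rho> \<le> 1" "0 \<le> q" "q \<le> 1"
  shows "bind_pmf (bernoulli_pmf \<rho>) (\<lambda>a. if a then bernoulli_pmf q else return_pmf c)
    = bernoulli_pmf (\<rho> * q + (1 - \<rho>) * of_bool c)"
proof (rule pmf_eqI)
  fix b
  have "\<rho> * q \<le> \<rho> * 1" using assms by (intro mult_left_mono) auto
  moreover have "0 \<le> \<rho> * q" using assms by simp
  ultimately have "0 \<le> \<rho> * q + (1 - \<rho>) * of_bool c" "\<rho> * q + (1 - \<rho>) * of_bool c \<le> 1"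
    using assms by (auto simp: of_bool_def)
  then show "pmf (bind_pmf (bernoulli_pmf \<rho>) (\<lambda>a. if a then bernoulli_pmf q else return_pmf c)) b
      = pmf (bernoulli_pmf (\<rho> * q + (1 - \<rho>) * of_bool c)) b"
    using assms by (cases b; cases c) (auto simp: pmf_bind algebra_simps)
qed

context pseudorandom_graph
begin

text \<open>Laziness disappears here: a vertex of A keeps its opinion with probability \<rho> (1 -
  f) + (1 - \<rho>) = 1 - \<rho> f.\<close>

lemma voting_step_conv_pi_bernoulli:
  assumes f: "\<And>x. x \<in> {0..1} \<Longrightarrow> f x \<in> {0..1}" and \<rho>: "0 \<le> \<rho>" "\<rho> \<le> 1" and A: "A \<subseteq> {..<n}"
  shows "voting_step f \<rho> {..<n} E A = map_pmf (\<lambda>s. {v \<in> {..<n}. s v})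
    (pi_bernoulli {..<n} (\<lambda>v. if v \<in> A then 1 - \<rho> * f (walk_X ({..<n} - A) v) else \<rho> * f (walk_X A v)))"
  unfolding voting_step_def pi_bernoulli_def
proof (intro arg_cong2[where f = map_pmf] refl Pi_pmf_cong)
  fix v assume v: "v \<in> {..<n}"
  have "f (walk_X B v) \<in> {0..1}" if "B \<subseteq> {..<n}" for B
    using X_nonneg[OF that v] X_le_1[OF that v] by (intro f) auto
  from this[of A] this[of "{..<n} - A"] A
  have F: "0 \<le> f (walk_X A v)" "f (walk_X A v) \<le> 1" "0 \<le> f (walk_X ({..<n} - A) v)" "f (walk_X ({..<n} - A) v) \<le> 1"
    by auto
  show "lazy_vertex_update f \<rho> {..<n} E A v
      = bernoulli_pmf (if v \<in> A then 1 - \<rho> * f (walk_X ({..<n} - A) v) else \<rho> * f (walk_X A v))"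
  proof (cases "v \<in> A")
    case True
    then show ?thesis
      using mixture_bernoulli[OF \<rho>, of "1 - f (walk_X ({..<n} - A) v)" True] F
      by (simp add: lazy_vertex_update_def vertex_update_def walk_X_def[symmetric] map_Not_bernoulli algebra_simps cong: if_cong)
  next
    case False
    then show ?thesis
      using mixture_bernoulli[OF \<rho>, of "f (walk_X A v)" False] F
      by (simp add: lazy_vertex_update_def vertex_update_def walk_X_def[symmetric] cong: if_cong)
  qed
qed

lemma prob_consensus_ge:
  assumes f: "\<And>x. x \<in> {0..1} \<Longrightarrow> f x \<in> {0..1}" and \<rho>: "0 \<le> \<rho>" "\<rho> \<le> 1" and A: "A \<subseteq> {..<n}"
    and K: "1 \<le> K" and \<delta>: "0 < \<delta>" "\<delta> < 1"
    and contr: "\<And>A. A \<subseteq> {..<n} \<Longrightarrow> measure_pmf.expectation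
         (pi_bernoulli {..<n} (\<lambda>v. if v \<in> A then 1 - \<rho> * f (walk_X ({..<n} - A) v) else \<rho> * f (walk_X A v)))
           (\<lambda>s. lyap K (real n) (sum walk_pi {v\<in>{..<n}. s v}))
         \<le> (1 - \<delta>) * lyap K (real n) (sum walk_pi A)"
  shows "1 - 4 * (real n)\<^sup>2 * (1 - \<delta>) ^ t
    \<le> measure (markov_chain (voting_step f \<rho> {..<n} E) A) {\<omega>. \<omega> t \<in> {{}, {..<n}}}"
proof -
  define \<Phi> where "\<Phi> B = lyap K (real n) (sum walk_pi B)" for B
  have \<Phi>: "0 \<le> \<Phi> B" "\<Phi> B \<le> 1" if "B \<subseteq> {..<n}" for B
    unfolding \<Phi>_def using mass_bounds[OF that] K n_pos by (intro lyap_bounds; simp)+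
  have n1: "1 \<le> real n" using n_pos by simp
  have heavy: "1 / (4 * real n) \<le> sum walk_pi B" if B: "B \<subseteq> {..<n}" "B \<noteq> {}" for B
  proof -
    obtain v where v: "v \<in> B" using B by auto
    have "1 / (4 * real n) \<le> walk_pi v" using pi_lower v B by auto
    also have "\<dots> \<le> sum walk_pi B"
      using v B pi_nonneg finite_subset[OF B(1)] by (intro member_le_sum) auto
    finally show ?thesis .
  qed
  have "1 - (1 - \<delta>) ^ t * \<Phi> A / (1 / (4 * (real n)\<^sup>2))
      \<le> measure (markov_chain (voting_step f \<rho> {..<n} E) A) {\<omega>. \<omega> t \<in> {{}, {..<n}}}"
  proof (rule markov_chain_Lyapunov[where \<Omega> = "Pow {..<n}"])
    fix B assume B: "B \<in> Pow {..<n}"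
    show "set_pmf (voting_step f \<rho> {..<n} E B) \<subseteq> Pow {..<n}" by (auto simp: voting_step_def)
    show "0 \<le> \<Phi> B" using B \<Phi> by auto
    show "measure_pmf.expectation (voting_step f \<rho> {..<n} E B) \<Phi> \<le> (1 - \<delta>) * \<Phi> B"
    proof -
      have "voting_step f \<rho> {..<n} E B = map_pmf (\<lambda>s. {v \<in> {..<n}. s v})
          (pi_bernoulli {..<n} (\<lambda>v. if v \<in> B then 1 - \<rho> * f (walk_X ({..<n} - B) v) else \<rho> * f (walk_X B v)))"
        using B f \<rho> by (intro voting_step_conv_pi_bernoulli) auto
      then show ?thesis using contr[of B] B by (simp only: integral_map_pmf \<Phi>_def Pow_iff)
    qed
    \<comment> \<open>Both opinions are then held by some vertex, and a single vertex already has
      mass 1/(4n).\<close>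
    assume "B \<notin> {{}, {..<n}}"
    then have "1 / (4 * real n) \<le> sum walk_pi B" "1 / (4 * real n) \<le> sum walk_pi ({..<n} - B)"
      using B by (auto intro!: heavy)
    then show "1 / (4 * (real n)\<^sup>2) \<le> \<Phi> B"
      unfolding \<Phi>_def using B mass_bounds[of B] mass_compl[of B] K n1 by (intro lyap_ge) auto
  qed (use A \<delta> n_pos in auto)
  moreover have "(1 - \<delta>) ^ t * \<Phi> A / (1 / (4 * (real n)\<^sup>2)) \<le> 4 * (real n)\<^sup>2 * (1 - \<delta>) ^ t"
    using \<Phi>[OF A] \<delta> mult_left_mono[of "\<Phi> A" 1 "4 * (real n)\<^sup>2 * (1 - \<delta>) ^ t"] by (simp add: mult_ac)
  ultimately show ?thesis by linarith
qed

end

theorem corollary1p14: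
  fixes f :: "real \<Rightarrow> real" and \<rho> :: real and p :: "nat \<Rightarrow> real"
  assumes "quasi_majority f"
    and "0 < \<rho>" and "\<rho> \<le> 1"
    and "\<And>n. 0 \<le> p n \<and> p n \<le> 1"
    and "p \<in> \<Omega>(\<lambda>n. 1 / sqrt (real n))"
  shows "\<exists>C>0. \<exists>c>0. \<exists>c'>0. \<forall>\<^sub>F n in sequentially.
    measure_pmf.prob (gnp n (p n))
      {E. \<forall>A\<subseteq>{..<n}.
         measure (markov_chain (voting_step f \<rho> {..<n} E) A)
           {\<omega>. ereal_of_enat (T_cons {..<n} \<omega>) \<le> ereal (C * ln (real n))}
         \<ge> 1 - real n powr (- c)}
    \<ge> 1 - real n powr (- c')"
proof -
  note \<rho> = assms(2,3)
  have f: "f x \<in> {0..1}" if "x \<in> {0..1}" for x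
    using assms(1) that by (auto simp: quasi_majority_def voting_function_def)
  obtain c where c: "0 < c" and p_ge: "\<forall>\<^sub>F n in sequentially. norm (p n) \<ge> c * norm (1 / sqrt (real n))"
    using assms(5) by (elim landau_omega.bigE)
  obtain L M where "voting_rule (\<lambda>x. \<rho> * f x) (\<lambda>x. \<rho> * deriv f x) L M"
    using quasi_majority_voting_rule[OF assms(1) \<rho>] by blast
  then interpret voting_rule "\<lambda>x. \<rho> * f x" "\<lambda>x. \<rho> * deriv f x" L M .
  have half: "0 < \<rho> * f (1/2)" "\<rho> * f (1/2) < 1"
  proof -
    have h: "0 < f (1/2)" "f (1/2) < 1" using assms(1) by (auto simp: quasi_majority_def)
    then show "0 < \<rho> * f (1/2)" using \<rho> by simp
    have "\<rho> * f (1/2) \<le> 1 * f (1/2)" using h \<rho> by (intro mult_right_mono) auto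
    then show "\<rho> * f (1/2) < 1" using h by linarith
  qed
  have end_point: "\<rho> * deriv f 0 < \<rho> * f 1"
    using quasi_majority_endpoint_derivs[OF assms(1)] \<rho> by simp
  \<comment> \<open>1932/c comes from \<open>disp_le\<close> with np >= c \<surd>n, and 128 from the
    codegree part of the second moment. The constants obtained depend on f, \<rho> and c, not on n
    or the graph.\<close>
  obtain \<delta> K \<eta> where \<delta>: "0 < \<delta>" "\<delta> < 1" and K: "1 \<le> K" and \<eta>: "0 < \<eta>"
    and contr: "\<forall>\<^sub>F N in at_top. \<forall>(V :: nat set) \<pi> X. voting_walk V \<pi> X N \<longrightarrow>
      (\<forall>A\<subseteq>V. voting_walk.disp V \<pi> X A \<le> 1932 / c / sqrt N \<and>
        (\<Sum>v\<in>V. \<pi> v * (X A v)\<^sup>2) \<le> (128 * sum \<pi> A + \<eta>) * sum \<pi> A) \<longrightarrow>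
      (\<forall>A\<subseteq>V. measure_pmf.expectation
           (pi_bernoulli V (\<lambda>v. if v \<in> A then 1 - \<rho> * f (X (V - A) v) else \<rho> * f (X A v)))
           (\<lambda>s. lyap K N (sum \<pi> {v\<in>V. s v}))
         \<le> (1 - \<delta>) * lyap K N (sum \<pi> A))"
    using lyap_contraction[OF half end_point lazy_updating_repelling[OF assms(1) \<rho>], of "1932 / c" 128] c
    by (auto simp only: zero_le_divide_iff zero_le_numeral less_imp_le)
  \<comment> \<open>After C ln n rounds the factor (1 - \<delta>)^t is of order n^-4, which leaves
    n^-2 after multiplication by 4 n^2, the inverse of the lower bound for \<open>lyap\<close> off
    consensus.\<close>
  define C where "C = 4 / \<delta>"
  have C: "0 < C" "\<delta> * C = 4" using \<delta> by (auto simp: C_def)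
  define err where "err n = 2 * real n * exp (- (c * sqrt (real n) / 128)) + exp (- real n) + 1 / (real n)\<^sup>2" for n
  have "\<forall>\<^sub>F n in sequentially. err n \<le> real n powr (-1)"
    unfolding err_def using c by real_asymp
  moreover have "\<forall>\<^sub>F n :: nat in sequentially. 7728 / c * real n powr (-1/4) + 32 / c * real n powr (-1/2)
        + 128 / c\<^sup>2 * real n powr (-1/4) * ln (real n) \<le> \<eta>"
    using c \<eta> by real_asymp
  moreover have "\<forall>\<^sub>F n :: nat in sequentially. 1 \<le> c * sqrt (real n)"
    using c by real_asymp
  moreover have "\<forall>\<^sub>F n in sequentially. 4 * (real n)\<^sup>2 * (exp \<delta> * real n powr (-4)) \<le> real n powr (-1)"
    by real_asymp
  moreover note p_ge eventually_ge_at_top[of "4 :: nat"]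
    eventually_compose_filterlim[OF contr filterlim_real_sequentially]
  ultimately have "\<forall>\<^sub>F n in sequentially.
    measure_pmf.prob (gnp n (p n))
      {E. \<forall>A\<subseteq>{..<n}.
         measure (markov_chain (voting_step f \<rho> {..<n} E) A)
           {\<omega>. ereal_of_enat (T_cons {..<n} \<omega>) \<le> ereal (C * ln (real n))}
         \<ge> 1 - real n powr (- 1)}
    \<ge> 1 - real n powr (- 1)"
  proof eventually_elim
    case (elim n)
    have n: "4 \<le> n" using elim(6) .
    have pn: "0 \<le> p n" "p n \<le> 1" using assms(4) by auto
    have np: "c * sqrt (real n) \<le> real n * p n"
    proof -
      have "c / sqrt (real n) \<le> p n" using elim(5) pn by simp
      then have "real n * (c / sqrt (real n)) \<le> real n * p n" by (intro mult_left_mono) auto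
      moreover have "real n * (c / sqrt (real n)) = c * sqrt (real n)"
      proof -
        have "real n * (c / sqrt (real n)) = c * (real n / sqrt (real n))"
          by (simp only: times_divide_eq_right mult.commute[of c])
        then show ?thesis by (simp only: real_div_sqrt of_nat_0_le_iff)
      qed
      ultimately show ?thesis by simp
    qed
    then have m: "1 \<le> real n * p n" using elim(3) by linarith
    then have p_pos: "0 < p n" using pn by (cases "p n = 0") auto
    have good: "1 - real n powr (-1) \<le> measure (markov_chain (voting_step f \<rho> {..<n} E) A)
        {\<omega>. ereal_of_enat (T_cons {..<n} \<omega>) \<le> ereal (C * ln (real n))}"
      if "pseudorandom n (p n) E" and A: "A \<subseteq> {..<n}" for E A
    proof -
      interpret G: pseudorandom_graph n "p n" E
        using that pn m p_pos by unfold_locales auto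
      \<comment> \<open>Rounding down loses less than one round; this is the factor exp \<delta>
        below.\<close>
      define t where "t = nat \<lfloor>C * ln (real n)\<rfloor>"
      have ln: "0 \<le> C * ln (real n)" using C n by simp
      have t: "real t \<le> C * ln (real n)" "C * ln (real n) - 1 \<le> real t"
        unfolding t_def using ln by linarith+
      have disp: "G.disp B \<le> 1932 / c / sqrt (real n)" if "B \<subseteq> {..<n}" for B
      proof -
        have "G.disp B \<le> 1932 / (real n * p n)" by (rule G.disp_le[OF that])
        also have "\<dots> \<le> 1932 / (c * sqrt (real n))" using np c n p_pos by (intro divide_left_mono mult_pos_pos) auto
        finally show ?thesis by simp
      qed
      have sm: "(\<Sum>v<n. G.walk_pi v * (G.walk_X B v)\<^sup>2) \<le> (128 * sum G.walk_pi B + \<eta>) * sum G.walk_pi B"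
        if "B \<subseteq> {..<n}" for B
      proof (rule order.trans[OF G.second_moment_le_mass[OF that c np]])
        show "(128 * sum G.walk_pi B + (7728 / c * real n powr (-1/4) + 32 / c * real n powr (-1/2)
            + 128 / c\<^sup>2 * real n powr (-1/4) * ln (real n))) * sum G.walk_pi B
          \<le> (128 * sum G.walk_pi B + \<eta>) * sum G.walk_pi B"
          using elim(2) G.mass_bounds[OF that] by (intro mult_right_mono add_left_mono) auto
      qed
      have step: "measure_pmf.expectation
         (pi_bernoulli {..<n} (\<lambda>v. if v \<in> B then 1 - \<rho> * f (G.walk_X ({..<n} - B) v) else \<rho> * f (G.walk_X B v)))
           (\<lambda>s. lyap K (real n) (sum G.walk_pi {v\<in>{..<n}. s v}))
         \<le> (1 - \<delta>) * lyap K (real n) (sum G.walk_pi B)" if "B \<subseteq> {..<n}" for B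
        using elim(7)[rule_format, OF G.voting_walk_axioms, of B] disp sm that by blast
      have "(1 - \<delta>) ^ t \<le> exp (- \<delta>) ^ t"
        using exp_ge_add_one_self[of "- \<delta>"] \<delta> by (intro power_mono) auto
      also have "\<dots> = exp (- (\<delta> * real t))" by (simp add: mult.commute flip: exp_of_nat_mult)
      also have "\<dots> \<le> exp (\<delta> - 4 * ln (real n))"
      proof -
        have "\<delta> * (C * ln (real n) - 1) \<le> \<delta> * real t" using t \<delta> by (intro mult_left_mono) auto
        then show ?thesis using C(2) by (simp add: right_diff_distrib flip: mult.assoc)
      qed
      also have "\<dots> = exp \<delta> * real n powr (-4)"
        using n by (simp add: powr_def exp_diff exp_minus divide_inverse)
      finally have "4 * (real n)\<^sup>2 * (1 - \<delta>) ^ t \<le> 4 * (real n)\<^sup>2 * (exp \<delta> * real n powr (-4))"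
        by (intro mult_left_mono) auto
      then have "1 - real n powr (-1) \<le> 1 - 4 * (real n)\<^sup>2 * (1 - \<delta>) ^ t" using elim(4) by linarith
      also have "\<dots> \<le> measure (markov_chain (voting_step f \<rho> {..<n} E) A) {\<omega>. \<omega> t \<in> {{}, {..<n}}}"
        using \<rho> by (intro G.prob_consensus_ge[OF f _ _ A K \<delta>] step) auto
      also have "\<dots> \<le> measure (markov_chain (voting_step f \<rho> {..<n} E) A)
          {\<omega>. ereal_of_enat (T_cons {..<n} \<omega>) \<le> ereal (C * ln (real n))}"
        by (rule prob_T_cons_ge[OF t(1)])
      finally show ?thesis .
    qed
    have "1 - real n powr (-1) \<le> 1 - err n" using elim(1) by linarith
    also have "\<dots> \<le> 1 - (2 * real n * exp (- (real n * p n / 128)) + exp (- real n) + 1 / (real n)\<^sup>2)"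
      unfolding err_def using np by (intro diff_left_mono add_right_mono mult_left_mono) auto
    also have "\<dots> \<le> measure_pmf.prob (gnp n (p n)) {E. pseudorandom n (p n) E}"
      by (rule gnp_pseudorandom[OF pn n m])
    also have "\<dots> \<le> measure_pmf.prob (gnp n (p n))
      {E. \<forall>A\<subseteq>{..<n}.
         measure (markov_chain (voting_step f \<rho> {..<n} E) A)
           {\<omega>. ereal_of_enat (T_cons {..<n} \<omega>) \<le> ereal (C * ln (real n))}
         \<ge> 1 - real n powr (- 1)}"
      using good by (intro measure_pmf.finite_measure_mono) auto
    finally show ?case .
  qed
  then show ?thesis using C by (intro exI[of _ C] exI[of _ 1] conjI) auto
qed

end
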